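(* Let $A\in\operatorname{op}^0(\Theta)$ be such that $[\Theta,A]\in\operatorname{op}^0(\Theta)$ and the bounded extension $\overline{A}^{0,0}:\mathcal H\to\mathcal H$ is self-adjoint. For $f\in C^\infty(\mathbb R)$, one has $f(A)\in\operatorname{op}^0(\Theta)$. Specifically, for every $s\in\mathbb R$ there is a constant $C_{s,A}$ such that $$\|f(A)\|_{\mathcal H^s\to\mathcal H^s}\le C_{s,A}\sum_{k=0}^{\lceil 2^{|s|}\rceil+1}\|f\|_{T^0(\mathbb R),k}.$$
   Context: Let $\mathcal H$ be a complex separable Hilbert space and $\Theta$ a positive self-adjoint, possibly unbounded, operator on $\mathcal H$ with bounded inverse. For $s\in\mathbb R$, $\mathcal H^s$ is the completion of $\operatorname{dom}\Theta^s$ in the norm $\|\xi\|_s=\|\Theta^s\xi\|$, and $\mathcal H^\infty=\bigcap_{s\ge0}\mathcal H^s$. For $r\in\mathbb R$, $\operatorname{op}^r(\Theta)$ is the set of linear operators $A:\mathcal H^\infty\to\mathcal H^\infty$ which for every $s\in\mathbb R$ extend to a bounded operator $\overline{A}^{s+r,s}:\mathcal H^{s+r}\to\mathcal H^s$. An operator $T$ on $\mathcal H$ is said to be in $\operatorname{op}^r(\Theta)$ if $\mathcal H^\infty\subseteq\operatorname{dom}T$, $T\mathcal H^\infty\subseteq\mathcal H^\infty$ and $T|_{\mathcal H^\infty}\in\operatorname{op}^r(\Theta)$. $f(A)$ denotes $f(\overline{A}^{0,0})$ defined by the continuous functional calculus on $\mathcal H$. For smooth $f:\mathbb R\to\mathbb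 C$, $\beta\in\mathbb R$ and $k\in\mathbb N=\{0,1,2,\dots\}$, $$\|f\|_{T^\beta(\mathbb R),k}=\int_{\mathbb R}|f^{(k)}(x)|\,\langle x\rangle^{k-\beta-1}\,dx,\qquad \langle x\rangle=(1+|x|^2)^{1/2}$$ (possibly infinite, in which case the estimate is vacuous). *)

theory Defs
  imports "HOL-Analysis.Analysis"
begin

section \<open>Complex Hilbert spaces and operators\<close>

class complex_hilbert = banach +
  fixes scaleC :: "complex \<Rightarrow> 'a \<Rightarrow> 'a" (infixr \<open>*\<^sub>C\<close> 75)
    and cinner :: "'a \<Rightarrow> 'a \<Rightarrow> complex"
  assumes scaleC_add_right: "c *\<^sub>C (x + y) = c *\<^sub>C x + c *\<^sub>C y"
    and scaleC_add_left: "(c + d) *\<^sub>C x = c *\<^sub>C x + d *\<^sub>C x"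
    and scaleC_scaleC: "c *\<^sub>C (d *\<^sub>C x) = (c * d) *\<^sub>C x"
    and scaleC_one: "1 *\<^sub>C x = x"
    and scaleR_scaleC: "scaleR r x = complex_of_real r *\<^sub>C x"
    and cinner_commute: "cinner x y = cnj (cinner y x)"
    and cinner_add_right: "cinner x (y + z) = cinner x y + cinner x z"
    and cinner_scaleC_right: "cinner x (c *\<^sub>C y) = c * cinner x y"
    and cinner_self: "cinner x x = complex_of_real ((norm x)\<^sup>2)"

definition bounded_clinear :: "('h::complex_hilbert \<Rightarrow> 'h) \<Rightarrow> bool" where
  "bounded_clinear T \<longleftrightarrow> bounded_linear T \<and> (\<forall>c x. T (c *\<^sub>C x) = c *\<^sub>C T x)"

text \<open>
  A possibly unbounded operator \<open>T\<close> is a partial function with domain \<open>dom T\<close>;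
  an everywhere defined operator \<open>B\<close> is turned into one as \<open>Some \<circ> B\<close>.
\<close>

definition linear_pop :: "('h::complex_hilbert \<rightharpoonup> 'h) \<Rightarrow> bool" where
  "linear_pop T \<longleftrightarrow> T 0 = Some 0
     \<and> (\<forall>x y u v. T x = Some u \<longrightarrow> T y = Some v \<longrightarrow> T (x + y) = Some (u + v))
     \<and> (\<forall>c x u. T x = Some u \<longrightarrow> T (c *\<^sub>C x) = Some (c *\<^sub>C u))"

text \<open>The right-hand side of the equivalence says that \<open>(y, z)\<close> is in the graph of the adjoint.\<close>

definition self_adjoint_pop :: "('h::complex_hilbert \<rightharpoonup> 'h) \<Rightarrow> bool" where
  "self_adjoint_pop T \<longleftrightarrow> linear_pop T \<and> closure (dom T) = UNIV
     \<and> (\<forall>y z. T y = Some z \<longleftrightarrow> (\<forall>x\<in>dom T. cinner y (the (T x)) = cinner z x))"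

definition positive_pop :: "('h::complex_hilbert \<rightharpoonup> 'h) \<Rightarrow> bool" where
  "positive_pop T \<longleftrightarrow>
     (\<forall>x\<in>dom T. Im (cinner x (the (T x))) = 0 \<and> Re (cinner x (the (T x))) \<ge> 0)"

definition inverse_pop :: "('h \<rightharpoonup> 'h) \<Rightarrow> ('h \<rightharpoonup> 'h)" where
  "inverse_pop T = (\<lambda>y. if \<exists>x. T x = Some y then Some (THE x. T x = Some y) else None)"

definition has_bounded_inverse :: "('h::complex_hilbert \<rightharpoonup> 'h) \<Rightarrow> bool" where
  "has_bounded_inverse T \<longleftrightarrow> inj_on T (dom T) \<and> ran T = UNIV
     \<and> bounded_clinear (\<lambda>y. the (inverse_pop T y))"

text \<open>\<open>S T - T S\<close> on its natural domain.\<close>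

definition commutator_pop ::
    "('h::complex_hilbert \<rightharpoonup> 'h) \<Rightarrow> ('h \<rightharpoonup> 'h) \<Rightarrow> ('h \<rightharpoonup> 'h)" where
  "commutator_pop S T = (\<lambda>x. if x \<in> dom (S \<circ>\<^sub>m T) \<inter> dom (T \<circ>\<^sub>m S)
     then Some (the ((S \<circ>\<^sub>m T) x) - the ((T \<circ>\<^sub>m S) x)) else None)"


section \<open>Continuous functional calculus\<close>

definition op_spectrum :: "('h::complex_hilbert \<Rightarrow> 'h) \<Rightarrow> complex set" where
  "op_spectrum T = {z. \<not> (\<exists>S. bounded_clinear S
     \<and> (\<forall>x. S (T x - z *\<^sub>C x) = x) \<and> (\<forall>x. T (S x) - z *\<^sub>C S x = x))}"

definition poly_op :: "complex poly \<Rightarrow> ('h::complex_hilbert \<Rightarrow> 'h) \<Rightarrow> 'h \<Rightarrow> 'h" where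
  "poly_op p T x = (\<Sum>i\<le>degree p. coeff p i *\<^sub>C (T ^^ i) x)"

text \<open>
  For bounded self-adjoint \<open>T\<close>, whose spectrum is real, and \<open>f\<close> continuous on the spectrum,
  \<open>cfc T f\<close> is the limit in operator norm of \<open>p\<^sub>n(T)\<close> for any polynomials \<open>p\<^sub>n\<close>
  converging to \<open>f\<close> uniformly on the spectrum.
\<close>

definition cfc :: "('h::complex_hilbert \<Rightarrow> 'h) \<Rightarrow> (real \<Rightarrow> complex) \<Rightarrow> ('h \<Rightarrow> 'h)" where
  "cfc T f = (THE B. bounded_clinear B \<and>
     (\<forall>p. uniform_limit {t. complex_of_real t \<in> op_spectrum T}
            (\<lambda>n t. poly (p n) (complex_of_real t)) f sequentially
          \<longrightarrow> (\<lambda>n. onorm (\<lambda>x. poly_op (p n) T x - B x)) \<longlonglongrightarrow> 0))"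


section \<open>Real powers and the associated scale of spaces\<close>

text \<open>
  For \<open>\<Theta>\<close> positive self-adjoint with bounded inverse: \<open>\<Theta>\<^sup>-\<^sup>s\<close> for \<open>s > 0\<close> is the bounded operator
  \<open>(\<Theta>\<^sup>-\<^sup>1)\<^sup>s\<close>, and \<open>\<Theta>\<^sup>s\<close> is its inverse, defined on its range. The case \<open>s = 0\<close> is
  separate because \<open>0 powr 0 = 0\<close>, while \<open>0\<close> may be in the spectrum of \<open>\<Theta>\<^sup>-\<^sup>1\<close>.
\<close>

definition pow_pop :: "('h::complex_hilbert \<rightharpoonup> 'h) \<Rightarrow> real \<Rightarrow> ('h \<rightharpoonup> 'h)" where
  "pow_pop \<Theta> s =
     (let R = (\<lambda>y. the (inverse_pop \<Theta> y));
          P = (\<lambda>a. Some \<circ> cfc R (\<lambda>t. complex_of_real (t powr a)))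
      in if s = 0 then Some else if s < 0 then P (- s) else inverse_pop (P s))"

definition sob_pnorm :: "('h::complex_hilbert \<rightharpoonup> 'h) \<Rightarrow> real \<Rightarrow> 'h \<Rightarrow> real" where
  "sob_pnorm \<Theta> s x = norm (the (pow_pop \<Theta> s x))"

text \<open>
  \<open>sob \<Theta> s\<close> is the completion of \<open>dom \<Theta>\<^sup>s\<close> in the norm \<open>sob_pnorm \<Theta> s\<close>:
  Cauchy sequences modulo null sequences.
\<close>

definition sob_cauchy :: "('h::complex_hilbert \<rightharpoonup> 'h) \<Rightarrow> real \<Rightarrow> (nat \<Rightarrow> 'h) set" where
  "sob_cauchy \<Theta> s = {X. range X \<subseteq> dom (pow_pop \<Theta> s)
     \<and> (\<forall>e>0. \<exists>N. \<forall>m\<ge>N. \<forall>n\<ge>N. sob_pnorm \<Theta> s (X m - X n) < e)}"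

definition sob_rel ::
    "('h::complex_hilbert \<rightharpoonup> 'h) \<Rightarrow> real \<Rightarrow> ((nat \<Rightarrow> 'h) \<times> (nat \<Rightarrow> 'h)) set" where
  "sob_rel \<Theta> s = {(X, Y). X \<in> sob_cauchy \<Theta> s \<and> Y \<in> sob_cauchy \<Theta> s
     \<and> (\<lambda>n. sob_pnorm \<Theta> s (X n - Y n)) \<longlonglongrightarrow> 0}"

definition sob :: "('h::complex_hilbert \<rightharpoonup> 'h) \<Rightarrow> real \<Rightarrow> (nat \<Rightarrow> 'h) set set" where
  "sob \<Theta> s = sob_cauchy \<Theta> s // sob_rel \<Theta> s"

definition sob_emb :: "('h::complex_hilbert \<rightharpoonup> 'h) \<Rightarrow> real \<Rightarrow> 'h \<Rightarrow> (nat \<Rightarrow> 'h) set" where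
  "sob_emb \<Theta> s x = sob_rel \<Theta> s `` {\<lambda>_. x}"

definition sob_add :: "('h::complex_hilbert \<rightharpoonup> 'h) \<Rightarrow> real \<Rightarrow>
    (nat \<Rightarrow> 'h) set \<Rightarrow> (nat \<Rightarrow> 'h) set \<Rightarrow> (nat \<Rightarrow> 'h) set" where
  "sob_add \<Theta> s a b = (\<Union>X\<in>a. \<Union>Y\<in>b. sob_rel \<Theta> s `` {\<lambda>n. X n + Y n})"

definition sob_scale :: "('h::complex_hilbert \<rightharpoonup> 'h) \<Rightarrow> real \<Rightarrow>
    complex \<Rightarrow> (nat \<Rightarrow> 'h) set \<Rightarrow> (nat \<Rightarrow> 'h) set" where
  "sob_scale \<Theta> s c a = (\<Union>X\<in>a. sob_rel \<Theta> s `` {\<lambda>n. c *\<^sub>C X n})"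

definition sob_norm :: "('h::complex_hilbert \<rightharpoonup> 'h) \<Rightarrow> real \<Rightarrow> (nat \<Rightarrow> 'h) set \<Rightarrow> real" where
  "sob_norm \<Theta> s a = (THE l. \<forall>X\<in>a. (\<lambda>n. sob_pnorm \<Theta> s (X n)) \<longlonglongrightarrow> l)"

text \<open>
  For \<open>s \<ge> 0\<close> the inclusion of \<open>dom \<Theta>\<^sup>s\<close> in the Hilbert space extends to an injection of
  \<open>sob \<Theta> s\<close>, whose range is the set intersected over below.
\<close>

definition sob_infty :: "('h::complex_hilbert \<rightharpoonup> 'h) \<Rightarrow> 'h set" where
  "sob_infty \<Theta> = (\<Inter>s\<in>{0..}. {x. \<exists>X\<in>sob_cauchy \<Theta> s. X \<longlonglongrightarrow> x})"


section \<open>Operators on the scale\<close>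

definition sob_bounded :: "('h::complex_hilbert \<rightharpoonup> 'h) \<Rightarrow> real \<Rightarrow> real \<Rightarrow>
    ((nat \<Rightarrow> 'h) set \<Rightarrow> (nat \<Rightarrow> 'h) set) \<Rightarrow> bool" where
  "sob_bounded \<Theta> a b B \<longleftrightarrow> B \<in> sob \<Theta> a \<rightarrow>\<^sub>E sob \<Theta> b
     \<and> (\<forall>x\<in>sob \<Theta> a. \<forall>y\<in>sob \<Theta> a. B (sob_add \<Theta> a x y) = sob_add \<Theta> b (B x) (B y))
     \<and> (\<forall>c. \<forall>x\<in>sob \<Theta> a. B (sob_scale \<Theta> a c x) = sob_scale \<Theta> b c (B x))
     \<and> (\<exists>C. \<forall>x\<in>sob \<Theta> a. sob_norm \<Theta> b (B x) \<le> C * sob_norm \<Theta> a x)"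

definition sob_onorm :: "('h::complex_hilbert \<rightharpoonup> 'h) \<Rightarrow> real \<Rightarrow> real \<Rightarrow>
    ((nat \<Rightarrow> 'h) set \<Rightarrow> (nat \<Rightarrow> 'h) set) \<Rightarrow> real" where
  "sob_onorm \<Theta> a b B =
     Inf {C. 0 \<le> C \<and> (\<forall>x\<in>sob \<Theta> a. sob_norm \<Theta> b (B x) \<le> C * sob_norm \<Theta> a x)}"

definition is_sob_ext :: "('h::complex_hilbert \<rightharpoonup> 'h) \<Rightarrow> real \<Rightarrow> real \<Rightarrow> ('h \<rightharpoonup> 'h) \<Rightarrow>
    ((nat \<Rightarrow> 'h) set \<Rightarrow> (nat \<Rightarrow> 'h) set) \<Rightarrow> bool" where
  "is_sob_ext \<Theta> a b T B \<longleftrightarrow> sob_bounded \<Theta> a b B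
     \<and> (\<forall>x\<in>sob_infty \<Theta>. B (sob_emb \<Theta> a x) = sob_emb \<Theta> b (the (T x)))"

text \<open>The bounded extension is unique because \<open>sob_infty \<Theta>\<close> is dense in \<open>sob \<Theta> a\<close>.\<close>

definition sob_ext :: "('h::complex_hilbert \<rightharpoonup> 'h) \<Rightarrow> real \<Rightarrow> real \<Rightarrow> ('h \<rightharpoonup> 'h) \<Rightarrow>
    ((nat \<Rightarrow> 'h) set \<Rightarrow> (nat \<Rightarrow> 'h) set)" where
  "sob_ext \<Theta> a b T = (THE B. is_sob_ext \<Theta> a b T B)"

definition op_class :: "('h::complex_hilbert \<rightharpoonup> 'h) \<Rightarrow> real \<Rightarrow> ('h \<rightharpoonup> 'h) set" where
  "op_class \<Theta> r = {A. dom A = sob_infty \<Theta> \<and> ran A \<subseteq> sob_infty \<Theta> \<and> linear_pop A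
     \<and> (\<forall>s. \<exists>B. is_sob_ext \<Theta> (s + r) s A B)}"

definition in_op :: "('h::complex_hilbert \<rightharpoonup> 'h) \<Rightarrow> real \<Rightarrow> ('h \<rightharpoonup> 'h) \<Rightarrow> bool" where
  "in_op \<Theta> r T \<longleftrightarrow> sob_infty \<Theta> \<subseteq> dom T
     \<and> (\<forall>x\<in>sob_infty \<Theta>. the (T x) \<in> sob_infty \<Theta>)
     \<and> T |` sob_infty \<Theta> \<in> op_class \<Theta> r"

text \<open>
  The extension of \<open>A\<close> to the Hilbert space itself, which is identified with its
  own completion \<open>sob \<Theta> 0\<close> by the bijection \<open>sob_emb \<Theta> 0\<close>.
\<close>

definition hilbert_ext :: "('h::complex_hilbert \<rightharpoonup> 'h) \<Rightarrow> ('h \<rightharpoonup> 'h) \<Rightarrow> ('h \<Rightarrow> 'h)" where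
  "hilbert_ext \<Theta> A = inv (sob_emb \<Theta> 0) \<circ> sob_ext \<Theta> 0 0 A \<circ> sob_emb \<Theta> 0"


section \<open>Smooth functions and weighted norms of derivatives\<close>

definition nth_deriv :: "nat \<Rightarrow> (real \<Rightarrow> complex) \<Rightarrow> (real \<Rightarrow> complex)" where
  "nth_deriv k f = ((\<lambda>g x. vector_derivative g (at x)) ^^ k) f"

definition smooth_real :: "(real \<Rightarrow> complex) \<Rightarrow> bool" where
  "smooth_real f \<longleftrightarrow> (\<forall>k x. nth_deriv k f differentiable (at x))"

definition T_norm :: "real \<Rightarrow> nat \<Rightarrow> (real \<Rightarrow> complex) \<Rightarrow> ennreal" where
  "T_norm \<beta> k f =
     (\<integral>\<^sup>+x. ennreal (norm (nth_deriv k f x) * sqrt (1 + \<bar>x\<bar>\<^sup>2) powr (real k - \<beta> - 1)) \<partial>lborel)"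

end

theory Submission
  imports Defs "HOL-Computational_Algebra.Fundamental_Theorem_Algebra"
begin

text \<open>
  The spectrum of the bounded self-adjoint operator \<open>T\<close>, the extension of \<open>A\<close>, lies in a compact
  interval \<open>[-L/2, L/2]\<close>, and the constant may depend on \<open>A\<close>. Hence only the restriction of \<open>f\<close> to
  \<open>[-L, L]\<close> matters, where all weights in the norms of \<open>f\<close> are comparable to \<open>1\<close>, and \<open>f\<close> may be
  expanded there in Chebyshev polynomials, \<open>f = \<Sum>\<^sub>k c\<^sub>k T\<^sub>k(x / L)\<close>. This takes the place of an
  almost analytic extension of \<open>f\<close>: it turns \<open>f(T)\<close> into the series \<open>\<Sum>\<^sub>k c\<^sub>k T\<^sub>k(T / L)\<close> of polynomials
  of \<open>T\<close>, and the estimate into a competition between the decay of \<open>c\<^sub>k\<close> and the growth of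
  \<open>T\<^sub>k(T / L)\<close> on the Sobolev space of index \<open>n\<close>.

  Decay (\<open>chebc_weighted\<close>): with \<open>x = L cos \<theta>\<close> the \<open>c\<^sub>k\<close> are cosine coefficients, and \<open>m\<close> integrations by
  parts give \<open>|c\<^sub>k| = O(k\<^sup>-\<^sup>m)\<close> with the \<open>L\<^sup>1\<close> norm of the \<open>m\<close>-th derivative of \<open>f\<close>.

  Growth (\<open>tT_growth\<close>): \<open>\<Theta>\<^sup>n T\<^sub>k(T / L) x\<close> satisfies the three-term recursion of the Chebyshev
  polynomials up to the inhomogeneity \<open>[\<Theta>\<^sup>n, T] T\<^sub>k(T / L) x\<close>. The commutator \<open>[\<Theta>\<^sup>n, T]\<close> is a sum of
  terms \<open>\<Theta>\<^sup>i [\<Theta>, T] \<Theta>\<^bsup>n-1-i\<^esup>\<close> and therefore has order \<open>n - 1\<close>. Since the polynomials of the second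
  kind are bounded on \<open>[-L/2, L/2]\<close>, variation of constants shows by induction on \<open>n\<close> that the
  norms are \<open>O((k + 1)\<^sup>n)\<close>. So \<open>n + 2\<close> derivatives suffice for the space of index \<open>n\<close>.

  For real \<open>s\<close> put \<open>n = \<lceil>|s|\<rceil>\<close>; then \<open>n + 1 \<le> \<lceil>2\<^bsup>|s|\<^esup>\<rceil>\<close>, which leaves enough derivatives. Indices
  between \<open>0\<close> and \<open>n\<close> follow by quadratic interpolation (\<open>sob_bd_midpoint\<close>,
  \<open>sob_bd_interpolate\<close>), negative ones by duality (\<open>sob_bd_dual\<close>), because \<open>f(T)\<^sup>* = f\<^sup>*(T)\<close> for
  the complex conjugate \<open>f\<^sup>*\<close> of \<open>f\<close>.

  Two preparations are needed. The continuous functional calculus of a bounded self-adjoint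
  operator rests on \<open>\<parallel>p(T)\<parallel> \<le> sup |p|\<close> over the spectrum (\<open>poly_op_norm_le\<close>); it also provides the
  powers \<open>R\<^sup>a\<close> of \<open>R = \<Theta>\<^sup>-\<^sup>1\<close>. And all estimates are made on the space of smooth vectors, which every
  power of \<open>\<Theta>\<close> maps bijectively onto itself and which is dense (\<open>Hinf_dense\<close>); each completion is
  an isometric copy of the Hilbert space itself, via the extension of \<open>\<Theta>\<^sup>s\<close>, and so
  estimates on smooth vectors become statements about bounded extensions (\<open>sob_ext_exists\<close>).
\<close>

section \<open>Inner product and bounded operators\<close>

lemma scaleC_zero_left [simp]: "0 *\<^sub>C (x::'h::complex_hilbert) = 0"
proof -
  have "(0 + 0) *\<^sub>C x = 0 *\<^sub>C x + 0 *\<^sub>C x" by (rule scaleC_add_left)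
  then show ?thesis by simp
qed

lemma scaleC_zero_right [simp]: "c *\<^sub>C (0::'h::complex_hilbert) = 0"
proof -
  have "c *\<^sub>C (0 + 0::'h) = c *\<^sub>C 0 + c *\<^sub>C 0" by (rule scaleC_add_right)
  then show ?thesis by simp
qed

lemma scaleC_minus_left [simp]: "(- c) *\<^sub>C (x::'h::complex_hilbert) = - (c *\<^sub>C x)"
  by (metis add.right_inverse add_eq_0_iff scaleC_add_left scaleC_zero_left)

lemma scaleC_minus_right [simp]: "c *\<^sub>C (- (x::'h::complex_hilbert)) = - (c *\<^sub>C x)"
  by (metis add.right_inverse add_eq_0_iff scaleC_add_right scaleC_zero_right)

lemma scaleC_diff_left: "(c - d) *\<^sub>C (x::'h::complex_hilbert) = c *\<^sub>C x - d *\<^sub>C x"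
  using scaleC_add_left[of c "- d" x] by simp

lemma scaleC_diff_right: "c *\<^sub>C (x - y::'h::complex_hilbert) = c *\<^sub>C x - c *\<^sub>C y"
  using scaleC_add_right[of c x "- y"] by simp

lemma scaleC_one' [simp]: "1 *\<^sub>C (x::'h::complex_hilbert) = x" by (rule scaleC_one)

lemma scaleC_sum: "c *\<^sub>C (\<Sum>i\<in>I. (x i::'h::complex_hilbert)) = (\<Sum>i\<in>I. c *\<^sub>C x i)"
  by (induction I rule: infinite_finite_induct) (auto simp: scaleC_add_right)

lemma cinner_zero_right [simp]: "cinner (x::'h::complex_hilbert) 0 = 0"
  using cinner_scaleC_right[of x 0 0] by simp

lemma cinner_add_left: "cinner (x + y) (z::'h::complex_hilbert) = cinner x z + cinner y z"
  by (metis cinner_add_right cinner_commute complex_cnj_add)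

lemma cinner_scaleC_left: "cinner (c *\<^sub>C x) (y::'h::complex_hilbert) = cnj c * cinner x y"
  by (metis cinner_commute cinner_scaleC_right complex_cnj_mult)

lemma cinner_zero_left [simp]: "cinner 0 (x::'h::complex_hilbert) = 0"
  using cinner_scaleC_left[of 0 0 x] by simp

lemma cinner_minus_right [simp]: "cinner x (- (y::'h::complex_hilbert)) = - cinner x y"
  using cinner_scaleC_right[of x "-1" y] by simp

lemma cinner_minus_left [simp]: "cinner (- x) (y::'h::complex_hilbert) = - cinner x y"
  using cinner_scaleC_left[of "-1" x y] by simp

lemma cinner_diff_right: "cinner x (y - (z::'h::complex_hilbert)) = cinner x y - cinner x z"
  using cinner_add_right[of x y "- z"] by simp

lemma cinner_diff_left: "cinner (x - y) (z::'h::complex_hilbert) = cinner x z - cinner y z"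
  using cinner_add_left[of x "- y" z] by simp

lemma norm_sq_cinner: "(norm (x::'h::complex_hilbert))\<^sup>2 = Re (cinner x x)"
  by (simp add: cinner_self)

lemma norm_scaleC [simp]: "norm (c *\<^sub>C (x::'h::complex_hilbert)) = cmod c * norm x"
proof -
  have "complex_of_real ((norm (c *\<^sub>C x))\<^sup>2) = cnj c * (c * complex_of_real ((norm x)\<^sup>2))"
    by (metis cinner_self cinner_scaleC_left cinner_scaleC_right)
  also have "\<dots> = complex_of_real ((cmod c)\<^sup>2 * (norm x)\<^sup>2)"
    by (metis complex_norm_square mult.assoc mult.commute of_real_mult)
  finally have "(norm (c *\<^sub>C x))\<^sup>2 = (cmod c * norm x)\<^sup>2"
    by (simp only: of_real_eq_iff power_mult_distrib)
  then show ?thesis by (simp add: power2_eq_iff_nonneg)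
qed

lemma norm_diff_sq:
  "(norm (x - (y::'h::complex_hilbert)))\<^sup>2 = (norm x)\<^sup>2 - 2 * Re (cinner x y) + (norm y)\<^sup>2"
proof -
  have "Re (cinner y x) = Re (cinner x y)" by (subst cinner_commute) simp
  then show ?thesis
    by (simp add: norm_sq_cinner cinner_diff_left cinner_diff_right)
qed

lemma Re_cinner_le: "Re (cinner x (y::'h::complex_hilbert)) \<le> norm x * norm y"
proof -
  define a b where "a = norm x" and "b = norm y"
  have "0 \<le> (norm (complex_of_real b *\<^sub>C x - complex_of_real a *\<^sub>C y))\<^sup>2" by simp
  also have "\<dots> = (b * a)\<^sup>2 - 2 * (b * (a * Re (cinner x y))) + (a * b)\<^sup>2"
    unfolding norm_diff_sq by (simp add: cinner_scaleC_left cinner_scaleC_right a_def b_def)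
  finally have h: "(a * b) * Re (cinner x y) \<le> (a * b) * (a * b)"
    by (simp add: power2_eq_square algebra_simps)
  show ?thesis
  proof (cases "a * b = 0")
    case True
    then have "x = 0 \<or> y = 0" by (auto simp: a_def b_def)
    then show ?thesis by auto
  next
    case False
    then have "a * b > 0" unfolding a_def b_def by (simp add: zero_less_mult_iff)
    then have "Re (cinner x y) \<le> a * b" using h mult_le_cancel_left_pos by blast
    then show ?thesis by (simp add: a_def b_def)
  qed
qed

lemma cinner_cauchy_schwarz: "cmod (cinner x (y::'h::complex_hilbert)) \<le> norm x * norm y"
proof (cases "cinner x y = 0")
  case False
  define u where "u = cnj (sgn (cinner x y))"
  have u: "cmod u = 1" using False by (simp add: u_def norm_sgn)
  have "u * cinner x y = of_real (cmod (cinner x y))"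
    using False complex_norm_square[of "cinner x y"]
    by (simp add: u_def sgn_eq field_simps power2_eq_square)
  then have "cmod (cinner x y) = Re (cinner x (u *\<^sub>C y))"
    by (simp add: cinner_scaleC_right)
  also have "\<dots> \<le> norm x * norm (u *\<^sub>C y)" by (rule Re_cinner_le)
  finally show ?thesis using u by simp
qed auto

lemma bounded_clinearI:
  assumes "\<And>x y. T (x + y) = T x + T y" "\<And>c x. T (c *\<^sub>C x) = c *\<^sub>C T x"
    "\<And>x. norm (T x) \<le> K * norm (x::'h::complex_hilbert)"
  shows "bounded_clinear T"
  unfolding bounded_clinear_def
proof (intro conjI allI assms(2))
  show "bounded_linear T"
    by (rule bounded_linear_intro[where K = K])
      (use assms in \<open>auto simp: scaleR_scaleC mult.commute\<close>)
qed

lemma bounded_clinear_bl: "bounded_clinear T \<Longrightarrow> bounded_linear T"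
  by (simp add: bounded_clinear_def)

lemma bounded_clinear_scaleC: "bounded_clinear T \<Longrightarrow> T (c *\<^sub>C x) = c *\<^sub>C T x"
  by (simp add: bounded_clinear_def)

lemma bounded_clinear_add: "bounded_clinear T \<Longrightarrow> T (x + y) = T x + T y"
  using bounded_clinear_bl linear_add bounded_linear.linear by blast

lemma bounded_clinear_diff: "bounded_clinear T \<Longrightarrow> T (x - y) = T x - T y"
  using bounded_clinear_bl linear_diff bounded_linear.linear by blast

lemma bounded_clinear_zero [simp]: "bounded_clinear T \<Longrightarrow> T 0 = 0"
  using bounded_clinear_bl linear_0 bounded_linear.linear by blast

lemma bounded_clinear_sum: "bounded_clinear T \<Longrightarrow> T (\<Sum>i\<in>I. x i) = (\<Sum>i\<in>I. T (x i))"
  using bounded_clinear_bl linear_sum bounded_linear.linear by blast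

lemma bounded_clinear_bound: "bounded_clinear T \<Longrightarrow> \<exists>K>0. \<forall>x. norm (T x) \<le> K * norm x"
  using bounded_linear.pos_bounded[OF bounded_clinear_bl] by (metis mult.commute)

lemma bounded_clinear_tendsto:
  "bounded_clinear T \<Longrightarrow> (X \<longlongrightarrow> x) F \<Longrightarrow> ((\<lambda>n. T (X n)) \<longlongrightarrow> T x) F"
  using bounded_linear.tendsto bounded_clinear_bl by blast

lemma bounded_clinear_id: "bounded_clinear (\<lambda>x::'h::complex_hilbert. x)"
  by (rule bounded_clinearI[where K = 1]) auto

lemma bounded_clinear_zero_op: "bounded_clinear (\<lambda>x::'h::complex_hilbert. 0)"
  by (rule bounded_clinearI[where K = 0]) auto

lemma bounded_clinear_comp:
  assumes "bounded_clinear S" "bounded_clinear T"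
  shows "bounded_clinear (\<lambda>x. S (T x))"
  using assms unfolding bounded_clinear_def by (auto intro: bounded_linear_compose)

lemma bounded_clinear_plus:
  assumes "bounded_clinear S" "bounded_clinear T"
  shows "bounded_clinear (\<lambda>x. S x + T x)"
  using assms unfolding bounded_clinear_def
  by (auto intro: bounded_linear_add simp: scaleC_add_right)

lemma bounded_clinear_scale:
  assumes "bounded_clinear S"
  shows "bounded_clinear (\<lambda>x. c *\<^sub>C S x)"
proof -
  obtain K where "\<And>x. norm (S x) \<le> K * norm x" using bounded_clinear_bound[OF assms] by auto
  then show ?thesis
    by (intro bounded_clinearI[where K = "cmod c * K"])
      (auto simp: bounded_clinear_add[OF assms] bounded_clinear_scaleC[OF assms]
        scaleC_add_right scaleC_scaleC mult.commute[of c] mult.assoc mult_left_mono)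
qed

lemma bounded_clinear_minus:
  assumes "bounded_clinear S" "bounded_clinear T"
  shows "bounded_clinear (\<lambda>x. S x - T x)"
  using bounded_clinear_plus[OF assms(1) bounded_clinear_scale[OF assms(2), of "-1"]] by simp

lemma bounded_clinear_shift:
  "bounded_clinear T \<Longrightarrow> bounded_clinear (\<lambda>x. T x - z *\<^sub>C x)"
  by (intro bounded_clinear_minus bounded_clinear_scale bounded_clinear_id)

lemma onorm_bounded_clinear: "bounded_clinear T \<Longrightarrow> norm (T x) \<le> onorm T * norm x"
  using onorm bounded_clinear_bl by blast


section \<open>Invertibility and spectra\<close>

definition cinvertible :: "('h::complex_hilbert \<Rightarrow> 'h) \<Rightarrow> bool" where
  "cinvertible T \<longleftrightarrow> (\<exists>S. bounded_clinear S \<and> (\<forall>x. S (T x) = x) \<and> (\<forall>x. T (S x) = x))"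

lemma op_spectrum_cinvertible: "z \<in> op_spectrum T \<longleftrightarrow> \<not> cinvertible (\<lambda>x. T x - z *\<^sub>C x)"
  by (simp add: op_spectrum_def cinvertible_def)

lemma cinvertible_comp:
  assumes "cinvertible S" "cinvertible T"
  shows "cinvertible (\<lambda>x. S (T x))"
proof -
  obtain S' T' where "bounded_clinear S'" "\<forall>x. S' (S x) = x" "\<forall>x. S (S' x) = x"
    "bounded_clinear T'" "\<forall>x. T' (T x) = x" "\<forall>x. T (T' x) = x"
    using assms unfolding cinvertible_def by blast
  then show ?thesis unfolding cinvertible_def
    by (intro exI[of _ "\<lambda>x. T' (S' x)"]) (auto intro: bounded_clinear_comp)
qed

lemma cinvertible_of_bounded_below:
  assumes T: "bounded_clinear T" and c: "c > 0" "\<And>x. norm (T x) \<ge> c * norm x" and surj: "surj T"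
  shows "cinvertible T"
proof -
  have inj: "inj T"
  proof (rule injI)
    fix x y assume "T x = T y"
    then have "T (x - y) = 0" by (simp add: bounded_clinear_diff[OF T])
    then have "c * norm (x - y) \<le> 0" using c(2)[of "x - y"] by simp
    then show "x = y" using c(1) by (simp add: mult_le_0_iff)
  qed
  define S where "S = inv T"
  have TS: "T (S x) = x" for x using surj by (simp add: S_def surj_f_inv_f)
  have ST: "S (T x) = x" for x using inj by (simp add: S_def)
  have "bounded_clinear S"
  proof (rule bounded_clinearI[where K = "1 / c"])
    show "S (x + y) = S x + S y" for x y by (metis TS ST bounded_clinear_add[OF T])
    show "S (z *\<^sub>C x) = z *\<^sub>C S x" for z x by (metis TS ST bounded_clinear_scaleC[OF T])
    show "norm (S x) \<le> 1 / c * norm x" for x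
      using c(2)[of "S x"] c(1) by (simp add: TS field_simps)
  qed
  then show ?thesis unfolding cinvertible_def using TS ST by blast
qed

text \<open>The equation \<open>T x + E x = y\<close> is the fixed point equation \<open>x = T\<^sup>-\<^sup>1 (y - E x)\<close> of a
  contraction, so that invertibility survives perturbations smaller than the lower bound.\<close>

lemma cinvertible_perturb:
  assumes T: "bounded_clinear T" "cinvertible T" and c: "\<And>x. norm (T x) \<ge> c * norm x"
    and E: "bounded_clinear E" "\<And>x. norm (E x) \<le> q * norm x" and q: "0 \<le> q" "q < c"
  shows "cinvertible (\<lambda>x. T x + E x)"
proof (rule cinvertible_of_bounded_below[where c = "c - q"])
  show "bounded_clinear (\<lambda>x. T x + E x)" using T E by (intro bounded_clinear_plus)
  show "c - q > 0" using q by simp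
  show "norm (T x + E x) \<ge> (c - q) * norm x" for x
  proof -
    have "norm (T x) \<le> norm (T x + E x) + norm (E x)"
      by (metis add_diff_cancel norm_triangle_ineq4)
    then show ?thesis using c[of x] E(2)[of x] by (simp add: algebra_simps)
  qed
  obtain S where S: "bounded_clinear S" "\<And>x. S (T x) = x" "\<And>x. T (S x) = x"
    using T(2) unfolding cinvertible_def by blast
  have Sb: "norm (S x) \<le> norm x / c" for x
    using c[of "S x"] q by (simp add: S field_simps)
  show "surj (\<lambda>x. T x + E x)"
  proof (rule surjI)
    fix y
    have "\<exists>!x. S (y - E x) = x"
    proof (rule banach_fix_type[where c = "q / c"])
      show "0 \<le> q / c" "q / c < 1" using q by auto
      show "\<forall>x x'. dist (S (y - E x)) (S (y - E x')) \<le> q / c * dist x x'"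
      proof (intro allI)
        fix x x'
        have "S (y - E x) - S (y - E x') = S (E (x' - x))"
          by (simp add: bounded_clinear_diff[OF S(1), symmetric] bounded_clinear_diff[OF E(1)])
        then have "dist (S (y - E x)) (S (y - E x')) \<le> norm (E (x' - x)) / c"
          by (simp add: dist_norm Sb)
        also have "\<dots> \<le> (q * norm (x' - x)) / c"
          using E(2) q by (intro divide_right_mono) auto
        finally show "dist (S (y - E x)) (S (y - E x')) \<le> q / c * dist x x'"
          by (simp add: dist_norm norm_minus_commute)
      qed
    qed
    then have "\<exists>x. T x + E x = y" by (metis S(3) diff_add_cancel)
    then show "T (SOME x. T x + E x = y) + E (SOME x. T x + E x = y) = y" by (rule someI_ex)
  qed
qed

lemma cinvertible_scale:
  assumes "z \<noteq> 0" shows "cinvertible (\<lambda>x::'h::complex_hilbert. z *\<^sub>C x)"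
  unfolding cinvertible_def
  by (rule exI[of _ "\<lambda>x. (1 / z) *\<^sub>C x"])
    (use assms in \<open>auto simp: scaleC_scaleC intro: bounded_clinear_scale bounded_clinear_id\<close>)

lemma op_spectrum_bound:
  assumes T: "bounded_clinear T" "\<And>x. norm (T x) \<le> K * norm x" "0 \<le> K" and z: "z \<in> op_spectrum T"
  shows "cmod z \<le> K"
proof (rule ccontr)
  assume "\<not> cmod z \<le> K"
  then have "cinvertible (\<lambda>x. (- z) *\<^sub>C x + T x)"
    using assms by (intro cinvertible_perturb[where c = "cmod z" and q = K] cinvertible_scale
        bounded_clinear_scale bounded_clinear_id) auto
  then show False using z by (simp add: op_spectrum_cinvertible)
qed

text \<open>Along a ray on which \<open>S + t c\<close> is bounded below by \<open>t\<close>, invertibility for large \<open>t\<close>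
  spreads to all \<open>t > 0\<close>, since \<open>\<bar>t - t'\<bar> < t'\<close> whenever \<open>0 < t \<le> t'\<close>. This replaces the usual
  argument by orthogonal complements.\<close>

lemma cinvertible_along_ray:
  assumes S: "bounded_clinear S" and c: "cmod c = 1"
    and below: "\<And>t x. t > 0 \<Longrightarrow> norm (S x + (of_real t * c) *\<^sub>C x) \<ge> t * norm x" and t: "t > 0"
  shows "cinvertible (\<lambda>x. S x + (of_real t * c) *\<^sub>C x)"
proof -
  obtain K where K: "K > 0" "\<And>x. norm (S x) \<le> K * norm x" using bounded_clinear_bound[OF S] by auto
  define t' where "t' = max t (K + 1)"
  have t': "t' > 0" "t \<le> t'" "K < t'" using t K by (auto simp: t'_def)
  have "cinvertible (\<lambda>x. (of_real t' * c) *\<^sub>C x + S x)"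
    by (rule cinvertible_perturb[where c = t' and q = K])
      (use K t' c S in \<open>auto intro!: bounded_clinear_scale bounded_clinear_id cinvertible_scale simp: norm_mult\<close>)
  then have "cinvertible (\<lambda>x. S x + (of_real t' * c) *\<^sub>C x)" by (simp add: add.commute)
  then have "cinvertible (\<lambda>x. (S x + (of_real t' * c) *\<^sub>C x) + (of_real (t - t') * c) *\<^sub>C x)"
  proof (rule cinvertible_perturb[where c = t' and q = "t' - t", rotated])
    show "norm ((of_real (t - t') * c) *\<^sub>C x) \<le> (t' - t) * norm x" for x
      using t' c by (simp add: norm_mult del: of_real_diff)
  qed (use t t' below S in \<open>auto intro!: bounded_clinear_plus bounded_clinear_scale bounded_clinear_id\<close>)
  then show ?thesis
    by (simp add: scaleC_diff_left algebra_simps)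
qed

definition bounded_selfadjoint :: "('h::complex_hilbert \<Rightarrow> 'h) \<Rightarrow> bool" where
  "bounded_selfadjoint T \<longleftrightarrow> bounded_clinear T \<and> (\<forall>x y. cinner x (T y) = cinner (T x) y)"

lemma bounded_selfadjoint_bcl: "bounded_selfadjoint T \<Longrightarrow> bounded_clinear T"
  by (simp add: bounded_selfadjoint_def)

lemma selfadjoint_cinner_real:
  "bounded_selfadjoint T \<Longrightarrow> Im (cinner x (T x)) = 0"
proof -
  assume "bounded_selfadjoint T"
  then have "cinner x (T x) = cnj (cinner x (T x))"
    unfolding bounded_selfadjoint_def by (metis cinner_commute)
  then show ?thesis by (metis complex_cnj_cancel_iff complex_eq_iff cnj.sel(2) equal_neg_zero)
qed

text \<open>For \<open>z = a + i b\<close> the operator \<open>T - a\<close> is symmetric, so that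
  \<open>\<parallel>(T - a) x - i t x\<parallel>\<^sup>2 = \<parallel>(T - a) x\<parallel>\<^sup>2 + t\<^sup>2 \<parallel>x\<parallel>\<^sup>2\<close>, and there are
  lower bounds along the ray from \<open>a\<close> through \<open>z\<close>.\<close>

lemma selfadjoint_spectrum_real:
  assumes T: "bounded_selfadjoint T" and z: "z \<in> op_spectrum T"
  shows "Im z = 0"
proof (rule ccontr)
  assume nz: "Im z \<noteq> 0"
  define c where "c = - \<i> * of_real (sgn (Im z))"
  define S where "S = (\<lambda>x. T x - of_real (Re z) *\<^sub>C x)"
  have bT: "bounded_clinear T" using T by (rule bounded_selfadjoint_bcl)
  have S: "bounded_clinear S" unfolding S_def by (intro bounded_clinear_shift bT)
  have c: "cmod c = 1" "Re c = 0" using nz by (auto simp: c_def norm_mult sgn_if)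
  have re: "cinner x (S x) = of_real (Re (cinner x (S x)))" for x
    using selfadjoint_cinner_real[OF T, of x]
    by (simp add: complex_eq_iff S_def cinner_diff_right cinner_scaleC_right cinner_self)
  have below: "norm (S x + (of_real t * c) *\<^sub>C x) \<ge> t * norm x" if "t > 0" for t x
  proof -
    let ?y = "(of_real t * c) *\<^sub>C x"
    have "Re (cinner (S x) (- ?y)) = 0"
    proof -
      have "cinner (S x) x = of_real (Re (cinner x (S x)))"
        by (metis re cinner_commute complex_cnj_complex_of_real)
      then show ?thesis using c(2) by (simp add: cinner_scaleC_right)
    qed
    then have "(norm (S x + ?y))\<^sup>2 = (norm (S x))\<^sup>2 + (norm ?y)\<^sup>2"
      using norm_diff_sq[of "S x" "- ?y"] by simp
    then have "(t * norm x)\<^sup>2 \<le> (norm (S x + ?y))\<^sup>2" using c that by (simp add: norm_mult)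
    then show ?thesis by (rule power2_le_imp_le) simp
  qed
  have "cinvertible (\<lambda>x. S x + (of_real \<bar>Im z\<bar> * c) *\<^sub>C x)"
    using nz by (intro cinvertible_along_ray S c below) auto
  moreover have "S x + (of_real \<bar>Im z\<bar> * c) *\<^sub>C x = T x - z *\<^sub>C x" for x
  proof -
    have "of_real (Re z) - of_real \<bar>Im z\<bar> * c = z"
      by (auto simp: complex_eq_iff c_def sgn_if)
    then have "z *\<^sub>C x = of_real (Re z) *\<^sub>C x - (of_real \<bar>Im z\<bar> * c) *\<^sub>C x"
      by (metis scaleC_diff_left)
    then show ?thesis by (simp add: S_def)
  qed
  ultimately show False using z by (simp add: op_spectrum_cinvertible)
qed

lemma positive_spectrum_nonneg:
  assumes T: "bounded_clinear T" and pos: "\<And>x. Re (cinner x (T x)) \<ge> 0"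
    and z: "complex_of_real r \<in> op_spectrum T"
  shows "r \<ge> 0"
proof (rule ccontr)
  assume "\<not> r \<ge> 0"
  have below: "norm (T x + (of_real t * 1) *\<^sub>C x) \<ge> t * norm x" if "t > 0" for t x
  proof -
    have "t * norm x * norm x = Re (cinner x (of_real t *\<^sub>C x))"
      by (simp add: cinner_scaleC_right cinner_self power2_eq_square)
    also have "\<dots> \<le> Re (cinner x (T x + of_real t *\<^sub>C x))" using pos by (simp add: cinner_add_right)
    also have "\<dots> \<le> norm x * norm (T x + of_real t *\<^sub>C x)" by (rule Re_cinner_le)
    finally show ?thesis by (cases "x = 0") (auto simp: mult.commute)
  qed
  have "cinvertible (\<lambda>x. T x + (of_real (- r) * 1) *\<^sub>C x)"
    using \<open>\<not> r \<ge> 0\<close> by (intro cinvertible_along_ray T below) auto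
  then show False using z by (simp add: op_spectrum_cinvertible)
qed


section \<open>Polynomials of an operator\<close>

lemma poly_op_altdef:
  "degree p \<le> n \<Longrightarrow> poly_op p T x = (\<Sum>i\<le>n. coeff p i *\<^sub>C (T ^^ i) (x::'h::complex_hilbert))"
  unfolding poly_op_def by (rule sum.mono_neutral_left) (auto simp: coeff_eq_0 not_le)

lemma poly_op_0 [simp]: "poly_op 0 T x = (0::'h::complex_hilbert)"
  by (simp add: poly_op_def)

lemma poly_op_1 [simp]: "poly_op 1 T x = (x::'h::complex_hilbert)"
  by (simp add: poly_op_def)

lemma poly_op_pCons:
  assumes T: "bounded_clinear T"
  shows "poly_op (pCons a p) T x = a *\<^sub>C x + T (poly_op p T x)"
proof -
  have "poly_op (pCons a p) T x = (\<Sum>i\<le>Suc (degree p). coeff (pCons a p) i *\<^sub>C (T ^^ i) x)"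
    by (intro poly_op_altdef degree_pCons_le)
  also have "\<dots> = a *\<^sub>C x + (\<Sum>i\<le>degree p. coeff p i *\<^sub>C T ((T ^^ i) x))"
    by (subst sum.atMost_Suc_shift) simp
  finally show ?thesis
    by (simp add: poly_op_def bounded_clinear_sum[OF T] bounded_clinear_scaleC[OF T])
qed

lemma poly_op_add: "poly_op (p + q) T x = poly_op p T x + poly_op q T (x::'h::complex_hilbert)"
proof -
  define n where "n = max (degree p) (degree q)"
  have "degree p \<le> n" "degree q \<le> n" "degree (p + q) \<le> n"
    by (auto simp: n_def degree_add_le_max)
  then show ?thesis
    by (simp add: poly_op_altdef[where n = n] scaleC_add_left sum.distrib)
qed

lemma poly_op_smult: "poly_op (smult c p) T x = c *\<^sub>C poly_op p T (x::'h::complex_hilbert)"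
  by (simp add: poly_op_altdef[where n = "degree p"] degree_smult_le scaleC_sum scaleC_scaleC)

lemma poly_op_diff: "poly_op (p - q) T x = poly_op p T x - poly_op q T (x::'h::complex_hilbert)"
  using poly_op_add[of p "smult (-1) q" T x] poly_op_smult[of "-1" q T x] by simp

lemma poly_op_sum: "poly_op (\<Sum>i\<in>I. p i) T x = (\<Sum>i\<in>I. poly_op (p i) T (x::'h::complex_hilbert))"
  by (induction I rule: infinite_finite_induct) (auto simp: poly_op_add)

lemma bounded_clinear_poly_op:
  assumes "bounded_clinear T" shows "bounded_clinear (poly_op p T)"
proof (induction p)
  case 0
  have "poly_op 0 T = (\<lambda>x. 0)" by auto
  then show ?case by (simp add: bounded_clinear_zero_op)
next
  case (pCons a p)
  have "poly_op (pCons a p) T = (\<lambda>x. a *\<^sub>C x + T (poly_op p T x))"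
    using assms by (auto simp: poly_op_pCons)
  then show ?case
    using bounded_clinear_plus[OF bounded_clinear_scale[OF bounded_clinear_id]
        bounded_clinear_comp[OF assms pCons(2)]] by simp
qed

lemma poly_op_mult:
  assumes "bounded_clinear T"
  shows "poly_op (p * q) T x = poly_op p T (poly_op q T x)"
  by (induction p) (auto simp: poly_op_add poly_op_smult poly_op_pCons[OF assms])

lemma poly_op_X:
  assumes "bounded_clinear T" shows "poly_op [:a, b:] T x = a *\<^sub>C x + b *\<^sub>C T x"
  by (simp add: poly_op_pCons[OF assms] bounded_clinear_scaleC[OF assms]
      bounded_clinear_zero[OF assms])

lemma cinner_poly_op:
  assumes "bounded_selfadjoint T"
  shows "cinner x (poly_op p T y) = cinner (poly_op (map_poly cnj p) T x) y"
proof -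
  have T: "bounded_clinear T" using assms by (rule bounded_selfadjoint_bcl)
  have comm: "poly_op q T (T z) = T (poly_op q T z)" for q z
    using poly_op_mult[OF T, of q "[:0,1:]" z] poly_op_mult[OF T, of "[:0,1:]" q z]
    by (simp add: poly_op_X[OF T] mult.commute)
  have sym: "cinner u (T v) = cinner (T u) v" for u v
    using assms by (simp add: bounded_selfadjoint_def)
  show ?thesis
  proof (induction p arbitrary: x)
    case (pCons a p)
    then show ?case
      by (simp add: poly_op_pCons[OF T] map_poly_pCons cinner_add_left cinner_add_right
          cinner_scaleC_left cinner_scaleC_right sym comm)
  qed (simp add: map_poly_0)
qed

lemma poly_map_cnj_of_real: "poly (map_poly cnj p) (complex_of_real t) = cnj (poly p (complex_of_real t))"
  by (induction p) (auto simp: map_poly_pCons)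

text \<open>Factor \<open>p\<close> over the complex numbers: if \<open>T - z\<close> were invertible for every root \<open>z\<close>, then so would
  be \<open>p(T)\<close>, the product of these operators and a nonzero constant.\<close>

lemma spectrum_root_of_not_cinvertible:
  fixes T :: "'h::complex_hilbert \<Rightarrow> 'h"
  assumes T: "bounded_clinear T" and "p \<noteq> 0" "\<not> cinvertible (poly_op p T)"
  shows "\<exists>z\<in>op_spectrum T. poly p z = 0"
  using assms(2,3)
proof (induction "degree p" arbitrary: p rule: less_induct)
  case less
  show ?case
  proof (cases "degree p = 0")
    case True
    then obtain c where c: "p = [:c:]" by (metis degree_eq_zeroE)
    then have "c \<noteq> 0" using less.prems by auto
    moreover have "poly_op p T = (\<lambda>x. c *\<^sub>C x)"
      by (auto simp: c poly_op_pCons[OF T] bounded_clinear_zero[OF T])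
    ultimately show ?thesis using less.prems cinvertible_scale[where z = c and 'h = 'h] by simp
  next
    case False
    then obtain z where z: "poly p z = 0"
      using fundamental_theorem_of_algebra[of p] constant_degree[of p] by auto
    then obtain q where q: "p = [:- z, 1:] * q" by (auto simp: poly_eq_0_iff_dvd)
    have "q \<noteq> 0" using q less.prems by auto
    show ?thesis
    proof (cases "z \<in> op_spectrum T")
      case True
      then show ?thesis using z by blast
    next
      case False
      have "poly_op p T = (\<lambda>x. poly_op [:- z, 1:] T (poly_op q T x))"
        unfolding q by (rule ext) (rule poly_op_mult[OF T])
      moreover have "cinvertible (poly_op [:- z, 1:] T)"
      proof -
        have "poly_op [:- z, 1:] T = (\<lambda>x. T x - z *\<^sub>C x)" by (auto simp: poly_op_X[OF T])
        then show ?thesis using False by (simp add: op_spectrum_cinvertible)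
      qed
      ultimately have "\<not> cinvertible (poly_op q T)"
        using less.prems(2) cinvertible_comp by metis
      moreover have "degree p = Suc (degree q)"
        unfolding q using \<open>q \<noteq> 0\<close> by (subst degree_mult_eq) auto
      ultimately have "\<exists>z\<in>op_spectrum T. poly q z = 0" using less.hyps[of q] \<open>q \<noteq> 0\<close> by simp
      then show ?thesis unfolding q by auto
    qed
  qed
qed

definition real_spectrum :: "('h::complex_hilbert \<Rightarrow> 'h) \<Rightarrow> real set" where
  "real_spectrum T = {t. complex_of_real t \<in> op_spectrum T}"

text \<open>With \<open>N = p(T)\<close> and \<open>M = \<parallel>N\<parallel>\<close>, vectors on which \<open>N\<close> nearly attains its norm
  are approximate eigenvectors of \<open>N\<^sup>* N\<close> for \<open>M\<^sup>2\<close>, because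
  \<open>\<parallel>N\<^sup>* N x - M\<^sup>2 x\<parallel>\<^sup>2 \<le> M\<^sup>2 (M\<^sup>2 \<parallel>x\<parallel>\<^sup>2 - \<parallel>N x\<parallel>\<^sup>2)\<close>.\<close>

lemma poly_op_norm_sq_spectrum:
  fixes T :: "'h::complex_hilbert \<Rightarrow> 'h"
  assumes T: "bounded_selfadjoint T" and M: "M = onorm (poly_op p T)" "M > 0"
  shows "\<not> cinvertible (poly_op (map_poly cnj p * p - [:of_real (M\<^sup>2):]) T)"
proof
  have bT: "bounded_clinear T" using T by (rule bounded_selfadjoint_bcl)
  define N N' where "N = poly_op p T" and "N' = poly_op (map_poly cnj p) T"
  have N: "bounded_clinear N" unfolding N_def by (rule bounded_clinear_poly_op[OF bT])
  have adj: "cinner x (N y) = cinner (N' x) y" for x y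
    unfolding N_def N'_def by (rule cinner_poly_op[OF T])
  have Nb: "norm (N x) \<le> M * norm x" for x
    using onorm_bounded_clinear[OF N] by (simp add: M(1) N_def)
  have N'b: "norm (N' x) \<le> M * norm x" for x
  proof -
    have "norm (N' x) * norm (N' x) = Re (cinner (N' x) (N' x))"
      by (simp add: norm_sq_cinner[symmetric] power2_eq_square)
    also have "\<dots> = Re (cinner x (N (N' x)))" by (simp add: adj)
    also have "\<dots> \<le> norm x * norm (N (N' x))" by (rule Re_cinner_le)
    also have "\<dots> \<le> norm x * (M * norm (N' x))" by (intro mult_left_mono Nb) auto
    finally show ?thesis by (cases "norm (N' x) = 0") (use M in \<open>auto simp: mult_ac\<close>)
  qed
  have dec: "(norm (N' (N x) - of_real (M\<^sup>2) *\<^sub>C x))\<^sup>2 \<le> M\<^sup>2 * (M\<^sup>2 * (norm x)\<^sup>2 - (norm (N x))\<^sup>2)" for x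
  proof -
    have "(norm (N' (N x) - of_real (M\<^sup>2) *\<^sub>C x))\<^sup>2
        = (norm (N' (N x)))\<^sup>2 - 2 * (M\<^sup>2 * Re (cinner (N' (N x)) x)) + (M\<^sup>2 * norm x)\<^sup>2"
      unfolding norm_diff_sq by (simp add: cinner_scaleC_right flip: of_real_power)
    also have "Re (cinner (N' (N x)) x) = (norm (N x))\<^sup>2" by (simp add: adj[symmetric] norm_sq_cinner)
    also have "(norm (N' (N x)))\<^sup>2 \<le> (M * norm (N x))\<^sup>2" by (intro power_mono N'b) auto
    finally show ?thesis by (simp add: power2_eq_square algebra_simps)
  qed
  have op: "poly_op (map_poly cnj p * p - [:of_real (M\<^sup>2):]) T x = N' (N x) - of_real (M\<^sup>2) *\<^sub>C x" for x
    unfolding N_def N'_def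
    by (simp only: poly_op_diff poly_op_mult[OF bT] poly_op_pCons[OF bT] poly_op_0
        bounded_clinear_zero[OF bT] add_0_right)
  assume "cinvertible (poly_op (map_poly cnj p * p - [:of_real (M\<^sup>2):]) T)"
  then obtain S where S: "bounded_clinear S"
    "\<And>x. S (N' (N x) - of_real (M\<^sup>2) *\<^sub>C x) = x"
    unfolding cinvertible_def op by metis
  obtain K where K: "K > 0" "\<And>x. norm (S x) \<le> K * norm x" using bounded_clinear_bound[OF S(1)] by auto
  \<comment> \<open>an inverse of norm at most \<open>K\<close> keeps \<open>\<parallel>N\<parallel>\<^sup>2\<close> below \<open>M\<^sup>2 - d\<close>\<close>
  define d where "d = inverse (K\<^sup>2 * M\<^sup>2)"
  have d: "d > 0" using K M by (simp add: d_def)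
  have low: "(norm (N x))\<^sup>2 \<le> (M\<^sup>2 - d) * (norm x)\<^sup>2" for x
  proof -
    have "norm x \<le> K * norm (N' (N x) - of_real (M\<^sup>2) *\<^sub>C x)"
      using K(2)[of "N' (N x) - of_real (M\<^sup>2) *\<^sub>C x"] by (simp only: S(2))
    then have "(norm x)\<^sup>2 \<le> (K * norm (N' (N x) - of_real (M\<^sup>2) *\<^sub>C x))\<^sup>2"
      by (intro power_mono) auto
    also have "\<dots> \<le> K\<^sup>2 * (M\<^sup>2 * (M\<^sup>2 * (norm x)\<^sup>2 - (norm (N x))\<^sup>2))"
      unfolding power_mult_distrib by (intro mult_left_mono dec) auto
    finally have "d * (norm x)\<^sup>2 \<le> M\<^sup>2 * (norm x)\<^sup>2 - (norm (N x))\<^sup>2"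
      using K M by (simp add: d_def field_simps)
    then show ?thesis by (simp add: algebra_simps)
  qed
  have "norm (N x) \<le> sqrt (max 0 (M\<^sup>2 - d)) * norm x" for x
  proof (rule power2_le_imp_le)
    have "(M\<^sup>2 - d) * (norm x)\<^sup>2 \<le> max 0 (M\<^sup>2 - d) * (norm x)\<^sup>2" by (intro mult_right_mono) auto
    then show "(norm (N x))\<^sup>2 \<le> (sqrt (max 0 (M\<^sup>2 - d)) * norm x)\<^sup>2"
      using low[of x] by (simp add: power_mult_distrib)
  qed auto
  then have "M \<le> sqrt (max 0 (M\<^sup>2 - d))"
    unfolding M(1) N_def[symmetric] by (intro onorm_bound) auto
  then have "M\<^sup>2 \<le> (sqrt (max 0 (M\<^sup>2 - d)))\<^sup>2" using M by (intro power_mono) auto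
  also have "\<dots> = max 0 (M\<^sup>2 - d)" by simp
  also have "\<dots> < M\<^sup>2" using d M by auto
  finally show False by simp
qed

lemma cmod_eqI: "cnj w * w = of_real (m\<^sup>2) \<Longrightarrow> m \<ge> 0 \<Longrightarrow> cmod w = m"
proof -
  assume h: "cnj w * w = of_real (m\<^sup>2)" "m \<ge> 0"
  have "complex_of_real ((cmod w)\<^sup>2) = w * cnj w" by (rule complex_norm_square)
  also have "\<dots> = of_real (m\<^sup>2)" using h(1) by (subst mult.commute)
  finally have "complex_of_real ((cmod w)\<^sup>2) = of_real (m\<^sup>2)" .
  then have "(cmod w)\<^sup>2 = m\<^sup>2" by (rule of_real_eq_iff[THEN iffD1])
  then show "cmod w = m" using h(2) by (simp add: power2_eq_iff_nonneg)
qed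

text \<open>By the previous lemma \<open>|p|\<^sup>2 - M\<^sup>2\<close> has a zero on the spectrum, unless it is the zero
  polynomial; in that case every point of the spectrum will do.\<close>

lemma poly_op_norm_attained:
  assumes T: "bounded_selfadjoint T" and M: "M = onorm (poly_op p T)" "M > 0"
    and nz: "map_poly cnj p * p \<noteq> [:of_real (M\<^sup>2):] \<or> real_spectrum T \<noteq> {}"
  shows "\<exists>t\<in>real_spectrum T. cmod (poly p (of_real t)) = M"
proof -
  have "\<exists>t\<in>real_spectrum T. poly (map_poly cnj p * p) (of_real t) = of_real (M\<^sup>2)"
  proof (cases "map_poly cnj p * p = [:of_real (M\<^sup>2):]")
    case True
    then show ?thesis using nz by auto
  next
    case False
    then have "map_poly cnj p * p - [:of_real (M\<^sup>2):] \<noteq> 0" by (simp only: right_minus_eq not_False_eq_True)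
    then obtain z where z: "z \<in> op_spectrum T" "poly (map_poly cnj p * p - [:of_real (M\<^sup>2):]) z = 0"
      using spectrum_root_of_not_cinvertible[OF bounded_selfadjoint_bcl[OF T]]
        poly_op_norm_sq_spectrum[OF T M] by blast
    have "z = of_real (Re z)" using selfadjoint_spectrum_real[OF T z(1)] by (simp add: complex_eq_iff)
    moreover have "poly (map_poly cnj p * p) z = of_real (M\<^sup>2)" using z(2) unfolding poly_diff by simp
    ultimately show ?thesis using z(1) by (intro bexI[of _ "Re z"]) (simp_all only: real_spectrum_def mem_Collect_eq)
  qed
  then obtain t where t: "t \<in> real_spectrum T" "poly (map_poly cnj p * p) (of_real t) = of_real (M\<^sup>2)" by blast
  then have "cmod (poly p (of_real t)) = M"
    using M unfolding poly_mult poly_map_cnj_of_real by (intro cmod_eqI) auto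
  then show ?thesis using t(1) by blast
qed

text \<open>\<open>p = X\<close> is the case in which \<open>|p|\<^sup>2\<close> is not constant.\<close>

lemma real_spectrum_nonempty:
  fixes T :: "'h::complex_hilbert \<Rightarrow> 'h"
  assumes T: "bounded_selfadjoint T" and "x \<noteq> (0::'h)"
  shows "real_spectrum T \<noteq> {}"
proof -
  have bT: "bounded_clinear T" using T by (rule bounded_selfadjoint_bcl)
  have X: "poly_op [:0, 1:] T = T" by (auto simp: poly_op_X[OF bT])
  show ?thesis
  proof (cases "onorm T > 0")
    case True
    have "\<exists>t\<in>real_spectrum T. cmod (poly [:0,1:] (of_real t)) = onorm T"
    proof (rule poly_op_norm_attained[OF T])
      have "map_poly cnj [:0,1:] * [:0,1:] \<noteq> [:of_real ((onorm T)\<^sup>2):]"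
      proof
        assume "map_poly cnj [:0,1:] * [:0,1:] = [:complex_of_real ((onorm T)\<^sup>2):]"
        then have "poly (map_poly cnj [:0,1:] * [:0,1:]) 0 = poly [:complex_of_real ((onorm T)\<^sup>2):] 0"
          by (rule arg_cong)
        then show False using True unfolding poly_mult by simp
      qed
      then show "map_poly cnj [:0,1:] * [:0,1:] \<noteq> [:of_real ((onorm T)\<^sup>2):] \<or> real_spectrum T \<noteq> {}" ..
      show "onorm T = onorm (poly_op [:0, 1:] T)" by (simp only: X)
      show "onorm T > 0" by (rule True)
    qed
    then show ?thesis by auto
  next
    case False
    have T0: "T y = 0" for y
    proof -
      have "onorm T = 0" using False onorm_pos_le[OF bounded_clinear_bl[OF bT]] by simp
      then show ?thesis using onorm_bounded_clinear[OF bT, of y] by simp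
    qed
    have "\<not> cinvertible (\<lambda>x. T x - of_real 0 *\<^sub>C x)"
    proof
      assume "cinvertible (\<lambda>x. T x - of_real 0 *\<^sub>C x)"
      then obtain S where "bounded_clinear S" "S (T x - of_real 0 *\<^sub>C x) = x"
        unfolding cinvertible_def by blast
      then show False using T0[of x] \<open>x \<noteq> 0\<close> by simp
    qed
    then have "0 \<in> real_spectrum T" by (simp add: real_spectrum_def op_spectrum_cinvertible)
    then show ?thesis by auto
  qed
qed

text \<open>So \<open>p(T)\<close> depends continuously on the restriction of \<open>p\<close> to the spectrum, in the uniform norm,
  which is what makes the continuous functional calculus well defined.\<close>

lemma poly_op_norm_le:
  assumes T: "bounded_selfadjoint T" and M: "M \<ge> 0"
    "\<And>t. t \<in> real_spectrum T \<Longrightarrow> cmod (poly p (of_real t)) \<le> M"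
  shows "norm (poly_op p T x) \<le> M * norm x"
proof -
  have N: "bounded_clinear (poly_op p T)"
    by (intro bounded_clinear_poly_op bounded_selfadjoint_bcl T)
  define m where "m = onorm (poly_op p T)"
  have "m \<le> M" if x: "x \<noteq> 0" and m: "m > 0"
  proof -
    have "\<exists>t\<in>real_spectrum T. cmod (poly p (of_real t)) = m"
      using real_spectrum_nonempty[OF T x] by (intro poly_op_norm_attained[OF T m_def m]) blast
    then show ?thesis using M(2) by auto
  qed
  then have "x = 0 \<or> m \<le> M" using M(1) by (cases "m > 0") auto
  moreover have "norm (poly_op p T x) \<le> m * norm x"
    unfolding m_def by (rule onorm_bounded_clinear[OF N])
  ultimately show ?thesis
    using bounded_clinear_zero[OF N] mult_right_mono[of m M "norm x"] by (auto simp del: bounded_clinear_zero)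
qed


section \<open>Continuous functional calculus of a bounded self-adjoint operator\<close>

abbreviation polys_tend_to :: "real set \<Rightarrow> (nat \<Rightarrow> complex poly) \<Rightarrow> (real \<Rightarrow> complex) \<Rightarrow> bool" where
  "polys_tend_to X p f \<equiv> uniform_limit X (\<lambda>n t. poly (p n) (complex_of_real t)) f sequentially"

lemma complex_poly_approx:
  fixes f :: "real \<Rightarrow> complex"
  assumes "continuous_on {a..b} f"
  shows "\<exists>p. polys_tend_to {a..b} p f"
proof -
  have real_approx: "\<exists>q. \<forall>t\<in>{a..b}. \<bar>poly q t - g t\<bar> < e"
    if g: "continuous_on {a..b} g" and e: "e > 0" for g :: "real \<Rightarrow> real" and e
  proof -
    obtain h where h: "real_polynomial_function h" "\<And>t. t \<in> {a..b} \<Longrightarrow> \<bar>g t - h t\<bar> < e"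
      using Stone_Weierstrass_real_polynomial_function[OF compact_Icc g e] by blast
    obtain c n where c: "h = (\<lambda>t. \<Sum>i\<le>n. c i * t ^ i)"
      using h(1) real_polynomial_function_iff_sum by blast
    have "poly (\<Sum>i\<le>n. monom (c i) i) t = h t" for t by (simp add: c poly_sum poly_monom)
    then show ?thesis using h(2) by (metis abs_minus_commute)
  qed
  have ex: "\<exists>p. \<forall>t\<in>{a..b}. cmod (poly p (of_real t) - f t) < e" if e: "e > 0" for e
  proof -
    obtain q where q: "\<And>t. t \<in> {a..b} \<Longrightarrow> \<bar>poly q t - Re (f t)\<bar> < e / 2"
      using real_approx[OF continuous_on_Re[OF assms] half_gt_zero[OF e]] by blast
    obtain r where r: "\<And>t. t \<in> {a..b} \<Longrightarrow> \<bar>poly r t - Im (f t)\<bar> < e / 2"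
      using real_approx[OF continuous_on_Im[OF assms] half_gt_zero[OF e]] by blast
    have m: "poly (map_poly of_real q) (of_real t) = complex_of_real (poly q t)" for q t
      by (induction q) (auto simp: map_poly_pCons)
    show ?thesis
    proof (intro exI ballI)
      fix t assume t: "t \<in> {a..b}"
      let ?z = "poly (map_poly of_real q + smult \<i> (map_poly of_real r)) (of_real t) - f t"
      have "Re ?z = poly q t - Re (f t)" "Im ?z = poly r t - Im (f t)" by (simp_all add: m)
      then show "cmod ?z < e" using cmod_le[of ?z] q[OF t] r[OF t] by linarith
    qed
  qed
  define p where "p n = (SOME p. \<forall>t\<in>{a..b}. cmod (poly p (of_real t) - f t) < 1 / real (Suc n))" for n
  have p: "\<forall>t\<in>{a..b}. cmod (poly (p n) (of_real t) - f t) < 1 / real (Suc n)" for n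
    unfolding p_def by (rule someI_ex) (intro ex, simp)
  have "polys_tend_to {a..b} p f"
  proof (rule uniform_limitI)
    fix e :: real assume "e > 0"
    then have "\<forall>\<^sub>F n in sequentially. 1 / real (Suc n) < e"
      using lim_inverse_n' by (intro order_tendstoD(2)[OF LIMSEQ_Suc[OF lim_1_over_n]]) auto
    then show "\<forall>\<^sub>F n in sequentially. \<forall>t\<in>{a..b}. dist (poly (p n) (of_real t)) (f t) < e"
    proof eventually_elim
      case (elim n)
      then show ?case using p[of n] by (auto simp: dist_norm intro: less_trans)
    qed
  qed
  then show ?thesis by blast
qed

lemma map_poly_cnj_cnj: "map_poly cnj (map_poly cnj p) = p"
  by (rule poly_eqI) (simp add: coeff_map_poly)

definition poly_approximable :: "real set \<Rightarrow> (real \<Rightarrow> complex) \<Rightarrow> bool" where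
  "poly_approximable X f \<longleftrightarrow>
     (\<exists>p. polys_tend_to X p f)"

lemma poly_approximable_poly: "poly_approximable X (\<lambda>t. poly p (complex_of_real t))"
  unfolding poly_approximable_def
  by (rule exI[of _ "\<lambda>n. p"]) (auto intro!: uniform_limitI)

lemma poly_approximable_cnj:
  assumes "poly_approximable X f" shows "poly_approximable X (\<lambda>t. cnj (f t))"
proof -
  obtain p where p: "polys_tend_to X p f"
    using assms by (auto simp: poly_approximable_def)
  have "uniform_limit X (\<lambda>n t. poly (map_poly cnj (p n)) (complex_of_real t)) (\<lambda>t. cnj (f t)) sequentially"
    using p unfolding uniform_limit_iff by (simp add: poly_map_cnj_of_real dist_norm flip: complex_cnj_diff)
  then show ?thesis unfolding poly_approximable_def by (intro exI[of _ "\<lambda>n. map_poly cnj (p n)"])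
qed

lemma damped_norm_less: "e > 0 \<Longrightarrow> e / (2 * (norm x + 1)) * norm x < e"
proof -
  assume e: "e > 0"
  have d: "2 * (norm x + 1) > 0" by (simp add: add_nonneg_pos)
  have "0 < norm x + 2" by (simp add: add_nonneg_pos)
  then have "norm x < 2 * (norm x + 1)" by (simp add: algebra_simps)
  then have "e * norm x < e * (2 * (norm x + 1))" using e by (rule mult_strict_left_mono)
  then show "e / (2 * (norm x + 1)) * norm x < e" using d by (simp only: times_divide_eq_left pos_divide_less_eq)
qed

locale selfadjoint_op =
  fixes T :: "'h::complex_hilbert \<Rightarrow> 'h"
  assumes selfadjoint: "bounded_selfadjoint T"
begin

lemma bcl: "bounded_clinear T"
  using selfadjoint by (rule bounded_selfadjoint_bcl)

text \<open>Convergence in operator norm, in the form in which it is produced by estimates for vectors.\<close>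

definition op_limit :: "(nat \<Rightarrow> complex poly) \<Rightarrow> ('h \<Rightarrow> 'h) \<Rightarrow> bool" where
  "op_limit p B \<longleftrightarrow> (\<forall>e>0. \<forall>\<^sub>F n in sequentially. \<forall>x. norm (poly_op (p n) T x - B x) \<le> e * norm x)"

lemma bounded_real_spectrum: "bounded (real_spectrum T)"
proof -
  obtain K where K: "K > 0" "\<And>x. norm (T x) \<le> K * norm x" using bounded_clinear_bound[OF bcl] by auto
  have "\<bar>t\<bar> \<le> K" if "t \<in> real_spectrum T" for t
    using op_spectrum_bound[OF bcl K(2), of "of_real t"] K(1) that by (simp add: real_spectrum_def)
  then show ?thesis by (auto simp: bounded_iff)
qed

text \<open>Boundedness of \<open>f\<close> on the spectrum is what lets products of approximating polynomials converge
  uniformly to products.\<close>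

lemma bounded_image_approximable:
  assumes "poly_approximable (real_spectrum T) f" shows "bounded (f ` real_spectrum T)"
proof -
  obtain p where p: "polys_tend_to (real_spectrum T) p f"
    using assms by (auto simp: poly_approximable_def)
  obtain n where n: "\<And>t. t \<in> real_spectrum T \<Longrightarrow> cmod (poly (p n) (of_real t) - f t) < 1"
    using uniform_limitD[OF p, of 1] by (auto simp: eventually_sequentially dist_norm)
  obtain K where K: "\<And>t. t \<in> real_spectrum T \<Longrightarrow> \<bar>t\<bar> \<le> K"
    using bounded_real_spectrum by (auto simp: bounded_iff)
  obtain m where m: "\<And>z. cmod z \<le> K \<Longrightarrow> cmod (poly (p n) z) \<le> m" using poly_bound_exists[of K "p n"] by blast
  have "cmod (f t) \<le> m + 1" if "t \<in> real_spectrum T" for t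
    using norm_triangle_sub[of "f t" "poly (p n) (of_real t)"] n[OF that] m[of "of_real t"] K[OF that]
    by (simp add: norm_minus_commute)
  then show ?thesis by (auto simp: bounded_iff)
qed

lemma op_limit_onorm_iff:
  assumes B: "bounded_clinear B"
  shows "op_limit p B \<longleftrightarrow> (\<lambda>n. onorm (\<lambda>x. poly_op (p n) T x - B x)) \<longlonglongrightarrow> 0"
proof
  have D: "bounded_clinear (\<lambda>x. poly_op (p n) T x - B x)" for n
    by (intro bounded_clinear_minus bounded_clinear_poly_op bcl B)
  have pos: "onorm (\<lambda>x. poly_op (p n) T x - B x) \<ge> 0" for n
    using onorm_pos_le[OF bounded_clinear_bl[OF D]] .
  show "(\<lambda>n. onorm (\<lambda>x. poly_op (p n) T x - B x)) \<longlonglongrightarrow> 0" if "op_limit p B"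
  proof (rule tendstoI)
    fix e :: real assume "e > 0"
    then have "\<forall>\<^sub>F n in sequentially. \<forall>x. norm (poly_op (p n) T x - B x) \<le> (e / 2) * norm x"
      using that by (auto simp: op_limit_def simp del: times_divide_eq_left)
    then show "\<forall>\<^sub>F n in sequentially. dist (onorm (\<lambda>x. poly_op (p n) T x - B x)) 0 < e"
    proof eventually_elim
      case (elim n)
      then have "onorm (\<lambda>x. poly_op (p n) T x - B x) \<le> e / 2"
        using \<open>e > 0\<close> by (intro onorm_bound) auto
      then show ?case using pos[of n] \<open>e > 0\<close> by simp
    qed
  qed
  assume lim: "(\<lambda>n. onorm (\<lambda>x. poly_op (p n) T x - B x)) \<longlonglongrightarrow> 0"
  show "op_limit p B" unfolding op_limit_def
  proof (intro allI impI)
    fix e :: real assume "e > 0"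
    then have "\<forall>\<^sub>F n in sequentially. onorm (\<lambda>x. poly_op (p n) T x - B x) < e"
      using lim by (intro order_tendstoD) auto
    then show "\<forall>\<^sub>F n in sequentially. \<forall>x. norm (poly_op (p n) T x - B x) \<le> e * norm x"
    proof eventually_elim
      case (elim n)
      show ?case
      proof
        fix x
        have "norm (poly_op (p n) T x - B x) \<le> onorm (\<lambda>x. poly_op (p n) T x - B x) * norm x"
          by (rule onorm_bounded_clinear[OF D])
        also have "\<dots> \<le> e * norm x" using elim by (intro mult_right_mono) auto
        finally show "norm (poly_op (p n) T x - B x) \<le> e * norm x" .
      qed
    qed
  qed
qed

lemma op_limit_pointwise:
  assumes "op_limit p B" shows "(\<lambda>n. poly_op (p n) T x) \<longlonglongrightarrow> B x"
proof (rule tendstoI)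
  fix e :: real assume e: "e > 0"
  have "e / (2 * (norm x + 1)) > 0" using e by (simp add: add_nonneg_pos)
  then have "\<forall>\<^sub>F n in sequentially. \<forall>x'. norm (poly_op (p n) T x' - B x') \<le> e / (2 * (norm x + 1)) * norm x'"
    using assms by (auto simp: op_limit_def simp del: times_divide_eq_left)
  then show "\<forall>\<^sub>F n in sequentially. dist (poly_op (p n) T x) (B x) < e"
  proof eventually_elim
    case (elim n)
    have "e / (2 * (norm x + 1)) * norm x < e" by (rule damped_norm_less[OF e])
    then show ?case using elim[rule_format, of x] by (simp add: dist_norm)
  qed
qed

text \<open>Two sequences with the same limit are treated at once: with equal sequences this is the Cauchy
  property, with different ones it shows that the limit operator depends on \<open>f\<close> alone.\<close>

lemma uniform_limits_close:
  assumes p: "polys_tend_to (real_spectrum T) p f"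
    and q: "polys_tend_to (real_spectrum T) q f"
    and e: "e > 0"
  shows "\<exists>N. \<forall>m\<ge>N. \<forall>n\<ge>N. \<forall>x. norm (poly_op (p m) T x - poly_op (q n) T x) \<le> e * norm x"
proof -
  obtain N where N: "\<And>n t. n \<ge> N \<Longrightarrow> t \<in> real_spectrum T \<Longrightarrow> cmod (poly (p n) (of_real t) - f t) < e / 2"
    using uniform_limitD[OF p, of "e/2"] e by (auto simp: eventually_sequentially dist_norm)
  obtain N' where N': "\<And>n t. n \<ge> N' \<Longrightarrow> t \<in> real_spectrum T \<Longrightarrow> cmod (poly (q n) (of_real t) - f t) < e / 2"
    using uniform_limitD[OF q, of "e/2"] e by (auto simp: eventually_sequentially dist_norm)
  show ?thesis
  proof (intro exI allI impI)
    fix m n x assume mn: "m \<ge> max N N'" "n \<ge> max N N'"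
    have "norm (poly_op (p m - q n) T x) \<le> e * norm x"
    proof (rule poly_op_norm_le[OF selfadjoint])
      fix t assume t: "t \<in> real_spectrum T"
      have "cmod (poly (p m) (of_real t) - poly (q n) (of_real t)) < e"
        using N[of m t] N'[of n t] mn t by (intro norm_diff_triangle_less[of _ "f t" "e/2" _ "e/2", simplified]) (auto simp: norm_minus_commute)
      then show "cmod (poly (p m - q n) (of_real t)) \<le> e" by simp
    qed (use e in auto)
    then show "norm (poly_op (p m) T x - poly_op (q n) T x) \<le> e * norm x" by (simp add: poly_op_diff)
  qed
qed

lemma op_limit_exists:
  assumes p: "polys_tend_to (real_spectrum T) p f"
  shows "\<exists>B. bounded_clinear B \<and> op_limit p B"
proof -
  have "\<exists>y. (\<lambda>n. poly_op (p n) T x) \<longlonglongrightarrow> y" for x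
  proof -
    have "Cauchy (\<lambda>n. poly_op (p n) T x)"
    proof (rule metric_CauchyI)
      fix e :: real assume e: "e > 0"
      have "e / (2 * (norm x + 1)) > 0" using e by (simp add: add_nonneg_pos)
      then obtain N where N: "\<And>m n. m \<ge> N \<Longrightarrow> n \<ge> N \<Longrightarrow>
          norm (poly_op (p m) T x - poly_op (p n) T x) \<le> e / (2 * (norm x + 1)) * norm x"
        using uniform_limits_close[OF p p] by blast
      have "e / (2 * (norm x + 1)) * norm x < e" by (rule damped_norm_less[OF e])
      then have "dist (poly_op (p m) T x) (poly_op (p n) T x) < e" if "m \<ge> N" "n \<ge> N" for m n
        using N[OF that] by (simp add: dist_norm)
      then show "\<exists>M. \<forall>m\<ge>M. \<forall>n\<ge>M. dist (poly_op (p m) T x) (poly_op (p n) T x) < e" by blast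
    qed
    then show ?thesis by (metis Cauchy_convergent convergent_def)
  qed
  then obtain B where B: "\<And>x. (\<lambda>n. poly_op (p n) T x) \<longlonglongrightarrow> B x" by metis
  have lim: "op_limit p B" unfolding op_limit_def
  proof (intro allI impI)
    fix e :: real assume "e > 0"
    then obtain N where N: "\<And>m n x. m \<ge> N \<Longrightarrow> n \<ge> N \<Longrightarrow> norm (poly_op (p m) T x - poly_op (p n) T x) \<le> e * norm x"
      using uniform_limits_close[OF p p] by blast
    have "norm (poly_op (p m) T x - B x) \<le> e * norm x" if "m \<ge> N" for m x
    proof (rule LIMSEQ_le_const2)
      show "(\<lambda>n. norm (poly_op (p m) T x - poly_op (p n) T x)) \<longlonglongrightarrow> norm (poly_op (p m) T x - B x)"
        by (intro tendsto_intros B)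
    qed (use N that in blast)
    then show "\<forall>\<^sub>F n in sequentially. \<forall>x. norm (poly_op (p n) T x - B x) \<le> e * norm x"
      by (auto simp: eventually_sequentially)
  qed
  have P: "bounded_clinear (poly_op (p n) T)" for n by (rule bounded_clinear_poly_op[OF bcl])
  obtain n where n: "\<And>x. norm (poly_op (p n) T x - B x) \<le> 1 * norm x"
    using lim unfolding op_limit_def eventually_sequentially by (metis order_refl zero_less_one)
  obtain K where K: "\<And>x. norm (poly_op (p n) T x) \<le> K * norm x" using bounded_clinear_bound[OF P[of n]] by auto
  have "bounded_clinear B"
  proof (rule bounded_clinearI[where K = "K + 1"])
    show "B (x + y) = B x + B y" for x y
      by (rule LIMSEQ_unique[OF B[of "x + y"]]) (auto simp: bounded_clinear_add[OF P] intro!: tendsto_add B)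
    show "B (c *\<^sub>C x) = c *\<^sub>C B x" for c x
      by (rule LIMSEQ_unique[OF B[of "c *\<^sub>C x"]])
        (auto simp: bounded_clinear_scaleC[OF P] intro!: bounded_clinear_tendsto[OF bounded_clinear_scale[OF bounded_clinear_id]] B)
    show "norm (B x) \<le> (K + 1) * norm x" for x
      using norm_triangle_sub[of "B x" "poly_op (p n) T x"] n[of x] K[of x]
      by (simp add: norm_minus_commute algebra_simps)
  qed
  then show ?thesis using lim by blast
qed

lemma op_limit_independent:
  assumes p: "polys_tend_to (real_spectrum T) p f"
    and q: "polys_tend_to (real_spectrum T) q f"
    and B: "op_limit p B"
  shows "op_limit q B"
  unfolding op_limit_def
proof (intro allI impI)
  fix e :: real assume e: "e > 0"
  obtain N where N: "\<And>m n x. m \<ge> N \<Longrightarrow> n \<ge> N \<Longrightarrow> norm (poly_op (q m) T x - poly_op (p n) T x) \<le> e * norm x"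
    using uniform_limits_close[OF q p e] by blast
  have "norm (poly_op (q m) T x - B x) \<le> e * norm x" if "m \<ge> N" for m x
  proof (rule LIMSEQ_le_const2)
    show "(\<lambda>n. norm (poly_op (q m) T x - poly_op (p n) T x)) \<longlonglongrightarrow> norm (poly_op (q m) T x - B x)"
      by (intro tendsto_intros op_limit_pointwise B)
  qed (use N that in blast)
  then show "\<forall>\<^sub>F n in sequentially. \<forall>x. norm (poly_op (q n) T x - B x) \<le> e * norm x"
    by (auto simp: eventually_sequentially)
qed

lemma
  assumes f: "poly_approximable (real_spectrum T) f"
  shows bounded_clinear_cfc: "bounded_clinear (cfc T f)"
    and cfc_limit: "\<And>p x. polys_tend_to (real_spectrum T) p f
      \<Longrightarrow> (\<lambda>n. poly_op (p n) T x) \<longlonglongrightarrow> cfc T f x"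
proof -
  let ?P = "\<lambda>B. bounded_clinear B \<and>
     (\<forall>p. polys_tend_to (real_spectrum T) p f
          \<longrightarrow> (\<lambda>n. onorm (\<lambda>x. poly_op (p n) T x - B x)) \<longlonglongrightarrow> 0)"
  obtain p where p: "polys_tend_to (real_spectrum T) p f"
    using f by (auto simp: poly_approximable_def)
  obtain B where B: "bounded_clinear B" "op_limit p B" using op_limit_exists[OF p] by blast
  have "?P B" using B(1) op_limit_independent[OF p _ B(2)] by (auto simp: op_limit_onorm_iff)
  moreover have "B' = B" if "?P B'" for B'
  proof
    fix x
    have "op_limit p B'" using that p by (auto simp: op_limit_onorm_iff)
    then show "B' x = B x" using op_limit_pointwise B(2) LIMSEQ_unique by blast
  qed
  ultimately have P: "?P (cfc T f)"
    unfolding cfc_def real_spectrum_def[symmetric] by (intro theI[of ?P B]) blast+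
  then show "bounded_clinear (cfc T f)" by blast
  fix q x assume "polys_tend_to (real_spectrum T) q f"
  then have "op_limit q (cfc T f)" using P by (auto simp: op_limit_onorm_iff)
  then show "(\<lambda>n. poly_op (q n) T x) \<longlonglongrightarrow> cfc T f x" by (rule op_limit_pointwise)
qed

lemma cfc_cong:
  assumes "\<And>t. t \<in> real_spectrum T \<Longrightarrow> f t = g t"
  shows "cfc T f = cfc T g"
proof -
  have "uniform_limit (real_spectrum T) p f sequentially = uniform_limit (real_spectrum T) p g sequentially" for p
    by (intro uniform_limit_cong') (use assms in auto)
  then show ?thesis unfolding cfc_def real_spectrum_def[symmetric] by simp
qed

lemma cfc_poly: "cfc T (\<lambda>t. poly p (of_real t)) = poly_op p T"
proof
  fix x
  have "(\<lambda>n. poly_op p T x) \<longlonglongrightarrow> cfc T (\<lambda>t. poly p (of_real t)) x"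
    by (rule cfc_limit[OF poly_approximable_poly]) (auto intro!: uniform_limitI)
  then show "cfc T (\<lambda>t. poly p (of_real t)) x = poly_op p T x"
    using LIMSEQ_unique tendsto_const by blast
qed

lemma poly_approximable_mult:
  assumes "poly_approximable (real_spectrum T) f" "poly_approximable (real_spectrum T) g"
  shows "poly_approximable (real_spectrum T) (\<lambda>t. f t * g t)"
    and "cfc T (\<lambda>t. f t * g t) x = cfc T f (cfc T g x)"
proof -
  obtain p where p: "polys_tend_to (real_spectrum T) p f"
    using assms by (auto simp: poly_approximable_def)
  obtain q where q: "polys_tend_to (real_spectrum T) q g"
    using assms by (auto simp: poly_approximable_def)
  have pq: "uniform_limit (real_spectrum T) (\<lambda>n t. poly (p n * q n) (complex_of_real t)) (\<lambda>t. f t * g t) sequentially"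
    unfolding poly_mult by (intro uniform_lim_mult p q bounded_image_approximable assms)
  then show ap: "poly_approximable (real_spectrum T) (\<lambda>t. f t * g t)"
    unfolding poly_approximable_def by (intro exI[of _ "\<lambda>n. p n * q n"])
  have l1: "(\<lambda>n. poly_op (p n * q n) T x) \<longlonglongrightarrow> cfc T (\<lambda>t. f t * g t) x"
    by (rule cfc_limit[OF ap pq])
  obtain M where M: "\<And>t. t \<in> real_spectrum T \<Longrightarrow> cmod (f t) \<le> M" "M \<ge> 0"
    using bounded_image_approximable[OF assms(1)] unfolding bounded_pos by force
  have "\<forall>\<^sub>F n in sequentially. norm (poly_op (p n) T (poly_op (q n) T x - cfc T g x))
      \<le> (M + 1) * norm (poly_op (q n) T x - cfc T g x)"
    using uniform_limitD[OF p, of 1, simplified]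
  proof eventually_elim
    case (elim n)
    show ?case
    proof (rule poly_op_norm_le[OF selfadjoint])
      fix t assume t: "t \<in> real_spectrum T"
      show "cmod (poly (p n) (of_real t)) \<le> M + 1"
        using norm_triangle_sub[of "poly (p n) (of_real t)" "f t"] M(1)[OF t] elim t by (force simp: dist_norm)
    qed (use M in auto)
  qed
  moreover have "(\<lambda>n. (M + 1) * norm (poly_op (q n) T x - cfc T g x)) \<longlonglongrightarrow> 0"
    using cfc_limit[OF assms(2) q, of x]
    by (intro tendsto_mult_right_zero) (simp add: LIM_zero tendsto_norm_zero)
  ultimately have "(\<lambda>n. poly_op (p n) T (poly_op (q n) T x - cfc T g x)) \<longlonglongrightarrow> 0"
    by (rule Lim_null_comparison)
  then have "(\<lambda>n. poly_op (p n) T (poly_op (q n) T x - cfc T g x) + poly_op (p n) T (cfc T g x))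
      \<longlonglongrightarrow> 0 + cfc T f (cfc T g x)"
    by (intro tendsto_add cfc_limit assms p)
  then have "(\<lambda>n. poly_op (p n * q n) T x) \<longlonglongrightarrow> cfc T f (cfc T g x)"
    by (simp add: poly_op_mult[OF bcl] bounded_clinear_diff[OF bounded_clinear_poly_op[OF bcl]])
  with l1 show "cfc T (\<lambda>t. f t * g t) x = cfc T f (cfc T g x)" by (rule LIMSEQ_unique)
qed

lemmas cfc_mult = poly_approximable_mult(2)

lemma poly_approximable_diff:
  assumes "poly_approximable (real_spectrum T) f" "poly_approximable (real_spectrum T) g"
  shows "poly_approximable (real_spectrum T) (\<lambda>t. f t - g t)"
    and "cfc T (\<lambda>t. f t - g t) x = cfc T f x - cfc T g x"
proof -
  obtain p where p: "polys_tend_to (real_spectrum T) p f"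
    using assms by (auto simp: poly_approximable_def)
  obtain q where q: "polys_tend_to (real_spectrum T) q g"
    using assms by (auto simp: poly_approximable_def)
  have pq: "uniform_limit (real_spectrum T) (\<lambda>n t. poly (p n - q n) (complex_of_real t)) (\<lambda>t. f t - g t) sequentially"
    unfolding poly_diff by (intro uniform_limit_minus p q)
  then show ap: "poly_approximable (real_spectrum T) (\<lambda>t. f t - g t)"
    unfolding poly_approximable_def by (intro exI[of _ "\<lambda>n. p n - q n"])
  have "(\<lambda>n. poly_op (p n) T x - poly_op (q n) T x) \<longlonglongrightarrow> cfc T f x - cfc T g x"
    by (intro tendsto_diff cfc_limit assms p q)
  then show "cfc T (\<lambda>t. f t - g t) x = cfc T f x - cfc T g x"
    using cfc_limit[OF ap pq, of x] LIMSEQ_unique by (simp add: poly_op_diff) blast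
qed

lemmas cfc_diff = poly_approximable_diff(2)

lemma cfc_norm_le:
  assumes f: "poly_approximable (real_spectrum T) f"
    and M: "M \<ge> 0" "\<And>t. t \<in> real_spectrum T \<Longrightarrow> cmod (f t) \<le> M"
  shows "norm (cfc T f x) \<le> M * norm x"
proof -
  obtain p where p: "polys_tend_to (real_spectrum T) p f"
    using f by (auto simp: poly_approximable_def)
  have bnd: "norm (cfc T f x) \<le> (M + e) * norm x" if e: "e > 0" for e
  proof (rule tendsto_upperbound)
    show "(\<lambda>n. norm (poly_op (p n) T x)) \<longlonglongrightarrow> norm (cfc T f x)"
      by (intro tendsto_norm cfc_limit f p)
    show "\<forall>\<^sub>F n in sequentially. norm (poly_op (p n) T x) \<le> (M + e) * norm x"
      using uniform_limitD[OF p e]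
    proof eventually_elim
      case (elim n)
      show ?case
      proof (rule poly_op_norm_le[OF selfadjoint])
        fix t assume t: "t \<in> real_spectrum T"
        show "cmod (poly (p n) (of_real t)) \<le> M + e"
          using norm_triangle_sub[of "poly (p n) (of_real t)" "f t"] M(2)[OF t] elim t by (force simp: dist_norm)
      qed (use M e in auto)
    qed
  qed simp
  show ?thesis
  proof (rule tendsto_lowerbound)
    show "((\<lambda>e. (M + e) * norm x) \<longlongrightarrow> M * norm x) (at_right 0)"
      by (auto intro!: tendsto_eq_intros)
    show "\<forall>\<^sub>F e in at_right 0. norm (cfc T f x) \<le> (M + e) * norm x"
      using bnd by (auto simp: eventually_at_filter)
  qed simp
qed

lemma cinner_cfc:
  assumes f: "poly_approximable (real_spectrum T) f"
  shows "cinner x (cfc T f y) = cinner (cfc T (\<lambda>t. cnj (f t)) x) y"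
proof -
  obtain p where p: "polys_tend_to (real_spectrum T) p f"
    using f by (auto simp: poly_approximable_def)
  have p': "uniform_limit (real_spectrum T) (\<lambda>n t. poly (map_poly cnj (p n)) (complex_of_real t)) (\<lambda>t. cnj (f t)) sequentially"
    using p unfolding uniform_limit_iff by (simp add: poly_map_cnj_of_real dist_norm flip: complex_cnj_diff)
  have lim: "(\<lambda>n. cinner u (X n)) \<longlonglongrightarrow> cinner u v" if "X \<longlonglongrightarrow> v" for u v :: 'h and X
  proof -
    have "(\<lambda>n. norm u * norm (X n - v)) \<longlonglongrightarrow> 0"
      using that by (intro tendsto_mult_right_zero) (simp add: LIM_zero tendsto_norm_zero)
    then have "(\<lambda>n. cinner u (X n) - cinner u v) \<longlonglongrightarrow> 0"
      by (rule Lim_null_comparison[rotated]) (auto simp: cinner_diff_right[symmetric] intro!: always_eventually cinner_cauchy_schwarz)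
    then show ?thesis by (rule LIM_zero_cancel)
  qed
  have 1: "(\<lambda>n. cinner x (poly_op (p n) T y)) \<longlonglongrightarrow> cinner x (cfc T f y)"
    by (intro lim cfc_limit f p)
  have "(\<lambda>n. cnj (cinner y (poly_op (map_poly cnj (p n)) T x))) \<longlonglongrightarrow> cnj (cinner y (cfc T (\<lambda>t. cnj (f t)) x))"
    by (intro tendsto_cnj lim cfc_limit poly_approximable_cnj f p')
  then have "(\<lambda>n. cinner x (poly_op (p n) T y)) \<longlonglongrightarrow> cinner (cfc T (\<lambda>t. cnj (f t)) x) y"
    by (simp only: cinner_commute[symmetric] cinner_poly_op[OF selfadjoint] map_poly_cnj_cnj)
  then show ?thesis using 1 LIMSEQ_unique by blast
qed

end


section \<open>Real powers of the operator and smooth vectors\<close>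

lemma inverse_pop_eq_Some:
  assumes "inj_on T (dom T)"
  shows "inverse_pop T y = Some x \<longleftrightarrow> T x = Some y"
proof -
  have uniq: "x = x'" if "T x = Some y" "T x' = Some y" for x x'
    using that assms by (intro inj_onD[OF assms]) auto
  show ?thesis
  proof (cases "\<exists>x. T x = Some y")
    case True
    then obtain x' where x': "T x' = Some y" by blast
    then have "(THE x. T x = Some y) = x'" using uniq by blast
    then show ?thesis using x' uniq by (auto simp: inverse_pop_def)
  qed (auto simp: inverse_pop_def)
qed

lemma inverse_pop_Some_comp:
  assumes "inj f" shows "inverse_pop (Some \<circ> f) y = Some x \<longleftrightarrow> f x = y"
  using inverse_pop_eq_Some[of "Some \<circ> f" y x] assms by (auto simp: inj_on_def dom_def)

locale sobolev_scale =
  fixes \<Theta> :: "'h::complex_hilbert \<rightharpoonup> 'h"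
  assumes sa: "self_adjoint_pop \<Theta>" and pos: "positive_pop \<Theta>" and binv: "has_bounded_inverse \<Theta>"
begin

definition R :: "'h \<Rightarrow> 'h" where "R y = the (inverse_pop \<Theta> y)"

lemma inverse_pop_Theta: "inverse_pop \<Theta> y = Some x \<longleftrightarrow> \<Theta> x = Some y"
  using binv by (intro inverse_pop_eq_Some) (simp add: has_bounded_inverse_def)

lemma Theta_R: "\<Theta> (R y) = Some y"
proof -
  have "y \<in> ran \<Theta>" using binv by (simp add: has_bounded_inverse_def)
  then obtain x where "\<Theta> x = Some y" by (auto simp: ran_def)
  then show ?thesis using inverse_pop_Theta[of y x] by (simp add: R_def)
qed

lemma R_eqI: "\<Theta> x = Some y \<Longrightarrow> R y = x"
  using inverse_pop_Theta[of y x] by (simp add: R_def)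

lemma dom_Theta: "dom \<Theta> = range R"
  using Theta_R R_eqI by (auto simp: dom_def image_iff)

lemma R_bcl: "bounded_clinear R"
proof -
  have "R = (\<lambda>y. the (inverse_pop \<Theta> y))" by (auto simp: R_def)
  then show ?thesis using binv by (simp add: has_bounded_inverse_def)
qed

lemma Theta_symmetric:
  assumes "\<Theta> x = Some u" "\<Theta> y = Some v" shows "cinner y u = cinner v x"
proof -
  have "\<forall>x\<in>dom \<Theta>. cinner y (the (\<Theta> x)) = cinner v x"
    using sa assms(2) by (simp add: self_adjoint_pop_def)
  then show ?thesis using assms(1) by force
qed

lemma R_selfadjoint: "bounded_selfadjoint R"
  unfolding bounded_selfadjoint_def
  using R_bcl Theta_symmetric[OF Theta_R Theta_R] by auto

sublocale selfadjoint_op R by standard (rule R_selfadjoint)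

lemma R_positive: "Re (cinner x (R x)) \<ge> 0"
proof -
  have "R x \<in> dom \<Theta>" using Theta_R by auto
  then have "Re (cinner (R x) (the (\<Theta> (R x)))) \<ge> 0" using pos unfolding positive_pop_def by blast
  then have "Re (cinner (R x) x) \<ge> 0" by (simp add: Theta_R)
  then show ?thesis by (subst cinner_commute) simp
qed

lemma R_injD: "R x = 0 \<Longrightarrow> x = 0"
  using Theta_R[of x] sa by (simp add: self_adjoint_pop_def linear_pop_def)

text \<open>Any bound for the norm of \<open>R\<close> will do.\<close>

definition specbound :: real where
  "specbound = (SOME K. K > 0 \<and> (\<forall>x. norm (R x) \<le> K * norm x))"

lemma specbound: "specbound > 0" "norm (R x) \<le> specbound * norm x"
  using someI_ex[OF bounded_clinear_bound[OF R_bcl]] unfolding specbound_def by auto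

lemma real_spectrum_R: "real_spectrum R \<subseteq> {0..specbound}"
proof
  fix t assume t: "t \<in> real_spectrum R"
  then have "t \<ge> 0" using positive_spectrum_nonneg[OF R_bcl R_positive] by (simp add: real_spectrum_def)
  moreover have "\<bar>t\<bar> \<le> specbound"
    using op_spectrum_bound[OF R_bcl specbound(2), of "of_real t"] t specbound(1) by (simp add: real_spectrum_def)
  ultimately show "t \<in> {0..specbound}" by simp
qed

lemma approximable_continuous:
  assumes "continuous_on {0..specbound} f" shows "poly_approximable (real_spectrum R) f"
  using complex_poly_approx[OF assms] uniform_limit_on_subset[OF _ real_spectrum_R]
  unfolding poly_approximable_def by blast

definition powR :: "real \<Rightarrow> 'h \<Rightarrow> 'h" where
  "powR a = cfc R (\<lambda>t. complex_of_real (t powr a))"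

lemma approximable_powr:
  assumes "a > 0" shows "poly_approximable (real_spectrum R) (\<lambda>t. complex_of_real (t powr a))"
  by (intro approximable_continuous continuous_on_of_real continuous_on_powr' continuous_intros)
    (use assms in auto)

lemma powR_bcl: "a > 0 \<Longrightarrow> bounded_clinear (powR a)"
  unfolding powR_def by (intro bounded_clinear_cfc approximable_powr)

lemma powR_add: "a > 0 \<Longrightarrow> b > 0 \<Longrightarrow> powR a (powR b x) = powR (a + b) x"
  unfolding powR_def by (simp add: cfc_mult[symmetric] approximable_powr powr_add)

lemma powR_1: "powR 1 = R"
proof -
  have "powR 1 = cfc R (\<lambda>t. poly [:0,1:] (of_real t))"
    unfolding powR_def by (rule cfc_cong) (use real_spectrum_R in auto)
  also have "\<dots> = R" unfolding cfc_poly by (auto simp: poly_op_X[OF R_bcl])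
  finally show ?thesis .
qed

lemma cinner_powR: "a > 0 \<Longrightarrow> cinner x (powR a y) = cinner (powR a x) y"
  unfolding powR_def by (simp add: cinner_cfc approximable_powr)

text \<open>Every \<open>R\<^sup>a\<close> is a factor of a power of \<open>R\<close> with positive integer exponent, and \<open>R\<close> is injective.\<close>

lemma powR_injD: assumes "a > 0" "powR a x = 0" shows "x = 0"
proof -
  have nat: "powR (real (Suc n)) y = 0 \<Longrightarrow> y = 0" for n y
  proof (induction n)
    case 0
    then show ?case using R_injD by (simp add: powR_1)
  next
    case (Suc n)
    have "powR (1 + real (Suc n)) y = R (powR (real (Suc n)) y)"
      by (subst powR_add[symmetric]) (auto simp: powR_1)
    then have "R (powR (real (Suc n)) y) = 0" using Suc.prems by (simp add: add_ac)
    then show ?case using Suc.IH R_injD by blast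
  qed
  obtain n where n: "a < real n" using reals_Archimedean2 by blast
  have "powR (real (Suc n)) x = powR (real (Suc n) - a) (powR a x)"
    using n assms by (subst powR_add) auto
  also have "\<dots> = 0" using n assms bounded_clinear_zero[OF powR_bcl] by simp
  finally show ?thesis by (rule nat)
qed

lemma powR_inj: assumes "a > 0" shows "inj (powR a)"
proof (rule injI)
  fix x y assume "powR a x = powR a y"
  then have "powR a (x - y) = 0" using bounded_clinear_diff[OF powR_bcl[OF assms]] by simp
  then have "x - y = 0" by (rule powR_injD[OF assms])
  then show "x = y" by simp
qed

text \<open>\<open>P s\<close> is \<open>\<Theta>\<^sup>s\<close> as a total function, to be applied to elements of the domain only.\<close>

definition P :: "real \<Rightarrow> 'h \<Rightarrow> 'h" where "P s x = the (pow_pop \<Theta> s x)"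

lemma pow_pop_eq:
  "pow_pop \<Theta> s = (if s = 0 then Some else if s < 0 then Some \<circ> powR (- s) else inverse_pop (Some \<circ> powR s))"
proof -
  have "(\<lambda>y. the (inverse_pop \<Theta> y)) = R" by (auto simp: R_def)
  then show ?thesis unfolding pow_pop_def Let_def powR_def by simp
qed

lemma pow_pop_pos: "s > 0 \<Longrightarrow> pow_pop \<Theta> s x = Some y \<longleftrightarrow> powR s y = x"
  using inverse_pop_Some_comp[OF powR_inj] by (simp add: pow_pop_eq)

lemma dom_pow_pos: "s > 0 \<Longrightarrow> dom (pow_pop \<Theta> s) = range (powR s)"
  by (auto simp: dom_def pow_pop_pos)

lemma dom_pow_nonpos: "s \<le> 0 \<Longrightarrow> dom (pow_pop \<Theta> s) = UNIV"
  by (auto simp: pow_pop_eq)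

lemma P_0 [simp]: "P 0 x = x" by (simp add: P_def pow_pop_eq)

lemma P_neg: "s > 0 \<Longrightarrow> P (- s) x = powR s x" by (simp add: P_def pow_pop_eq)

lemma P_powR_same: "s > 0 \<Longrightarrow> P s (powR s y) = y"
  using pow_pop_pos[of s "powR s y" y] by (simp add: P_def)

lemma P_linear:
  assumes "x \<in> dom (pow_pop \<Theta> s)" "y \<in> dom (pow_pop \<Theta> s)"
  shows dom_pow_add: "x + y \<in> dom (pow_pop \<Theta> s)" and P_add: "P s (x + y) = P s x + P s y"
    and dom_pow_scale: "c *\<^sub>C x \<in> dom (pow_pop \<Theta> s)" and P_scale: "P s (c *\<^sub>C x) = c *\<^sub>C P s x"
proof -
  consider "s > 0" | "s = 0" | "s < 0" by linarith
  then have "x + y \<in> dom (pow_pop \<Theta> s) \<and> P s (x + y) = P s x + P s y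
      \<and> c *\<^sub>C x \<in> dom (pow_pop \<Theta> s) \<and> P s (c *\<^sub>C x) = c *\<^sub>C P s x"
  proof cases
    case 1
    then obtain u v where uv: "x = powR s u" "y = powR s v" using assms by (auto simp: dom_pow_pos)
    have "x + y = powR s (u + v)" "c *\<^sub>C x = powR s (c *\<^sub>C u)"
      using uv powR_bcl[OF 1] by (auto simp: bounded_clinear_add bounded_clinear_scaleC)
    then show ?thesis using uv 1 by (simp add: P_powR_same dom_pow_pos)
  next
    case 3
    then show ?thesis using P_neg[of "- s"] powR_bcl[of "- s"]
      by (simp add: dom_pow_nonpos bounded_clinear_add bounded_clinear_scaleC)
  qed (simp add: dom_pow_nonpos)
  then show "x + y \<in> dom (pow_pop \<Theta> s)" "P s (x + y) = P s x + P s y"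
    "c *\<^sub>C x \<in> dom (pow_pop \<Theta> s)" "P s (c *\<^sub>C x) = c *\<^sub>C P s x" by blast+
qed

lemma P_diff:
  assumes "x \<in> dom (pow_pop \<Theta> s)" "y \<in> dom (pow_pop \<Theta> s)"
  shows "P s (x - y) = P s x - P s y"
  using P_linear[OF assms(1) dom_pow_scale[OF assms(2) assms(2), of "-1"]] P_scale[OF assms(2) assms(2), of "-1"]
  by auto

text \<open>The group law in the form in which it is used: a smooth vector is of the form \<open>R\<^sup>m y\<close> for all
  \<open>m\<close>, and with \<open>m\<close> large all exponents remain positive.\<close>

lemma P_powR:
  assumes "m > 0" "m - s > 0"
  shows "P s (powR m y) = powR (m - s) y"
proof -
  consider "s > 0" | "s = 0" | "s < 0" by linarith
  then show ?thesis
  proof cases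
    case 1
    have "powR m y = powR s (powR (m - s) y)" using assms 1 by (simp add: powR_add)
    then show ?thesis using 1 by (simp add: P_powR_same)
  next
    case 3
    then show ?thesis using P_neg[of "- s"] assms by (simp add: powR_add)
  qed simp
qed


subsection \<open>Smooth vectors\<close>

abbreviation Hinf :: "'h set" where "Hinf \<equiv> sob_infty \<Theta>"

lemma sob_pnorm_P: "sob_pnorm \<Theta> s x = norm (P s x)" by (simp add: sob_pnorm_def P_def)

lemma sob_cauchy_iff:
  "X \<in> sob_cauchy \<Theta> s \<longleftrightarrow> range X \<subseteq> dom (pow_pop \<Theta> s) \<and> Cauchy (\<lambda>n. P s (X n))"
proof -
  have "sob_pnorm \<Theta> s (X m - X n) = dist (P s (X m)) (P s (X n))" if "range X \<subseteq> dom (pow_pop \<Theta> s)" for m n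
  proof -
    have "X m \<in> dom (pow_pop \<Theta> s)" "X n \<in> dom (pow_pop \<Theta> s)" using that by auto
    then show ?thesis by (simp only: sob_pnorm_P P_diff dist_norm)
  qed
  then have "(\<forall>e>0. \<exists>N. \<forall>m\<ge>N. \<forall>n\<ge>N. sob_pnorm \<Theta> s (X m - X n) < e) \<longleftrightarrow> Cauchy (\<lambda>n. P s (X n))"
    if "range X \<subseteq> dom (pow_pop \<Theta> s)" using that unfolding Cauchy_def by presburger
  then show ?thesis unfolding sob_cauchy_def by blast
qed

lemma Hinf_iff: "x \<in> Hinf \<longleftrightarrow> (\<forall>s>0. x \<in> range (powR s))"
proof -
  have pos: "(\<exists>X\<in>sob_cauchy \<Theta> s. X \<longlonglongrightarrow> x) \<longleftrightarrow> x \<in> range (powR s)" if s: "s > 0" for s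
  proof
    assume "\<exists>X\<in>sob_cauchy \<Theta> s. X \<longlonglongrightarrow> x"
    then obtain X where X: "range X \<subseteq> range (powR s)" "Cauchy (\<lambda>n. P s (X n))" "X \<longlonglongrightarrow> x"
      using s by (auto simp: sob_cauchy_iff dom_pow_pos)
    obtain y where y: "(\<lambda>n. P s (X n)) \<longlonglongrightarrow> y" using X(2) by (metis Cauchy_convergent convergent_def)
    have "powR s (P s (X n)) = X n" for n
    proof -
      obtain z where "X n = powR s z" using X(1) by blast
      then show ?thesis by (simp add: P_powR_same[OF s])
    qed
    then have "X \<longlonglongrightarrow> powR s y" using bounded_clinear_tendsto[OF powR_bcl[OF s] y] by simp
    then show "x \<in> range (powR s)" using X(3) LIMSEQ_unique by blast
  next
    assume "x \<in> range (powR s)"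
    then have "(\<lambda>_. x) \<in> sob_cauchy \<Theta> s" using s by (auto simp: sob_cauchy_iff dom_pow_pos Cauchy_def)
    then show "\<exists>X\<in>sob_cauchy \<Theta> s. X \<longlonglongrightarrow> x" by (rule bexI[rotated]) (rule tendsto_const)
  qed
  have zero: "\<exists>X\<in>sob_cauchy \<Theta> 0. X \<longlonglongrightarrow> x"
    by (rule bexI[of _ "\<lambda>_. x"]) (auto simp: sob_cauchy_iff dom_pow_nonpos Cauchy_def)
  have "x \<in> Hinf \<longleftrightarrow> (\<forall>s\<ge>0. \<exists>X\<in>sob_cauchy \<Theta> s. X \<longlonglongrightarrow> x)" by (auto simp: sob_infty_def)
  also have "\<dots> \<longleftrightarrow> (\<forall>s>0. \<exists>X\<in>sob_cauchy \<Theta> s. X \<longlonglongrightarrow> x)"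
    using zero by (auto simp: le_less)
  finally show ?thesis using pos by simp
qed

lemma Hinf_powRE:
  assumes "x \<in> Hinf" "m > 0" obtains y where "x = powR m y"
  using assms by (auto simp: Hinf_iff)

lemma Hinf_in_dom: "x \<in> Hinf \<Longrightarrow> x \<in> dom (pow_pop \<Theta> s)"
  by (cases "s > 0") (auto simp: Hinf_iff dom_pow_pos dom_pow_nonpos)

lemma Hinf_0 [simp]: "0 \<in> Hinf"
  unfolding Hinf_iff using bounded_clinear_zero[OF powR_bcl] by (metis rangeI)

lemma Hinf_add: "x \<in> Hinf \<Longrightarrow> y \<in> Hinf \<Longrightarrow> x + y \<in> Hinf"
  unfolding Hinf_iff using bounded_clinear_add[OF powR_bcl] by (metis rangeE rangeI)

lemma Hinf_scale: "x \<in> Hinf \<Longrightarrow> c *\<^sub>C x \<in> Hinf"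
  unfolding Hinf_iff using bounded_clinear_scaleC[OF powR_bcl] by (metis rangeE rangeI)

lemma Hinf_of_nat: assumes "\<And>n. x \<in> range (powR (real (Suc n)))" shows "x \<in> Hinf"
  unfolding Hinf_iff
proof (intro allI impI)
  fix s :: real assume s: "s > 0"
  obtain n where n: "s < real n" using reals_Archimedean2 by blast
  obtain y where "x = powR (real (Suc n)) y" using assms by blast
  also have "\<dots> = powR s (powR (real (Suc n) - s) y)" using n s by (subst powR_add) auto
  finally show "x \<in> range (powR s)" by blast
qed

lemma P_Hinf: assumes "x \<in> Hinf" shows "P s x \<in> Hinf"
  unfolding Hinf_iff
proof (intro allI impI)
  fix r :: real assume r: "r > 0"
  have "\<bar>s\<bar> + r + 1 > 0" using r by linarith
  then obtain y where y: "x = powR (\<bar>s\<bar> + r + 1) y" by (rule Hinf_powRE[OF assms])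
  have "P s x = powR (\<bar>s\<bar> + r + 1 - s) y" unfolding y by (rule P_powR) (use r in auto)
  also have "\<dots> = powR r (powR (\<bar>s\<bar> + 1 - s) y)" using r by (subst powR_add) (auto simp: algebra_simps)
  finally show "P s x \<in> range (powR r)" by blast
qed

lemma P_P: assumes "x \<in> Hinf" shows "P a (P b x) = P (a + b) x"
proof -
  define m where "m = \<bar>a\<bar> + \<bar>b\<bar> + 1"
  have "m > 0" by (simp add: m_def add_nonneg_pos)
  then obtain y where y: "x = powR m y" by (rule Hinf_powRE[OF assms])
  have "P b x = powR (m - b) y" unfolding y by (rule P_powR) (auto simp: m_def)
  then have "P a (P b x) = powR (m - b - a) y" by (simp add: P_powR m_def)
  also have "\<dots> = P (a + b) x" unfolding y by (subst P_powR) (auto simp: m_def algebra_simps)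
  finally show ?thesis .
qed

lemma P_minus_P [simp]: "x \<in> Hinf \<Longrightarrow> P (- a) (P a x) = x" "x \<in> Hinf \<Longrightarrow> P a (P (- a) x) = x"
  by (simp_all add: P_P)

lemma cinner_P: assumes "x \<in> Hinf" "y \<in> Hinf" shows "cinner x (P s y) = cinner (P s x) y"
proof -
  define m where "m = \<bar>s\<bar> + 1"
  have m0: "m > 0" by (simp add: m_def add_nonneg_pos)
  obtain u where u: "x = powR m u" by (rule Hinf_powRE[OF assms(1) m0])
  obtain v where v: "y = powR m v" by (rule Hinf_powRE[OF assms(2) m0])
  have 1: "P s x = powR (m - s) u" "P s y = powR (m - s) v"
    unfolding u v by (rule P_powR; simp add: m_def)+
  have m: "m > 0" "m - s > 0" by (auto simp: m_def)
  have "cinner (powR m u) (powR (m - s) v) = cinner u (powR m (powR (m - s) v))"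
    using m by (simp add: cinner_powR)
  also have "\<dots> = cinner u (powR (m - s) (powR m v))" using m by (simp add: powR_add add.commute)
  also have "\<dots> = cinner (powR (m - s) u) (powR m v)" using m by (simp add: cinner_powR)
  finally show ?thesis using 1 u v by simp
qed

lemma Theta_P: "x \<in> Hinf \<Longrightarrow> \<Theta> x = Some (P 1 x)"
  using Hinf_powRE[of x 1] P_powR_same[of 1] Theta_R by (metis powR_1 zero_less_one)

lemma P_linear_Hinf:
  assumes "x \<in> Hinf" "y \<in> Hinf"
  shows "P s (x + y) = P s x + P s y" "P s (x - y) = P s x - P s y" "P s (c *\<^sub>C x) = c *\<^sub>C P s x"
  using assms by (auto intro!: P_add P_diff P_scale Hinf_in_dom)

text \<open>Vectors of the form \<open>g(R) R y\<close> with a cut-off \<open>g\<close> vanishing near \<open>0\<close> lie in the range of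
  every power of \<open>R\<close>, and they approximate the vectors \<open>R y\<close>, which form the domain of
  \<open>\<Theta>\<close>.\<close>

lemma Hinf_dense: assumes "e > 0" shows "\<exists>x\<in>Hinf. norm (x - h) < e"
proof -
  have "h \<in> closure (range R)" using sa by (simp add: self_adjoint_pop_def dom_Theta)
  then obtain y where y: "norm (R y - h) < e / 2"
    using assms by (force simp: closure_approachable dist_norm dest: spec[of _ "e/2"])
  obtain n :: nat where n: "2 * (2 * (norm y + 1)) / e < real n" using reals_Archimedean2 by blast
  have n0: "real n > 0"
    using assms by (intro le_less_trans[OF _ n] divide_nonneg_pos) (auto simp: add_nonneg_pos)
  define g where "g t = min 1 (max 0 (real n * t - 1))" for t
  define w where "w = cfc R (\<lambda>t. complex_of_real (g t * t)) y"
  have apg: "poly_approximable (real_spectrum R) (\<lambda>t. complex_of_real (g t * t))"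
    unfolding g_def by (intro approximable_continuous continuous_intros)
  have "w \<in> Hinf" unfolding Hinf_iff
  proof (intro allI impI)
    fix s :: real assume s: "s > 0"
    \<comment> \<open>\<open>k t = t\<^sup>1\<^sup>-\<^sup>s g t\<close>; the maximum keeps the power continuous at \<open>0\<close> and differs from \<open>t\<close> only where \<open>g\<close> vanishes\<close>
    define k where "k t = max t (1 / real n) powr (1 - s) * g t" for t
    have mpos: "max t (1 / real n) > 0" for t using n0 by (simp add: less_max_iff_disj)
    have mp: "0 \<le> max t (1 / real n)" "max t (1 / real n) \<noteq> 0" for t
      using mpos[of t] by linarith+
    have apk: "poly_approximable (real_spectrum R) (\<lambda>t. complex_of_real (k t))"
      unfolding k_def g_def
      by (intro approximable_continuous continuous_on_of_real continuous_on_mult continuous_on_powr' continuous_intros)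
        (simp add: mp)
    have "cfc R (\<lambda>t. complex_of_real (g t * t)) = cfc R (\<lambda>t. complex_of_real (t powr s) * complex_of_real (k t))"
    proof (rule cfc_cong)
      fix t assume "t \<in> real_spectrum R"
      then have t: "t \<ge> 0" using real_spectrum_R by auto
      have "g t * t = t powr s * k t"
      proof (cases "t \<le> 1 / real n")
        case True
        then have "real n * t - 1 \<le> 0" using n0 by (simp add: field_simps)
        then have "g t = 0" by (simp add: g_def)
        then show ?thesis by (simp add: k_def)
      next
        case False
        moreover have "1 / real n > 0" using n0 by simp
        ultimately have "t > 0" "max t (1 / real n) = t" by linarith+
        then show ?thesis by (simp add: k_def powr_diff)
      qed
      then show "complex_of_real (g t * t) = complex_of_real (t powr s) * complex_of_real (k t)"
        by (metis of_real_mult)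
    qed
    then have "w = cfc R (\<lambda>t. complex_of_real (t powr s) * complex_of_real (k t)) y"
      by (simp only: w_def)
    also have "\<dots> = powR s (cfc R (\<lambda>t. complex_of_real (k t)) y)"
      unfolding powR_def by (rule cfc_mult[OF approximable_powr[OF s] apk])
    finally show "w \<in> range (powR s)" by blast
  qed
  moreover have "norm (w - R y) \<le> 2 / real n * norm y"
  proof -
    have X: "poly_op [:0, 1:] R = R" by (auto simp: poly_op_X[OF R_bcl])
    have "w - R y = cfc R (\<lambda>t. complex_of_real (g t * t) - poly [:0, 1:] (of_real t)) y"
      by (simp only: cfc_diff[OF apg poly_approximable_poly] w_def cfc_poly X)
    also have "norm \<dots> \<le> 2 / real n * norm y"
    proof (rule cfc_norm_le)
      show "poly_approximable (real_spectrum R) (\<lambda>t. complex_of_real (g t * t) - poly [:0, 1:] (of_real t))"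
        by (intro poly_approximable_diff apg poly_approximable_poly)
      fix t assume "t \<in> real_spectrum R"
      then have t: "t \<ge> 0" using real_spectrum_R by auto
      have g: "0 \<le> g t" "g t \<le> 1" by (auto simp: g_def)
      have "g t * t - t = - ((1 - g t) * t)" by (simp add: algebra_simps)
      then have "\<bar>g t * t - t\<bar> = (1 - g t) * t" using g t by (simp add: abs_mult)
      also have "\<dots> \<le> 2 / real n"
      proof (cases "t \<le> 2 / real n")
        case True
        then show ?thesis using g t mult_left_le_one_le[of t "1 - g t"] by linarith
      next
        case False
        then have "real n * t - 1 \<ge> 1" using n0 by (simp add: field_simps)
        then show ?thesis using n0 by (simp add: g_def)
      qed
      finally have "\<bar>g t * t - t\<bar> \<le> 2 / real n" .
      moreover have "complex_of_real (g t * t) - poly [:0, 1:] (of_real t) = of_real (g t * t - t)" by simp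
      ultimately show "cmod (complex_of_real (g t * t) - poly [:0, 1:] (of_real t)) \<le> 2 / real n"
        by (metis norm_of_real)
    qed (use n0 in auto)
    finally show ?thesis .
  qed
  moreover have "2 / real n * norm y < e / 2"
  proof -
    have "2 * (2 * (norm y + 1)) < real n * e" using n assms by (simp add: field_simps)
    then have "4 * norm y < real n * e" by simp
    then show ?thesis using n0 assms by (simp add: field_simps)
  qed
  ultimately show ?thesis
    using y norm_triangle_ineq[of "w - R y" "R y - h"] by (intro bexI[of _ w]) auto
qed

end


section \<open>The completions as copies of the Hilbert space\<close>

lemma dense_sequence:
  fixes h :: "'h::real_normed_vector"
  assumes "\<And>e. e > 0 \<Longrightarrow> \<exists>x\<in>D. norm (x - h) < e"
  shows "\<exists>X. (\<forall>n. X n \<in> D) \<and> X \<longlonglongrightarrow> h"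
proof -
  have "\<forall>n. \<exists>x\<in>D. norm (x - h) < inverse (real (Suc n))" using assms by simp
  then obtain X where X: "\<And>n. X n \<in> D" "\<And>n. norm (X n - h) < inverse (real (Suc n))" by metis
  have "(\<lambda>n. X n - h) \<longlonglongrightarrow> 0"
    by (rule Lim_null_comparison[OF _ LIMSEQ_inverse_real_of_nat])
      (use X(2) in \<open>auto intro!: always_eventually less_imp_le\<close>)
  then show ?thesis using X(1) LIM_zero_cancel by blast
qed

lemma bounded_extension_dense:
  fixes F :: "'h::complex_hilbert \<Rightarrow> 'h"
  assumes D: "\<And>x y. x \<in> D \<Longrightarrow> y \<in> D \<Longrightarrow> x + y \<in> D" "\<And>c x. x \<in> D \<Longrightarrow> c *\<^sub>C x \<in> D"
    and dense: "\<And>h e. e > 0 \<Longrightarrow> \<exists>x\<in>D. norm (x - h) < e"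
    and F: "\<And>x y. x \<in> D \<Longrightarrow> y \<in> D \<Longrightarrow> F (x + y) = F x + F y" "\<And>c x. x \<in> D \<Longrightarrow> F (c *\<^sub>C x) = c *\<^sub>C F x"
    and C: "C \<ge> 0" "\<And>x. x \<in> D \<Longrightarrow> norm (F x) \<le> C * norm x"
  obtains B where "bounded_clinear B" "\<And>x. x \<in> D \<Longrightarrow> B x = F x" "\<And>x. norm (B x) \<le> C * norm x"
proof -
  have Fdiff: "F x - F y = F (x - y)" "x - y \<in> D" if "x \<in> D" "y \<in> D" for x y
    using F(1)[of x "(-1) *\<^sub>C y"] F(2)[of y "-1"] D(1)[of x "(-1) *\<^sub>C y"] D(2)[of y "-1"] that by auto
  have "\<exists>X. (\<forall>n. X n \<in> D) \<and> X \<longlonglongrightarrow> h" for h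
    by (rule dense_sequence) (rule dense)
  then obtain X where X: "\<And>h n. X h n \<in> D" "\<And>h. X h \<longlonglongrightarrow> h" by metis
  have conv: "convergent (\<lambda>n. F (Y n))" if Y: "\<And>n. Y n \<in> D" "convergent Y" for Y
  proof -
    have "Cauchy (\<lambda>n. F (Y n))"
    proof (rule metric_CauchyI)
      fix e :: real assume e: "e > 0"
      have "e / (C + 1) > 0" using e C by simp
      then obtain N where N: "\<And>m n. m \<ge> N \<Longrightarrow> n \<ge> N \<Longrightarrow> dist (Y m) (Y n) < e / (C + 1)"
        using convergent_Cauchy[OF Y(2)] unfolding Cauchy_def by blast
      have "dist (F (Y m)) (F (Y n)) < e" if "m \<ge> N" "n \<ge> N" for m n
      proof -
        have "dist (F (Y m)) (F (Y n)) \<le> C * norm (Y m - Y n)"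
          using Fdiff[OF Y(1) Y(1)] C(2) by (simp add: dist_norm)
        also have "\<dots> \<le> (C + 1) * norm (Y m - Y n)" by (intro mult_right_mono) auto
        also have "\<dots> < e" using N[OF that] C by (simp add: dist_norm field_simps)
        finally show ?thesis .
      qed
      then show "\<exists>M. \<forall>m\<ge>M. \<forall>n\<ge>M. dist (F (Y m)) (F (Y n)) < e" by blast
    qed
    then show ?thesis by (simp add: Cauchy_convergent_iff)
  qed
  define B where "B h = lim (\<lambda>n. F (X h n))" for h
  have BX: "(\<lambda>n. F (X h n)) \<longlonglongrightarrow> B h" for h
    using conv[of "X h"] X convergent_LIMSEQ_iff unfolding B_def convergent_def by metis
  have BY: "(\<lambda>n. F (Y n)) \<longlonglongrightarrow> B h" if Y: "\<And>n. Y n \<in> D" "Y \<longlonglongrightarrow> h" for Y h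
  proof -
    have "(\<lambda>n. C * norm (Y n - X h n)) \<longlonglongrightarrow> C * norm (h - h)" by (intro tendsto_intros Y X)
    then have "(\<lambda>n. C * norm (Y n - X h n)) \<longlonglongrightarrow> 0" by simp
    then have "(\<lambda>n. F (Y n) - F (X h n)) \<longlonglongrightarrow> 0"
      by (rule Lim_null_comparison[rotated])
        (use Fdiff[OF Y(1) X(1)] C(2) in \<open>auto intro!: always_eventually\<close>)
    from tendsto_add[OF this BX[of h]] show ?thesis by simp
  qed
  have bnd: "norm (B h) \<le> C * norm h" for h
  proof (rule LIMSEQ_le[OF tendsto_norm[OF BX]])
    show "(\<lambda>n. C * norm (X h n)) \<longlonglongrightarrow> C * norm h" by (intro tendsto_intros X)
  qed (use C(2) X(1) in blast)
  have "bounded_clinear B"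
  proof (rule bounded_clinearI[OF _ _ bnd])
    show "B (x + y) = B x + B y" for x y
    proof (rule LIMSEQ_unique)
      show "(\<lambda>n. F (X x n + X y n)) \<longlonglongrightarrow> B (x + y)" by (intro BY D X tendsto_add)
      show "(\<lambda>n. F (X x n + X y n)) \<longlonglongrightarrow> B x + B y"
        by (simp only: F(1)[OF X(1) X(1)]) (intro tendsto_add BX)
    qed
    show "B (c *\<^sub>C x) = c *\<^sub>C B x" for c x
    proof (rule LIMSEQ_unique)
      note sc = bounded_clinear_tendsto[OF bounded_clinear_scale[OF bounded_clinear_id]]
      show "(\<lambda>n. F (c *\<^sub>C X x n)) \<longlonglongrightarrow> B (c *\<^sub>C x)" by (intro BY D X sc)
      show "(\<lambda>n. F (c *\<^sub>C X x n)) \<longlonglongrightarrow> c *\<^sub>C B x"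
        by (simp only: F(2)[OF X(1)]) (intro sc BX)
    qed
  qed
  moreover have "B x = F x" if "x \<in> D" for x
    using BY[of "\<lambda>_. x" x] that LIMSEQ_unique tendsto_const by blast
  ultimately show thesis using that bnd by blast
qed

context sobolev_scale
begin

text \<open>
  \<open>cls s h\<close> is the point of the completion of index \<open>s\<close> to which the extension of \<open>\<Theta>\<^sup>s\<close> assigns the
  vector \<open>h\<close>. The lemmas below show that \<open>cls s\<close> is an isometric linear bijection from the Hilbert
  space onto the completion; surjectivity of the extended \<open>\<Theta>\<^sup>s\<close> is the density of the smooth vectors.
\<close>

definition cls :: "real \<Rightarrow> 'h \<Rightarrow> (nat \<Rightarrow> 'h) set" where
  "cls s h = {X. range X \<subseteq> dom (pow_pop \<Theta> s) \<and> (\<lambda>n. P s (X n)) \<longlonglongrightarrow> h}"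

lemma clsI: "(\<And>n. X n \<in> dom (pow_pop \<Theta> s)) \<Longrightarrow> (\<lambda>n. P s (X n)) \<longlonglongrightarrow> h \<Longrightarrow> X \<in> cls s h"
  unfolding cls_def by blast

lemma clsD:
  assumes "X \<in> cls s h"
  shows "X n \<in> dom (pow_pop \<Theta> s)" "(\<lambda>n. P s (X n)) \<longlonglongrightarrow> h"
  using assms unfolding cls_def by blast+

lemma cls_nonempty: "\<exists>X. X \<in> cls s h \<and> range X \<subseteq> Hinf"
proof -
  have "\<exists>X. (\<forall>n. X n \<in> Hinf) \<and> X \<longlonglongrightarrow> h" by (rule dense_sequence) (rule Hinf_dense)
  then obtain X where X: "\<And>n. X n \<in> Hinf" "X \<longlonglongrightarrow> h" by blast
  then have "(\<lambda>n. P (- s) (X n)) \<in> cls s h"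
    using X by (intro clsI Hinf_in_dom P_Hinf) simp_all
  then show ?thesis using P_Hinf X(1) by blast
qed

lemma cls_inj: "X \<in> cls s h \<Longrightarrow> X \<in> cls s k \<Longrightarrow> h = k"
  unfolding cls_def using LIMSEQ_unique by blast

lemma cls_eq_iff [simp]: "cls s h = cls s k \<longleftrightarrow> h = k"
  using cls_nonempty cls_inj by metis

lemma sob_cauchy_cls: "X \<in> sob_cauchy \<Theta> s \<longleftrightarrow> (\<exists>h. X \<in> cls s h)"
  unfolding sob_cauchy_iff cls_def Cauchy_convergent_iff convergent_def by blast

lemma sob_rel_iff: "(X, Y) \<in> sob_rel \<Theta> s \<longleftrightarrow> (\<exists>h. X \<in> cls s h \<and> Y \<in> cls s h)"
proof -
  have "(\<lambda>n. sob_pnorm \<Theta> s (X n - Y n)) \<longlonglongrightarrow> 0 \<longleftrightarrow> h = k" if "X \<in> cls s h" "Y \<in> cls s k" for h k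
  proof -
    have "sob_pnorm \<Theta> s (X n - Y n) = norm (P s (X n) - P s (Y n))" for n
    proof -
      have "X n \<in> dom (pow_pop \<Theta> s)" "Y n \<in> dom (pow_pop \<Theta> s)" using that clsD(1) by blast+
      then show ?thesis by (simp only: sob_pnorm_P P_diff)
    qed
    moreover have "(\<lambda>n. norm (P s (X n) - P s (Y n))) \<longlonglongrightarrow> norm (h - k)"
      using that by (auto simp: cls_def intro!: tendsto_intros)
    ultimately show ?thesis
      by (metis (no_types, lifting) LIMSEQ_unique eq_iff_diff_eq_0 ext norm_eq_zero)
  qed
  then show ?thesis by (simp add: sob_rel_def sob_cauchy_cls) blast
qed

lemma sob_rel_Image: "X \<in> cls s h \<Longrightarrow> sob_rel \<Theta> s `` {X} = cls s h"
  by (auto simp: sob_rel_iff dest: cls_inj[of X s h])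

lemma sob_eq: "sob \<Theta> s = range (cls s)"
proof -
  have "sob \<Theta> s = (\<lambda>X. sob_rel \<Theta> s `` {X}) ` sob_cauchy \<Theta> s" by (auto simp: sob_def quotient_def)
  also have "\<dots> = range (cls s)"
  proof safe
    fix X assume "X \<in> sob_cauchy \<Theta> s"
    then show "sob_rel \<Theta> s `` {X} \<in> range (cls s)" using sob_rel_Image sob_cauchy_cls by auto
  next
    fix h
    obtain X where "X \<in> cls s h" using cls_nonempty by blast
    then show "cls s h \<in> (\<lambda>X. sob_rel \<Theta> s `` {X}) ` sob_cauchy \<Theta> s"
      using sob_rel_Image sob_cauchy_cls by (metis image_eqI)
  qed
  finally show ?thesis .
qed

lemma sob_emb_cls: "x \<in> dom (pow_pop \<Theta> s) \<Longrightarrow> sob_emb \<Theta> s x = cls s (P s x)"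
  unfolding sob_emb_def by (intro sob_rel_Image clsI) simp_all

lemma sob_add_cls: "sob_add \<Theta> s (cls s h) (cls s k) = cls s (h + k)"
proof -
  have "(\<lambda>n. X n + Y n) \<in> cls s (h + k)" if "X \<in> cls s h" "Y \<in> cls s k" for X Y
  proof -
    have d: "X n \<in> dom (pow_pop \<Theta> s)" "Y n \<in> dom (pow_pop \<Theta> s)" for n using that clsD(1) by blast+
    have "(\<lambda>n. P s (X n) + P s (Y n)) \<longlonglongrightarrow> h + k" using that by (auto simp: cls_def intro!: tendsto_add)
    then show ?thesis by (intro clsI dom_pow_add d) (simp only: P_add[OF d])
  qed
  then have "sob_rel \<Theta> s `` {\<lambda>n. X n + Y n} = cls s (h + k)" if "X \<in> cls s h" "Y \<in> cls s k" for X Y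
    using that sob_rel_Image by blast
  then show ?thesis unfolding sob_add_def using cls_nonempty[of s h] cls_nonempty[of s k] by blast
qed

lemma sob_scale_cls: "sob_scale \<Theta> s c (cls s h) = cls s (c *\<^sub>C h)"
proof -
  have "(\<lambda>n. c *\<^sub>C X n) \<in> cls s (c *\<^sub>C h)" if "X \<in> cls s h" for X
  proof -
    have d: "X n \<in> dom (pow_pop \<Theta> s)" for n using that clsD(1) by blast
    have "(\<lambda>n. c *\<^sub>C P s (X n)) \<longlonglongrightarrow> c *\<^sub>C h"
      using that bounded_clinear_tendsto[OF bounded_clinear_scale[OF bounded_clinear_id]]
      by (auto simp: cls_def)
    then show ?thesis by (intro clsI dom_pow_scale[OF d d]) (simp only: P_scale[OF d d])
  qed
  then have "sob_rel \<Theta> s `` {\<lambda>n. c *\<^sub>C X n} = cls s (c *\<^sub>C h)" if "X \<in> cls s h" for X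
    using that sob_rel_Image by blast
  then show ?thesis unfolding sob_scale_def using cls_nonempty[of s h] by blast
qed

lemma sob_norm_cls: "sob_norm \<Theta> s (cls s h) = norm h"
proof -
  have lim: "(\<lambda>n. sob_pnorm \<Theta> s (X n)) \<longlonglongrightarrow> norm h" if "X \<in> cls s h" for X
    using that by (auto simp: cls_def sob_pnorm_P intro!: tendsto_norm)
  obtain X where X: "X \<in> cls s h" using cls_nonempty by blast
  show ?thesis unfolding sob_norm_def
  proof (rule the_equality)
    show "\<forall>X\<in>cls s h. (\<lambda>n. sob_pnorm \<Theta> s (X n)) \<longlonglongrightarrow> norm h" using lim by blast
    show "l = norm h" if "\<forall>X\<in>cls s h. (\<lambda>n. sob_pnorm \<Theta> s (X n)) \<longlonglongrightarrow> l" for l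
      using that lim[OF X] X LIMSEQ_unique by blast
  qed
qed

text \<open>Bounded operators between completions are thus bounded operators on the Hilbert space itself.\<close>

lemma sob_bounded_transfer:
  assumes "sob_bounded \<Theta> a b B"
  shows "\<exists>B'. bounded_clinear B' \<and> (\<forall>h. B (cls a h) = cls b (B' h))"
proof -
  have "B (cls a h) \<in> range (cls b)" for h
    using assms by (auto simp: sob_bounded_def sob_eq PiE_def Pi_def)
  then have "\<forall>h. \<exists>k. B (cls a h) = cls b k" by blast
  then obtain B' where B': "\<And>h. B (cls a h) = cls b (B' h)" by metis
  have add: "B' (x + y) = B' x + B' y" for x y
  proof -
    have "B (sob_add \<Theta> a (cls a x) (cls a y)) = sob_add \<Theta> b (B (cls a x)) (B (cls a y))"
      using assms by (auto simp: sob_bounded_def sob_eq)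
    then show ?thesis by (simp add: sob_add_cls B')
  qed
  have scale: "B' (c *\<^sub>C x) = c *\<^sub>C B' x" for c x
  proof -
    have "B (sob_scale \<Theta> a c (cls a x)) = sob_scale \<Theta> b c (B (cls a x))"
      using assms by (auto simp: sob_bounded_def sob_eq)
    then show ?thesis by (simp add: sob_scale_cls B')
  qed
  obtain C where C: "\<And>h. sob_norm \<Theta> b (B (cls a h)) \<le> C * sob_norm \<Theta> a (cls a h)"
    using assms unfolding sob_bounded_def sob_eq by blast
  have "bounded_clinear B'"
    by (rule bounded_clinearI[OF add scale]) (use C in \<open>simp add: B' sob_norm_cls\<close>)
  then show ?thesis using B' by blast
qed

lemma sob_ext_bound:
  assumes B: "is_sob_ext \<Theta> a b T B" and T: "\<And>x. x \<in> Hinf \<Longrightarrow> the (T x) \<in> Hinf"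
  shows "\<exists>B'. bounded_clinear B' \<and> (\<forall>h. B (cls a h) = cls b (B' h)) \<and> (\<forall>x\<in>Hinf. P b (the (T x)) = B' (P a x))"
proof -
  obtain B' where B': "bounded_clinear B'" "\<And>h. B (cls a h) = cls b (B' h)"
    using sob_bounded_transfer B unfolding is_sob_ext_def by metis
  have "P b (the (T x)) = B' (P a x)" if x: "x \<in> Hinf" for x
  proof -
    have "B (sob_emb \<Theta> a x) = sob_emb \<Theta> b (the (T x))" using B x by (simp add: is_sob_ext_def)
    then show ?thesis using x T[OF x] by (simp add: sob_emb_cls Hinf_in_dom B'(2))
  qed
  then show ?thesis using B' by blast
qed

lemma op_class_bound:
  assumes "A \<in> op_class \<Theta> 0"
  shows "\<exists>C>0. \<forall>x\<in>Hinf. norm (P s (the (A x))) \<le> C * norm (P s x)"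
proof -
  have "\<exists>B. is_sob_ext \<Theta> (s + 0) s A B" using assms unfolding op_class_def by blast
  then obtain B where B: "is_sob_ext \<Theta> s s A B" by auto
  have "the (A x) \<in> Hinf" if x: "x \<in> Hinf" for x
  proof -
    have "x \<in> dom A" using assms x by (simp add: op_class_def)
    then obtain y where "A x = Some y" by blast
    then show ?thesis using assms by (auto simp: op_class_def ran_def)
  qed
  then obtain B' where "bounded_clinear B'" "\<forall>x\<in>Hinf. P s (the (A x)) = B' (P s x)"
    using sob_ext_bound[OF B] by blast
  then show ?thesis using bounded_clinear_bound[of B'] by metis
qed

lemma sob_ext_unique:
  assumes T: "\<And>x. x \<in> Hinf \<Longrightarrow> the (T x) \<in> Hinf"
    and B1: "is_sob_ext \<Theta> a b T B1" and B2: "is_sob_ext \<Theta> a b T B2"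
  shows "B1 = B2"
proof -
  obtain C1 where C1: "bounded_clinear C1" "\<And>h. B1 (cls a h) = cls b (C1 h)" "\<And>x. x \<in> Hinf \<Longrightarrow> P b (the (T x)) = C1 (P a x)"
    using sob_ext_bound[OF B1 T] by blast
  obtain C2 where C2: "bounded_clinear C2" "\<And>h. B2 (cls a h) = cls b (C2 h)" "\<And>x. x \<in> Hinf \<Longrightarrow> P b (the (T x)) = C2 (P a x)"
    using sob_ext_bound[OF B2 T] by blast
  have eq: "C1 x = C2 x" if "x \<in> Hinf" for x
    using C1(3)[OF P_Hinf[OF that, of "- a"]] C2(3)[OF P_Hinf[OF that, of "- a"]] that by simp
  have "C1 h = C2 h" for h
  proof -
    obtain X where X: "X \<in> cls 0 h" "range X \<subseteq> Hinf" using cls_nonempty by blast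
    then have "X \<longlonglongrightarrow> h" by (simp add: cls_def)
    then have "(\<lambda>n. C1 (X n)) \<longlonglongrightarrow> C1 h" "(\<lambda>n. C2 (X n)) \<longlonglongrightarrow> C2 h"
      using bounded_clinear_tendsto C1(1) C2(1) by blast+
    moreover have "C1 (X n) = C2 (X n)" for n using eq X(2) by auto
    ultimately show ?thesis using LIMSEQ_unique by simp
  qed
  then have on: "B1 z = B2 z" if "z \<in> sob \<Theta> a" for z using that C1(2) C2(2) by (auto simp: sob_eq)
  have "B1 \<in> sob \<Theta> a \<rightarrow>\<^sub>E sob \<Theta> b" "B2 \<in> sob \<Theta> a \<rightarrow>\<^sub>E sob \<Theta> b"
    using B1 B2 by (auto simp: is_sob_ext_def sob_bounded_def)
  then show ?thesis using on by (rule PiE_ext)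
qed

lemma sob_ext_is_sob_ext:
  assumes "\<And>x. x \<in> Hinf \<Longrightarrow> the (T x) \<in> Hinf" "is_sob_ext \<Theta> a b T B"
  shows "sob_ext \<Theta> a b T = B"
  unfolding sob_ext_def 
  by (rule the_equality[where P = "is_sob_ext \<Theta> a b T", OF assms(2)])
    (rule sob_ext_unique[where T = T, OF assms(1) _ assms(2)])

text \<open>Conjugated with the isometries, the extension of \<open>T\<close> is that of \<open>\<Theta>\<^sup>b T \<Theta>\<^sup>-\<^sup>a\<close>, which is bounded on the
  dense subspace of smooth vectors.\<close>

lemma sob_ext_exists:
  assumes T: "\<And>x. x \<in> Hinf \<Longrightarrow> the (T x) \<in> Hinf"
    and add: "\<And>x y. x \<in> Hinf \<Longrightarrow> y \<in> Hinf \<Longrightarrow> the (T (x + y)) = the (T x) + the (T y)"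
    and scale: "\<And>c x. x \<in> Hinf \<Longrightarrow> the (T (c *\<^sub>C x)) = c *\<^sub>C the (T x)"
    and C: "C \<ge> 0" "\<And>x. x \<in> Hinf \<Longrightarrow> norm (P b (the (T x))) \<le> C * norm (P a x)"
  shows "is_sob_ext \<Theta> a b T (sob_ext \<Theta> a b T)" and "sob_onorm \<Theta> a b (sob_ext \<Theta> a b T) \<le> C"
proof -
  define F where "F w = P b (the (T (P (- a) w)))" for w
  obtain B' where B': "bounded_clinear B'" "\<And>x. x \<in> Hinf \<Longrightarrow> B' x = F x" "\<And>x. norm (B' x) \<le> C * norm x"
  proof (rule bounded_extension_dense[where D = Hinf and F = F and C = C])
    show "F (x + y) = F x + F y" if "x \<in> Hinf" "y \<in> Hinf" for x y
      using that by (simp add: F_def P_linear_Hinf add T P_Hinf)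
    show "F (c *\<^sub>C x) = c *\<^sub>C F x" if "x \<in> Hinf" for c x
      using that by (simp add: F_def P_linear_Hinf[OF that that] scale P_Hinf P_linear_Hinf[OF T T])
    show "norm (F x) \<le> C * norm x" if "x \<in> Hinf" for x
      using C(2)[OF P_Hinf[OF that, of "- a"]] that by (simp add: F_def)
  qed (use Hinf_add Hinf_scale Hinf_dense C in auto)
  define B where "B = (\<lambda>z\<in>sob \<Theta> a. cls b (B' (THE h. z = cls a h)))"
  have Bc: "B (cls a h) = cls b (B' h)" for h
    by (simp add: B_def sob_eq)
  have bnd: "\<forall>x\<in>sob \<Theta> a. sob_norm \<Theta> b (B x) \<le> C * sob_norm \<Theta> a x"
    using B'(3) by (auto simp: sob_eq Bc sob_norm_cls)
  have "sob_bounded \<Theta> a b B"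
    unfolding sob_bounded_def
  proof (intro conjI)
    show "B \<in> sob \<Theta> a \<rightarrow>\<^sub>E sob \<Theta> b" 
    proof -
      have "B \<in> extensional (sob \<Theta> a)" by (simp add: B_def)
      then show ?thesis by (auto simp: PiE_def sob_eq Bc)
    qed
    show "\<forall>x\<in>sob \<Theta> a. \<forall>y\<in>sob \<Theta> a. B (sob_add \<Theta> a x y) = sob_add \<Theta> b (B x) (B y)"
      by (auto simp: sob_eq sob_add_cls Bc bounded_clinear_add[OF B'(1)])
    show "\<forall>c. \<forall>x\<in>sob \<Theta> a. B (sob_scale \<Theta> a c x) = sob_scale \<Theta> b c (B x)"
      by (auto simp: sob_eq sob_scale_cls Bc bounded_clinear_scaleC[OF B'(1)])
  qed (use bnd in blast)
  moreover have "\<forall>x\<in>Hinf. B (sob_emb \<Theta> a x) = sob_emb \<Theta> b (the (T x))"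
    by (simp add: sob_emb_cls Hinf_in_dom T Bc B'(2) P_Hinf F_def)
  ultimately have ext: "is_sob_ext \<Theta> a b T B" by (simp add: is_sob_ext_def)
  have eq: "sob_ext \<Theta> a b T = B" by (rule sob_ext_is_sob_ext[where T = T, OF T ext])
  show "is_sob_ext \<Theta> a b T (sob_ext \<Theta> a b T)" using ext eq by simp
  show "sob_onorm \<Theta> a b (sob_ext \<Theta> a b T) \<le> C"
    unfolding eq sob_onorm_def by (rule cInf_lower) (use bnd C in \<open>auto intro: bdd_belowI[of _ 0]\<close>)
qed

lemma hilbert_ext_extends:
  assumes "A \<in> op_class \<Theta> 0"
  shows "bounded_clinear (hilbert_ext \<Theta> A)" and "x \<in> Hinf \<Longrightarrow> A x = Some (hilbert_ext \<Theta> A x)"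
    and "x \<in> Hinf \<Longrightarrow> hilbert_ext \<Theta> A x \<in> Hinf"
proof -
  have dA: "dom A = Hinf" "ran A \<subseteq> Hinf" using assms by (auto simp: op_class_def)
  have T: "the (A x) \<in> Hinf" if x: "x \<in> Hinf" for x
  proof -
    obtain y where "A x = Some y" using x dA(1) by blast
    then show ?thesis using dA(2) by (auto simp: ran_def)
  qed
  have "\<exists>B. is_sob_ext \<Theta> (0 + 0) 0 A B" using assms unfolding op_class_def by blast
  then obtain B where B: "is_sob_ext \<Theta> 0 0 A B" by auto
  obtain B' where B': "bounded_clinear B'" "\<And>h. B (cls 0 h) = cls 0 (B' h)" "\<And>x. x \<in> Hinf \<Longrightarrow> P 0 (the (A x)) = B' (P 0 x)"
    using sob_ext_bound[OF B T] by blast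
  have emb: "sob_emb \<Theta> 0 = cls 0" by (auto simp: sob_emb_cls dom_pow_nonpos)
  have ext: "sob_ext \<Theta> 0 0 A = B" by (rule sob_ext_is_sob_ext[where T = A, OF _ B]) (rule T)
  have "inj (cls 0)" by (rule injI) simp
  then have eq: "hilbert_ext \<Theta> A = B'"
    unfolding hilbert_ext_def ext emb
    by (auto simp: B'(2))
  show "bounded_clinear (hilbert_ext \<Theta> A)" using B' eq by simp
  show 1: "A x = Some (hilbert_ext \<Theta> A x)" if x: "x \<in> Hinf" for x
  proof -
    obtain y where "A x = Some y" using x dA(1) by blast
    then show ?thesis using B'(3)[OF x] eq by simp
  qed
  show "hilbert_ext \<Theta> A x \<in> Hinf" if "x \<in> Hinf" for x using T[OF that] 1[OF that] by simp
qed

end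


section \<open>Chebyshev expansion of smooth functions\<close>

lemma nth_deriv_vector_derivative:
  assumes "smooth_real f"
  shows "(nth_deriv k f has_vector_derivative nth_deriv (Suc k) f x) (at x)"
  using assms by (auto simp: smooth_real_def nth_deriv_def vector_derivative_works)

lemma nth_deriv_0 [simp]: "nth_deriv 0 f = f"
  by (simp add: nth_deriv_def)

lemma nth_deriv_comp: "nth_deriv j (nth_deriv k f) = nth_deriv (j + k) f"
  by (simp add: nth_deriv_def funpow_add)

lemma smooth_real_nth_deriv: "smooth_real f \<Longrightarrow> smooth_real (nth_deriv k f)"
  by (simp add: smooth_real_def nth_deriv_comp)

lemma continuous_on_nth_deriv: "smooth_real f \<Longrightarrow> continuous_on A (nth_deriv k f)"
  by (intro continuous_at_imp_continuous_on ballI)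
    (rule has_vector_derivative_continuous[OF nth_deriv_vector_derivative])

lemma continuous_on_smooth: "smooth_real f \<Longrightarrow> continuous_on A f"
  using continuous_on_nth_deriv[of f A 0] by simp

lemma nth_deriv_cnj:
  assumes "smooth_real f" shows "nth_deriv k (\<lambda>x. cnj (f x)) = (\<lambda>x. cnj (nth_deriv k f x))"
proof (induction k)
  case (Suc k)
  have "((\<lambda>x. cnj (nth_deriv k f x)) has_vector_derivative cnj (nth_deriv (Suc k) f x)) (at x)" for x
    by (rule bounded_linear.has_vector_derivative[OF bounded_linear_cnj nth_deriv_vector_derivative[OF assms]])
  then have "vector_derivative (\<lambda>x. cnj (nth_deriv k f x)) (at x) = cnj (nth_deriv (Suc k) f x)" for x
    by (rule vector_derivative_at)
  then show ?case using Suc by (simp add: nth_deriv_def)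
qed simp

lemma smooth_real_cnj: "smooth_real f \<Longrightarrow> smooth_real (\<lambda>x. cnj (f x))"
  by (subst smooth_real_def, simp only: nth_deriv_cnj, intro allI,
      rule differentiableI_vector, rule bounded_linear.has_vector_derivative[OF bounded_linear_cnj],
      rule nth_deriv_vector_derivative)

locale chebyshev =
  fixes L :: real assumes L_pos: "L > 0"
begin

text \<open>The norms without weights on the compact interval, and the cosine coefficients of
  \<open>f (L cos \<theta>)\<close>.\<close>

definition I :: "nat \<Rightarrow> (real \<Rightarrow> complex) \<Rightarrow> real" where
  "I m f = integral {-L..L} (\<lambda>x. cmod (nth_deriv m f x))"

definition ccoef :: "(real \<Rightarrow> complex) \<Rightarrow> nat \<Rightarrow> complex" where
  "ccoef f k = integral {0..pi} (\<lambda>\<theta>. f (L * cos \<theta>) * of_real (cos (real k * \<theta>)))"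

lemma Lcos_range: "L * cos \<theta> \<in> {-L..L}"
proof -
  have "L * cos \<theta> \<le> L * 1" "L * (- 1) \<le> L * cos \<theta>" using L_pos by (intro mult_left_mono; simp)+
  then show ?thesis by simp
qed

lemma I_nonneg: "I m f \<ge> 0"
  unfolding I_def
  by (cases "(\<lambda>x. cmod (nth_deriv m f x)) integrable_on {-L..L}")
    (auto simp: not_integrable_integral intro: integral_nonneg)

lemma integrable_nth_deriv:
  "smooth_real f \<Longrightarrow> (\<lambda>x. cmod (nth_deriv m f x)) integrable_on {a..b}"
  by (intro integrable_continuous_real continuous_intros continuous_on_nth_deriv)

lemma continuous_on_Lcos:
  assumes "continuous_on {-L..L} f" shows "continuous_on A (\<lambda>\<theta>. f (L * cos \<theta>))"
  using Lcos_range by (intro continuous_on_compose2[OF assms] continuous_intros) auto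

text \<open>One integration by parts; the boundary terms vanish because \<open>sin (k \<theta>)\<close> does.\<close>

lemma ccoef_by_parts:
  assumes f: "smooth_real f" and k: "k \<ge> 1"
  shows "of_nat k * ccoef f k
    = integral {0..pi} (\<lambda>\<theta>. of_real (L * sin \<theta> * sin (real k * \<theta>)) * nth_deriv 1 f (L * cos \<theta>))"
proof -
  let ?g = "nth_deriv 1 f"
  have cf: "continuous_on {-L..L} f" "continuous_on {-L..L} ?g"
    using f by (auto intro: continuous_on_smooth continuous_on_nth_deriv)
  have d: "((\<lambda>\<theta>. f (L * cos \<theta>) * of_real (sin (real k * \<theta>))) has_vector_derivative
      of_nat k * (f (L * cos \<theta>) * of_real (cos (real k * \<theta>)))
      - of_real (L * sin \<theta> * sin (real k * \<theta>)) * ?g (L * cos \<theta>)) (at \<theta> within {0..pi})" for \<theta>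
  proof -
    have 1: "((\<lambda>\<theta>. f (L * cos \<theta>)) has_vector_derivative (- (L * sin \<theta>)) *\<^sub>R ?g (L * cos \<theta>)) (at \<theta> within {0..pi})"
    proof -
      have a: "((\<lambda>\<theta>. L * cos \<theta>) has_vector_derivative - (L * sin \<theta>)) (at \<theta> within {0..pi})"
        unfolding has_real_derivative_iff_has_vector_derivative[symmetric]
        by (auto intro!: derivative_eq_intros)
      have b: "(f has_vector_derivative ?g (L * cos \<theta>)) (at (L * cos \<theta>) within (\<lambda>\<theta>. L * cos \<theta>) ` {0..pi})"
        using nth_deriv_vector_derivative[OF f, of 0] has_vector_derivative_at_within by fastforce
      show ?thesis using vector_diff_chain_within[OF a b] by (simp add: o_def)
    qed
    have 2: "((\<lambda>\<theta>. complex_of_real (sin (real k * \<theta>))) has_vector_derivative of_real (real k * cos (real k * \<theta>))) (at \<theta> within {0..pi})"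
      by (rule has_vector_derivative_of_real) (auto intro!: derivative_eq_intros)
    show ?thesis
      using has_vector_derivative_mult[OF 1 2] by (simp add: scaleR_conv_of_real algebra_simps)
  qed
  have "((\<lambda>\<theta>. of_nat k * (f (L * cos \<theta>) * of_real (cos (real k * \<theta>)))
      - of_real (L * sin \<theta> * sin (real k * \<theta>)) * ?g (L * cos \<theta>)) has_integral
      f (L * cos pi) * of_real (sin (real k * pi)) - f (L * cos 0) * of_real (sin (real k * 0))) {0..pi}"
    by (rule fundamental_theorem_of_calculus) (use d in auto)
  then have "((\<lambda>\<theta>. of_nat k * (f (L * cos \<theta>) * of_real (cos (real k * \<theta>)))
      - of_real (L * sin \<theta> * sin (real k * \<theta>)) * ?g (L * cos \<theta>)) has_integral 0) {0..pi}"
    by simp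
  then have "integral {0..pi} (\<lambda>\<theta>. of_nat k * (f (L * cos \<theta>) * of_real (cos (real k * \<theta>)))
      - of_real (L * sin \<theta> * sin (real k * \<theta>)) * ?g (L * cos \<theta>)) = 0"
    by (rule integral_unique)
  moreover have "(\<lambda>\<theta>. of_nat k * (f (L * cos \<theta>) * of_real (cos (real k * \<theta>)))) integrable_on {0..pi}"
    "(\<lambda>\<theta>. of_real (L * sin \<theta> * sin (real k * \<theta>)) * ?g (L * cos \<theta>)) integrable_on {0..pi}"
    by (intro integrable_continuous_real continuous_intros continuous_on_Lcos cf)+
  ultimately show ?thesis unfolding ccoef_def by (simp add: integral_diff)
qed

lemma ccoef_decay_1:
  assumes f: "smooth_real f" and k: "k \<ge> 1"
  shows "real k * cmod (ccoef f k) \<le> I 1 f"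
proof -
  let ?h = "\<lambda>x. cmod (nth_deriv 1 f x)"
  have ch: "continuous_on {-L..L} ?h" by (intro continuous_intros continuous_on_nth_deriv f)
  have "((\<lambda>\<theta>. (- (L * sin \<theta>)) *\<^sub>R ?h (L * cos \<theta>)) has_integral
      (integral {L * cos 0..L * cos pi} ?h - integral {L * cos pi..L * cos 0} ?h)) {0..pi}"
    by (rule has_integral_substitution_general[where s = "{}" and c = "-L" and d = L])
      (use Lcos_range ch in \<open>auto intro!: derivative_eq_intros continuous_intros simp del: atLeastAtMost_iff\<close>)
  then have "((\<lambda>\<theta>. - ((- (L * sin \<theta>)) *\<^sub>R ?h (L * cos \<theta>))) has_integral - (- I 1 f)) {0..pi}"
    using L_pos by (intro has_integral_neg) (simp add: I_def)
  then have sub: "((\<lambda>\<theta>. L * sin \<theta> * ?h (L * cos \<theta>)) has_integral I 1 f) {0..pi}" by simp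
  have "real k * cmod (ccoef f k) = cmod (of_nat k * ccoef f k)" by (simp add: norm_mult)
  also have "\<dots> \<le> integral {0..pi} (\<lambda>\<theta>. L * sin \<theta> * ?h (L * cos \<theta>))"
    unfolding ccoef_by_parts[OF f k]
  proof (rule integral_norm_bound_integral)
    show "(\<lambda>\<theta>. of_real (L * sin \<theta> * sin (real k * \<theta>)) * nth_deriv 1 f (L * cos \<theta>)) integrable_on {0..pi}"
      by (intro integrable_continuous_real continuous_intros continuous_on_Lcos continuous_on_nth_deriv f)
    fix \<theta> assume t: "\<theta> \<in> {0..pi}"
    then have s: "sin \<theta> \<ge> 0" by (simp add: sin_ge_zero)
    have "cmod (of_real (L * sin \<theta> * sin (real k * \<theta>)) * nth_deriv 1 f (L * cos \<theta>))
        = L * sin \<theta> * \<bar>sin (real k * \<theta>)\<bar> * ?h (L * cos \<theta>)"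
      using s L_pos by (simp add: norm_mult abs_mult)
    also have "\<dots> \<le> L * sin \<theta> * 1 * ?h (L * cos \<theta>)"
      using s L_pos by (intro mult_right_mono mult_left_mono) auto
    finally show "cmod (of_real (L * sin \<theta> * sin (real k * \<theta>)) * nth_deriv 1 f (L * cos \<theta>))
        \<le> L * sin \<theta> * ?h (L * cos \<theta>)" by simp
  qed (use sub in auto)
  also have "\<dots> = I 1 f" using sub by (rule integral_unique)
  finally show ?thesis .
qed

text \<open>The two factors \<open>sin\<close> combine to a difference of cosines, so that coefficients of \<open>f\<close> are expressed by
  those of its derivative and the integration by parts can be iterated.\<close>

lemma ccoef_deriv:
  assumes f: "smooth_real f" and k: "k \<ge> 1"
  shows "of_nat (2 * k) * ccoef f k = of_real L * (ccoef (nth_deriv 1 f) (k - 1) - ccoef (nth_deriv 1 f) (k + 1))"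
proof -
  let ?g = "nth_deriv 1 f"
  have eq: "2 * (of_real (L * sin \<theta> * sin (real k * \<theta>)) * ?g (L * cos \<theta>))
      = of_real L * (?g (L * cos \<theta>) * of_real (cos (real (k - 1) * \<theta>)) - ?g (L * cos \<theta>) * of_real (cos (real (k + 1) * \<theta>)))" for \<theta>
  proof -
    have "cos (real (k - 1) * \<theta>) - cos (real (k + 1) * \<theta>) = 2 * (sin \<theta> * sin (real k * \<theta>))"
      using k by (simp add: of_nat_diff algebra_simps cos_add cos_diff)
    then have e: "complex_of_real (cos (real (k - 1) * \<theta>)) - of_real (cos (real (k + 1) * \<theta>)) = of_real (2 * (sin \<theta> * sin (real k * \<theta>)))"
      by (metis of_real_diff)
    show ?thesis unfolding right_diff_distrib[symmetric] e by simp
  qed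
  have int: "(\<lambda>\<theta>. ?g (L * cos \<theta>) * of_real (cos (real j * \<theta>))) integrable_on {0..pi}" for j
    by (intro integrable_continuous_real continuous_intros continuous_on_Lcos continuous_on_nth_deriv f)
  have "of_nat (2 * k) * ccoef f k = 2 * (of_nat k * ccoef f k)" by simp
  also have "\<dots> = integral {0..pi} (\<lambda>\<theta>. 2 * (of_real (L * sin \<theta> * sin (real k * \<theta>)) * ?g (L * cos \<theta>)))"
    unfolding ccoef_by_parts[OF f k] by simp
  also have "\<dots> = of_real L * (ccoef ?g (k - 1) - ccoef ?g (k + 1))"
    by (simp only: eq ccoef_def integral_mult_right integral_diff[OF int int])
  finally show ?thesis .
qed

text \<open>Integrating by parts \<open>m\<close> times costs only the \<open>L\<^sup>1\<close> norm of the \<open>m\<close>-th derivative: each step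
  produces a factor \<open>sin \<theta>\<close>, which is absorbed into the cosines except in the last step, where it is
  the Jacobian of \<open>x = L cos \<theta>\<close>.\<close>

lemma ccoef_decay:
  "\<exists>C\<ge>0. \<forall>f k. smooth_real f \<longrightarrow> k \<ge> Suc m \<longrightarrow> real k ^ Suc m * cmod (ccoef f k) \<le> C * I (Suc m) f"
proof (induction m)
  case 0
  then show ?case using ccoef_decay_1 by (intro exI[of _ 1]) auto
next
  case (Suc m)
  then obtain C where C: "C \<ge> 0" "\<And>f k. smooth_real f \<Longrightarrow> k \<ge> Suc m \<Longrightarrow> real k ^ Suc m * cmod (ccoef f k) \<le> C * I (Suc m) f"
    by blast
  have "real k ^ Suc (Suc m) * cmod (ccoef f k) \<le> (L * 2 ^ Suc m * C) * I (Suc (Suc m)) f"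
    if f: "smooth_real f" and k: "k \<ge> Suc (Suc m)" for f k
  proof -
    let ?g = "nth_deriv 1 f"
    have g: "smooth_real ?g" by (rule smooth_real_nth_deriv[OF f])
    have Ig: "I (Suc m) ?g = I (Suc (Suc m)) f" by (simp add: I_def nth_deriv_comp)
    have near: "real k ^ Suc m * cmod (ccoef ?g j) \<le> 2 ^ Suc m * (C * I (Suc (Suc m)) f)"
      if j: "j \<ge> Suc m" "k \<le> 2 * j" for j
    proof -
      have "real k ^ Suc m * cmod (ccoef ?g j) \<le> (2 * real j) ^ Suc m * cmod (ccoef ?g j)"
        using j by (intro mult_right_mono power_mono) auto
      also have "\<dots> = 2 ^ Suc m * (real j ^ Suc m * cmod (ccoef ?g j))" by (simp only: power_mult_distrib mult.assoc)
      also have "\<dots> \<le> 2 ^ Suc m * (C * I (Suc (Suc m)) f)"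
        using C(2)[OF g j(1)] unfolding Ig by (intro mult_left_mono) auto
      finally show ?thesis .
    qed
    have "2 * (real k * cmod (ccoef f k)) = cmod (of_nat (2 * k) * ccoef f k)" by (simp only: norm_mult norm_of_nat)
    also have "\<dots> = L * cmod (ccoef ?g (k - 1) - ccoef ?g (k + 1))"
      using ccoef_deriv[OF f, of k] k L_pos by (simp add: norm_mult)
    also have "\<dots> \<le> L * (cmod (ccoef ?g (k - 1)) + cmod (ccoef ?g (k + 1)))"
      using L_pos by (intro mult_left_mono norm_triangle_ineq4) auto
    finally have "real k ^ Suc m * (2 * (real k * cmod (ccoef f k)))
        \<le> real k ^ Suc m * (L * (cmod (ccoef ?g (k - 1)) + cmod (ccoef ?g (k + 1))))"
      by (intro mult_left_mono) auto
    also have "\<dots> = L * (real k ^ Suc m * cmod (ccoef ?g (k - 1)) + real k ^ Suc m * cmod (ccoef ?g (k + 1)))"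
      by (simp only: distrib_left mult.left_commute)
    also have "\<dots> \<le> L * (2 ^ Suc m * (C * I (Suc (Suc m)) f) + 2 ^ Suc m * (C * I (Suc (Suc m)) f))"
      using L_pos k by (intro mult_left_mono add_mono near) auto
    finally show ?thesis by (simp add: algebra_simps)
  qed
  then show ?case using C(1) L_pos by (intro exI[of _ "L * 2 ^ Suc m * C"]) auto
qed

text \<open>Compare \<open>f x\<close> with \<open>f y\<close> by the fundamental theorem of calculus and average over \<open>y\<close>.\<close>

lemma sup_bound:
  assumes f: "smooth_real f" and x: "x \<in> {-L..L}"
  shows "cmod (f x) \<le> (1 / (2 * L)) * I 0 f + I 1 f"
proof -
  have 1: "cmod (f x) - I 1 f \<le> cmod (f y)" if y: "y \<in> {-L..L}" for y
  proof -
    have ftc: "cmod (f b - f a) \<le> I 1 f" if ab: "a \<le> b" "a \<in> {-L..L}" "b \<in> {-L..L}" for a b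
    proof -
      have "(nth_deriv 1 f has_integral (f b - f a)) {a..b}"
        using nth_deriv_vector_derivative[OF f, of 0] ab(1)
        by (intro fundamental_theorem_of_calculus) (auto intro: has_vector_derivative_at_within)
      then have "f b - f a = integral {a..b} (nth_deriv 1 f)" by (simp add: integral_unique)
      also have "cmod \<dots> \<le> integral {a..b} (\<lambda>x. cmod (nth_deriv 1 f x))"
        by (intro integral_norm_bound_integral integrable_nth_deriv f integrable_continuous_real continuous_on_nth_deriv) auto
      also have "\<dots> \<le> I 1 f"
        unfolding I_def using ab by (intro integral_subset_le integrable_nth_deriv f) auto
      finally show ?thesis .
    qed
    have "cmod (f x - f y) \<le> I 1 f"
      using ftc[of x y] ftc[of y x] x y by (cases "x \<le> y") (auto simp: norm_minus_commute)
    then show ?thesis using norm_triangle_sub[of "f x" "f y"] by linarith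
  qed
  have "2 * L * (cmod (f x) - I 1 f) = integral {-L..L} (\<lambda>y. cmod (f x) - I 1 f)" using L_pos by simp
  also have "\<dots> \<le> integral {-L..L} (\<lambda>y. cmod (f y))"
    using 1 integrable_nth_deriv[OF f, of 0] by (intro integral_le) (auto simp del: atLeastAtMost_iff)
  also have "\<dots> = I 0 f" by (simp add: I_def)
  finally show ?thesis using L_pos by (simp add: field_simps)
qed

definition tnorm :: "nat \<Rightarrow> (real \<Rightarrow> complex) \<Rightarrow> real" where
  "tnorm N f = (\<Sum>j\<le>N. I j f)"

lemma I_le_tnorm: "j \<le> N \<Longrightarrow> I j f \<le> tnorm N f"
  unfolding tnorm_def by (rule member_le_sum) (auto simp: I_nonneg)

lemma tnorm_nonneg: "tnorm N f \<ge> 0"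
  unfolding tnorm_def by (intro sum_nonneg I_nonneg)

text \<open>The normalization with which \<open>\<Sum>\<^sub>k chebc f k cos (k \<theta>)\<close> reproduces \<open>f (L cos \<theta>)\<close>.\<close>

definition chebc :: "(real \<Rightarrow> complex) \<Rightarrow> nat \<Rightarrow> complex" where
  "chebc f k = (if k = 0 then of_real (1 / pi) else of_real (2 / pi)) * ccoef f k"

lemma cmod_chebc_le: "cmod (chebc f k) \<le> cmod (ccoef f k)"
proof -
  have "cmod (if k = 0 then complex_of_real (1 / pi) else of_real (2 / pi)) \<le> 1"
    using pi_ge_two by (auto simp: norm_divide)
  then show ?thesis unfolding chebc_def norm_mult by (metis mult_left_le_one_le norm_ge_zero)
qed

lemma ccoef_le_sup:
  assumes f: "smooth_real f" and M: "\<And>x. x \<in> {-L..L} \<Longrightarrow> cmod (f x) \<le> M"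
  shows "cmod (ccoef f k) \<le> pi * M"
proof -
  have "cmod (ccoef f k) \<le> integral {0..pi} (\<lambda>\<theta>. M)" unfolding ccoef_def
  proof (rule integral_norm_bound_integral)
    show "(\<lambda>\<theta>. f (L * cos \<theta>) * of_real (cos (real k * \<theta>))) integrable_on {0..pi}"
      by (intro integrable_continuous_real continuous_intros continuous_on_Lcos continuous_on_smooth f)
    fix \<theta> assume "\<theta> \<in> {0..pi}"
    have "cmod (f (L * cos \<theta>) * of_real (cos (real k * \<theta>))) \<le> M * 1"
      unfolding norm_mult using M[OF Lcos_range] order_trans[OF norm_ge_zero M[OF Lcos_range]]
      by (intro mult_mono) auto
    then show "cmod (f (L * cos \<theta>) * of_real (cos (real k * \<theta>))) \<le> M" by simp
  qed auto
  then show ?thesis by simp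
qed

text \<open>The weight \<open>(k + 1)\<^sup>n\<close>, the growth of the \<open>k\<close>-th Chebyshev polynomial of the operator on the
  \<open>n\<close>-th Sobolev space, is absorbed with \<open>n + 2\<close> derivatives.\<close>

lemma chebc_weighted:
  "\<exists>K\<ge>0. \<forall>f k. smooth_real f \<longrightarrow> cmod (chebc f k) * real (k + 1) ^ n \<le> K * tnorm (n + 2) f / (real (k + 1))\<^sup>2"
proof -
  obtain C where C: "C \<ge> 0" "\<And>f k. smooth_real f \<Longrightarrow> k \<ge> Suc (Suc n) \<Longrightarrow>
      real k ^ Suc (Suc n) * cmod (ccoef f k) \<le> C * I (Suc (Suc n)) f"
    using ccoef_decay[of "Suc n"] by metis
  \<comment> \<open>the two summands serve the indices \<open>k \<ge> n + 2\<close>, where the decay applies, and the remaining ones\<close>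
  define K where "K = 2 ^ (n + 2) * C + real (n + 2) ^ (n + 2) * (pi * (1 / (2 * L) + 1))"
  have K: "K \<ge> 0" "2 ^ (n + 2) * C \<le> K" "real (n + 2) ^ (n + 2) * (pi * (1 / (2 * L) + 1)) \<le> K"
    using C L_pos by (auto simp: K_def)
  have "cmod (chebc f k) * real (k + 1) ^ (n + 2) \<le> K * tnorm (n + 2) f" if f: "smooth_real f" for f k
  proof (cases "k \<ge> Suc (Suc n)")
    case True
    have "cmod (chebc f k) * real (k + 1) ^ (n + 2) \<le> cmod (ccoef f k) * (2 * real k) ^ (n + 2)"
      using True by (intro mult_mono power_mono cmod_chebc_le) auto
    also have "\<dots> = 2 ^ (n + 2) * (real k ^ Suc (Suc n) * cmod (ccoef f k))"
      by (simp add: power_mult_distrib)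
    also have "\<dots> \<le> 2 ^ (n + 2) * (C * I (Suc (Suc n)) f)"
      using C(2)[OF f True] by (intro mult_left_mono) auto
    also have "\<dots> = (2 ^ (n + 2) * C) * I (n + 2) f" by simp
    also have "\<dots> \<le> K * tnorm (n + 2) f"
      by (intro mult_mono K I_le_tnorm I_nonneg) auto
    finally show ?thesis .
  next
    case False
    have sup: "cmod (f x) \<le> (1 / (2 * L) + 1) * tnorm (n + 2) f" if "x \<in> {-L..L}" for x
    proof -
      have "cmod (f x) \<le> 1 / (2 * L) * I 0 f + 1 * I 1 f" using sup_bound[OF f that] by simp
      also have "\<dots> \<le> 1 / (2 * L) * tnorm (n + 2) f + 1 * tnorm (n + 2) f"
        using L_pos by (intro add_mono mult_left_mono I_le_tnorm) auto
      finally show ?thesis by (simp add: algebra_simps)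
    qed
    have "cmod (chebc f k) * real (k + 1) ^ (n + 2)
        \<le> (pi * ((1 / (2 * L) + 1) * tnorm (n + 2) f)) * real (n + 2) ^ (n + 2)"
      using False L_pos tnorm_nonneg order_trans[OF cmod_chebc_le ccoef_le_sup[OF f sup]]
      by (intro mult_mono power_mono) (auto intro!: mult_nonneg_nonneg)
    also have "\<dots> = (real (n + 2) ^ (n + 2) * (pi * (1 / (2 * L) + 1))) * tnorm (n + 2) f" by (simp only: mult_ac)
    also have "\<dots> \<le> K * tnorm (n + 2) f" by (intro mult_right_mono K tnorm_nonneg)
    finally show ?thesis .
  qed
  then have "cmod (chebc f k) * real (k + 1) ^ n \<le> K * tnorm (n + 2) f / (real (k + 1))\<^sup>2" if "smooth_real f" for f k
    using that by (simp add: power_add power2_eq_square mult_ac pos_le_divide_eq)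
  then show ?thesis using K(1) by blast
qed

lemma summable_chebc: assumes "smooth_real f" shows "summable (\<lambda>k. cmod (chebc f k))"
proof -
  obtain K where "\<And>k. cmod (chebc f k) * real (k + 1) ^ 0 \<le> K * tnorm (0 + 2) f / (real (k + 1))\<^sup>2"
    using chebc_weighted[of 0] assms by metis
  then have K: "cmod (chebc f k) \<le> K * tnorm (0 + 2) f / (real (k + 1))\<^sup>2" for k by simp
  have "summable (\<lambda>k. 1 / (real (k + 1))\<^sup>2)"
    using inverse_power_summable[of 2, where 'a = real] summable_iff_shift[of "\<lambda>n. inverse (real n ^ 2)" 1]
    by (simp add: inverse_eq_divide)
  then have "summable (\<lambda>k. K * tnorm (0 + 2) f * (1 / (real (k + 1))\<^sup>2))" by (rule summable_mult)
  then show ?thesis by (rule summable_comparison_test'[where N = 0]) (use K in auto)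
qed


subsection \<open>Chebyshev polynomials\<close>

text \<open>The Chebyshev polynomials of the first and second kind, rescaled to the interval \<open>[-L, L]\<close>.\<close>

fun chebT :: "nat \<Rightarrow> complex poly" where
  "chebT 0 = 1"
| "chebT (Suc 0) = [:0, of_real (1 / L):]"
| "chebT (Suc (Suc k)) = [:0, of_real (2 / L):] * chebT (Suc k) - chebT k"

fun chebU :: "nat \<Rightarrow> complex poly" where
  "chebU 0 = 1"
| "chebU (Suc 0) = [:0, of_real (2 / L):]"
| "chebU (Suc (Suc k)) = [:0, of_real (2 / L):] * chebU (Suc k) - chebU k"

lemma poly_chebT: "poly (chebT k) (of_real (L * cos \<theta>)) = of_real (cos (real k * \<theta>))"
proof (induction k rule: chebT.induct)
  case (3 k)
  have c: "cos (real (Suc (Suc k)) * \<theta>) = 2 * cos \<theta> * cos (real (Suc k) * \<theta>) - cos (real k * \<theta>)"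
    using cos_add[of "real (Suc k) * \<theta>" \<theta>] cos_diff[of "real (Suc k) * \<theta>" \<theta>] by (simp add: algebra_simps)
  have "poly [:0, complex_of_real (2 / L):] (of_real (L * cos \<theta>)) = of_real (2 * cos \<theta>)"
    using L_pos by simp
  then show ?case unfolding chebT.simps poly_diff poly_mult 3 c by simp
qed (use L_pos in auto)

lemma poly_chebU: "poly (chebU k) (of_real (L * cos \<theta>)) * of_real (sin \<theta>) = of_real (sin (real (k + 1) * \<theta>))"
proof (induction k rule: chebU.induct)
  case 2
  then show ?case using L_pos sin_double[of \<theta>] by simp
next
  case (3 k)
  have c: "sin (real (Suc (Suc k) + 1) * \<theta>) = 2 * cos \<theta> * sin (real (Suc k + 1) * \<theta>) - sin (real (k + 1) * \<theta>)"
    using sin_add[of "real (Suc k + 1) * \<theta>" \<theta>] sin_diff[of "real (Suc k + 1) * \<theta>" \<theta>] by (simp add: algebra_simps)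
  have p: "poly [:0, complex_of_real (2 / L):] (of_real (L * cos \<theta>)) = of_real (2 * cos \<theta>)"
    using L_pos by simp
  have "poly (chebU (Suc (Suc k))) (of_real (L * cos \<theta>)) * of_real (sin \<theta>)
      = of_real (2 * cos \<theta>) * (poly (chebU (Suc k)) (of_real (L * cos \<theta>)) * of_real (sin \<theta>))
        - poly (chebU k) (of_real (L * cos \<theta>)) * of_real (sin \<theta>)"
    unfolding chebU.simps poly_diff poly_mult p by (simp only: algebra_simps)
  then show ?case unfolding 3 c by simp
qed auto

lemma arccos_param:
  assumes "x \<in> {-L..L}" obtains \<theta> where "x = L * cos \<theta>" "\<theta> \<in> {0..pi}" "sin \<theta> = sqrt (1 - (x / L)\<^sup>2)"
proof -
  have x: "-1 \<le> x / L" "x / L \<le> 1" using assms L_pos by (auto simp: field_simps)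
  show thesis
    by (rule that[of "arccos (x / L)"]) (use x L_pos in \<open>auto simp: arccos_lbound arccos_ubound sin_arccos_abs sin_arccos\<close>)
qed

lemma chebT_bound: "x \<in> {-L..L} \<Longrightarrow> cmod (poly (chebT k) (of_real x)) \<le> 1"
  by (erule arccos_param) (simp only: poly_chebT norm_of_real abs_cos_le_one)

text \<open>On half of the interval \<open>sin \<theta>\<close> stays away from \<open>0\<close>, so that the second kind is bounded too.\<close>

lemma chebU_bound: assumes "\<bar>x\<bar> \<le> L / 2" shows "cmod (poly (chebU k) (of_real x)) \<le> 2"
proof -
  have "x \<in> {-L..L}" using assms L_pos by auto
  then obtain \<theta> where t: "x = L * cos \<theta>" "sin \<theta> = sqrt (1 - (x / L)\<^sup>2)" by (rule arccos_param)
  have "\<bar>x / L\<bar> \<le> 1 / 2" using assms L_pos by (simp add: field_simps)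
  then have "(x / L)\<^sup>2 \<le> (1 / 2)\<^sup>2" by (simp add: abs_le_square_iff[symmetric])
  then have "sqrt ((1 / 2)\<^sup>2) \<le> sin \<theta>" unfolding t(2) by (intro real_sqrt_le_mono) (simp add: power2_eq_square)
  then have s: "1 / 2 \<le> sin \<theta>" by simp
  have "cmod (poly (chebU k) (of_real x)) * sin \<theta> = cmod (poly (chebU k) (of_real x) * of_real (sin \<theta>))"
    using s by (simp add: norm_mult)
  also have "\<dots> \<le> 1" unfolding t(1) poly_chebU by simp
  finally have "cmod (poly (chebU k) (of_real x)) * sin \<theta> \<le> 1" .
  moreover have "cmod (poly (chebU k) (of_real x)) * (1 / 2) \<le> cmod (poly (chebU k) (of_real x)) * sin \<theta>"
    using s by (intro mult_left_mono) auto
  ultimately show ?thesis by linarith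
qed

subsection \<open>Convergence of the Chebyshev series\<close>

lemma integral_cos_nat: "integral {0..pi} (\<lambda>\<theta>. cos (of_int m * \<theta>)) = (if m = 0 then pi else 0)" for m :: int
proof (cases "m = 0")
  case False
  have "((\<lambda>\<theta>. cos (of_int m * \<theta>)) has_integral sin (of_int m * pi) / of_int m - sin (of_int m * 0) / of_int m) {0..pi}"
    by (rule fundamental_theorem_of_calculus)
      (use False in \<open>auto intro!: derivative_eq_intros simp: has_real_derivative_iff_has_vector_derivative[symmetric]\<close>)
  moreover have "sin (of_int m * pi) = 0" by (simp add: mult.commute)
  ultimately show ?thesis using False by (simp add: integral_unique)
qed simp

lemma cos_orthogonal:
  "integral {0..pi} (\<lambda>\<theta>. cos (real k * \<theta>) * cos (real j * \<theta>)) = (if k = j then if j = 0 then pi else pi / 2 else 0)"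
proof -
  have eq: "cos (real k * \<theta>) * cos (real j * \<theta>)
      = (1 / 2) * (cos (of_int (int k - int j) * \<theta>) + cos (of_int (int k + int j) * \<theta>))" for \<theta>
    by (simp add: cos_add cos_diff algebra_simps)
  have int: "(\<lambda>\<theta>. cos (of_int m * \<theta>)) integrable_on {0..pi}" for m :: int
    by (intro integrable_continuous_real continuous_intros)
  show ?thesis unfolding eq integral_mult_right integral_add[OF int int] integral_cos_nat by auto
qed

definition cheb_sum :: "(real \<Rightarrow> complex) \<Rightarrow> nat \<Rightarrow> complex poly" where
  "cheb_sum f n = (\<Sum>k<n. smult (chebc f k) (chebT k))"

lemma poly_cheb_sum: "poly (cheb_sum f n) z = (\<Sum>k<n. chebc f k * poly (chebT k) z)"
  by (simp add: cheb_sum_def poly_sum)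

lemma cheb_series_uniform:
  assumes f: "smooth_real f"
  shows "uniform_limit {-L..L} (\<lambda>n x. poly (cheb_sum f n) (of_real x))
      (\<lambda>x. \<Sum>k. chebc f k * poly (chebT k) (of_real x)) sequentially"
  unfolding poly_cheb_sum
proof (rule Weierstrass_m_test)
  fix k x assume "x \<in> {-L..L}"
  then show "norm (chebc f k * poly (chebT k) (of_real x)) \<le> cmod (chebc f k)"
    using chebT_bound by (simp add: norm_mult mult_left_le)
qed (rule summable_chebc[OF f])

text \<open>A continuous function all of whose cosine moments vanish is orthogonal to all polynomials,
  hence, by the Weierstrass approximation theorem, to its own conjugate.\<close>

lemma zero_if_cosine_moments_zero:
  fixes F :: "real \<Rightarrow> complex"
  assumes F: "continuous_on {-L..L} F"
    and mom: "\<And>j. integral {0..pi} (\<lambda>\<theta>. F (L * cos \<theta>) * of_real (cos (real j * \<theta>))) = 0"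
    and x: "x \<in> {-L..L}"
  shows "F x = 0"
proof -
  have int: "(\<lambda>\<theta>. F (L * cos \<theta>) * of_real (h \<theta>)) integrable_on {0..pi}" if "continuous_on {0..pi} h" for h
    by (intro integrable_continuous_real continuous_intros continuous_on_Lcos F that)
  have pow: "integral {0..pi} (\<lambda>\<theta>. F (L * cos \<theta>) * of_real (cos \<theta> ^ d * cos (real j * \<theta>))) = 0" for d j
  proof (induction d arbitrary: j)
    case 0
    then show ?case using mom by simp
  next
    case (Suc d)
    show ?case
    proof (cases j)
      case 0
      then show ?thesis using Suc[of 1] by (simp add: mult.commute)
    next
      case (Suc i)
      have "cos \<theta> ^ Suc d * cos (real j * \<theta>)
        = (1 / 2) * (cos \<theta> ^ d * cos (real i * \<theta>) + cos \<theta> ^ d * cos (real (j + 1) * \<theta>))" for \<theta>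
      proof -
        have "cos (real i * \<theta>) = cos (real j * \<theta> - \<theta>)" "cos (real (j + 1) * \<theta>) = cos (real j * \<theta> + \<theta>)"
          by (simp_all add: Suc algebra_simps)
        then show ?thesis by (simp only: cos_add cos_diff) (simp add: algebra_simps)
      qed
      then have e: "F (L * cos \<theta>) * of_real (cos \<theta> ^ Suc d * cos (real j * \<theta>))
        = of_real (1 / 2) * (F (L * cos \<theta>) * of_real (cos \<theta> ^ d * cos (real i * \<theta>))
            + F (L * cos \<theta>) * of_real (cos \<theta> ^ d * cos (real (j + 1) * \<theta>)))" for \<theta>
        by (simp only: of_real_mult of_real_add) (simp add: algebra_simps)
      show ?thesis
        unfolding e integral_mult_right
        by (subst integral_add) (intro int continuous_intros, intro int continuous_intros, simp only: Suc.IH, simp)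
    qed
  qed
  have monom: "integral {0..pi} (\<lambda>\<theta>. F (L * cos \<theta>) * poly (monom c d) (of_real (L * cos \<theta>))) = 0" for c d
  proof -
    have "F (L * cos \<theta>) * poly (monom c d) (of_real (L * cos \<theta>))
      = (c * of_real (L ^ d)) * (F (L * cos \<theta>) * of_real (cos \<theta> ^ d * cos (real 0 * \<theta>)))" for \<theta>
      by (simp add: poly_monom power_mult_distrib algebra_simps)
    then show ?thesis by (simp only: integral_mult_right pow) simp
  qed
  have intp: "(\<lambda>\<theta>. F (L * cos \<theta>) * poly p (of_real (L * cos \<theta>))) integrable_on {0..pi}" for p
    by (intro integrable_continuous_real continuous_intros continuous_on_Lcos F)
  have poly: "integral {0..pi} (\<lambda>\<theta>. F (L * cos \<theta>) * poly p (of_real (L * cos \<theta>))) = 0" for p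
  proof -
    have "F (L * cos \<theta>) * poly p (of_real (L * cos \<theta>))
        = (\<Sum>i\<le>degree p. F (L * cos \<theta>) * poly (monom (coeff p i) i) (of_real (L * cos \<theta>)))" for \<theta>
      by (simp add: poly_altdef[of p] poly_monom sum_distrib_left)
    then show ?thesis by (simp only: integral_sum[OF finite_atMost intp] monom) simp
  qed
  obtain B where B: "B > 0" "\<And>x. x \<in> {-L..L} \<Longrightarrow> cmod (F x) \<le> B"
    using compact_imp_bounded[OF compact_continuous_image[OF F compact_Icc]] unfolding bounded_pos by auto
  have csq: "continuous_on {0..pi} (\<lambda>\<theta>. (cmod (F (L * cos \<theta>)))\<^sup>2)"
    by (intro continuous_intros continuous_on_Lcos[of F] F)
  have "integral {0..pi} (\<lambda>\<theta>. (cmod (F (L * cos \<theta>)))\<^sup>2) \<le> e" if e: "e > 0" for e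
  proof -
    obtain q where q: "polys_tend_to {-L..L} q (\<lambda>t. cnj (F t))"
      using complex_poly_approx[of "-L" L "\<lambda>t. cnj (F t)"] F by (auto intro!: continuous_intros)
    have "e / (pi * B) > 0" using e B by simp
    from uniform_limitD[OF q this] obtain n where
      n: "\<And>t. t \<in> {-L..L} \<Longrightarrow> dist (poly (q n) (complex_of_real t)) (cnj (F t)) < e / (pi * B)"
      unfolding eventually_sequentially by blast
    let ?G = "\<lambda>\<theta>. F (L * cos \<theta>) * (cnj (F (L * cos \<theta>)) - poly (q n) (of_real (L * cos \<theta>)))"
    have cG: "(\<lambda>\<theta>. F (L * cos \<theta>) * cnj (F (L * cos \<theta>))) integrable_on {0..pi}"
      by (intro integrable_continuous_real continuous_intros continuous_on_Lcos F)
    have "complex_of_real (integral {0..pi} (\<lambda>\<theta>. (cmod (F (L * cos \<theta>)))\<^sup>2))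
        = integral {0..pi} (\<lambda>\<theta>. complex_of_real ((cmod (F (L * cos \<theta>)))\<^sup>2))"
      using has_integral_of_real[OF integrable_integral[OF integrable_continuous_real[OF csq]]]
      by (metis integral_unique)
    also have "\<dots> = integral {0..pi} (\<lambda>\<theta>. F (L * cos \<theta>) * cnj (F (L * cos \<theta>)))"
      by (simp only: complex_norm_square)
    also have "\<dots> = integral {0..pi} ?G"
      by (simp only: right_diff_distrib integral_diff[OF cG intp] poly) simp
    finally have eq: "complex_of_real (integral {0..pi} (\<lambda>\<theta>. (cmod (F (L * cos \<theta>)))\<^sup>2)) = integral {0..pi} ?G" .
    have "cmod (integral {0..pi} ?G) \<le> integral {0..pi} (\<lambda>\<theta>. e / pi)"
    proof (rule integral_norm_bound_integral)
      show "?G integrable_on {0..pi}"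
        by (intro integrable_continuous_real continuous_intros continuous_on_Lcos F)
      fix \<theta>
      have "cmod (?G \<theta>) \<le> B * (e / (pi * B))"
        unfolding norm_mult using B(2)[OF Lcos_range] n[OF Lcos_range] B(1) e
        by (intro mult_mono) (auto simp: dist_norm norm_minus_commute less_imp_le)
      then show "cmod (?G \<theta>) \<le> e / pi" using B(1) by simp
    qed auto
    also have "\<dots> = e" by simp
    finally have "\<bar>integral {0..pi} (\<lambda>\<theta>. (cmod (F (L * cos \<theta>)))\<^sup>2)\<bar> \<le> e" unfolding eq[symmetric] by simp
    then show ?thesis by simp
  qed
  then have "integral {0..pi} (\<lambda>\<theta>. (cmod (F (L * cos \<theta>)))\<^sup>2) \<le> 0" by (rule field_le_epsilon[where y = 0, simplified])
  moreover have "integral {0..pi} (\<lambda>\<theta>. (cmod (F (L * cos \<theta>)))\<^sup>2) \<ge> 0"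
    by (intro integral_nonneg integrable_continuous_real csq) auto
  ultimately have "\<forall>\<theta>\<in>{0..pi}. (cmod (F (L * cos \<theta>)))\<^sup>2 = 0"
    using integral_eq_0_iff[OF csq pi_gt_zero] by auto
  moreover obtain \<theta> where "x = L * cos \<theta>" "\<theta> \<in> {0..pi}" using x by (rule arccos_param)
  ultimately show ?thesis by auto
qed

text \<open>The series converges uniformly to some continuous function, and this has the same cosine
  moments as \<open>f\<close>.\<close>

lemma cheb_series_converges:
  assumes f: "smooth_real f"
  shows "polys_tend_to {-L..L} (cheb_sum f) f"
proof -
  define S where "S = (\<lambda>x. \<Sum>k. chebc f k * poly (chebT k) (complex_of_real x))"
  have unif: "polys_tend_to {-L..L} (cheb_sum f) S"
    using cheb_series_uniform[OF f] by (simp only: S_def)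
  have cS: "continuous_on {-L..L} S"
    by (rule uniform_limit_theorem[OF _ unif]) (auto intro!: always_eventually continuous_intros)
  have momS: "integral {0..pi} (\<lambda>\<theta>. S (L * cos \<theta>) * of_real (cos (real j * \<theta>))) = ccoef f j" for j
  proof -
    have u: "uniform_limit {0..pi} (\<lambda>n \<theta>. poly (cheb_sum f n) (of_real (L * cos \<theta>)) * of_real (cos (real j * \<theta>)))
        (\<lambda>\<theta>. S (L * cos \<theta>) * of_real (cos (real j * \<theta>))) sequentially"
    proof (rule uniform_limitI)
      fix e :: real assume "e > 0"
      from uniform_limitD[OF unif this]
      show "\<forall>\<^sub>F n in sequentially. \<forall>\<theta>\<in>{0..pi}. dist (poly (cheb_sum f n) (of_real (L * cos \<theta>)) * of_real (cos (real j * \<theta>)))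
          (S (L * cos \<theta>) * of_real (cos (real j * \<theta>))) < e"
      proof eventually_elim
        case (elim n)
        show ?case
        proof
          fix \<theta>
          have "dist (poly (cheb_sum f n) (of_real (L * cos \<theta>)) * of_real (cos (real j * \<theta>))) (S (L * cos \<theta>) * of_real (cos (real j * \<theta>)))
              = dist (poly (cheb_sum f n) (of_real (L * cos \<theta>))) (S (L * cos \<theta>)) * \<bar>cos (real j * \<theta>)\<bar>"
            by (simp only: dist_norm left_diff_distrib[symmetric] norm_mult norm_of_real)
          also have "\<dots> \<le> dist (poly (cheb_sum f n) (of_real (L * cos \<theta>))) (S (L * cos \<theta>))"
            by (intro mult_left_le) auto
          also have "\<dots> < e" using elim Lcos_range by blast
          finally show "dist (poly (cheb_sum f n) (of_real (L * cos \<theta>)) * of_real (cos (real j * \<theta>))) (S (L * cos \<theta>) * of_real (cos (real j * \<theta>))) < e" .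
        qed
      qed
    qed
    have partial: "integral {0..pi} (\<lambda>\<theta>. poly (cheb_sum f n) (of_real (L * cos \<theta>)) * of_real (cos (real j * \<theta>))) = ccoef f j"
      if n: "n > j" for n
    proof -
      have e: "poly (cheb_sum f n) (of_real (L * cos \<theta>)) * of_real (cos (real j * \<theta>))
          = (\<Sum>k<n. chebc f k * of_real (cos (real k * \<theta>) * cos (real j * \<theta>)))" for \<theta>
        unfolding poly_cheb_sum poly_chebT by (simp only: sum_distrib_right of_real_mult mult.assoc)
      have i: "(\<lambda>\<theta>. chebc f k * complex_of_real (cos (real k * \<theta>) * cos (real j * \<theta>))) integrable_on {0..pi}" for k
        by (intro integrable_continuous_real continuous_intros)
      have o: "integral {0..pi} (\<lambda>\<theta>. chebc f k * complex_of_real (cos (real k * \<theta>) * cos (real j * \<theta>)))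
          = (if k = j then ccoef f j else 0)" for k
      proof -
        have "(\<lambda>\<theta>. cos (real k * \<theta>) * cos (real j * \<theta>)) integrable_on {0..pi}"
          by (intro integrable_continuous_real continuous_intros)
        from has_integral_of_real[OF integrable_integral[OF this]]
        have "integral {0..pi} (\<lambda>\<theta>. complex_of_real (cos (real k * \<theta>) * cos (real j * \<theta>)))
            = of_real (if k = j then if j = 0 then pi else pi / 2 else 0)"
          unfolding cos_orthogonal by (rule integral_unique)
        then show ?thesis by (simp only: integral_mult_right) (auto simp: chebc_def)
      qed
      show ?thesis unfolding e integral_sum[OF finite_lessThan i] o using n by simp
    qed
    obtain Is J where IJ: "\<And>n. ((\<lambda>\<theta>. poly (cheb_sum f n) (of_real (L * cos \<theta>)) * of_real (cos (real j * \<theta>))) has_integral Is n) {0..pi}"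
      "((\<lambda>\<theta>. S (L * cos \<theta>) * of_real (cos (real j * \<theta>))) has_integral J) {0..pi}" "Is \<longlonglongrightarrow> J"
      by (rule uniform_limit_integral[OF u]) (auto intro!: continuous_intros)
    have "\<forall>\<^sub>F n in sequentially. Is n = ccoef f j"
      using eventually_gt_at_top[of j]
    proof eventually_elim
      case (elim n)
      then show ?case using integral_unique[OF IJ(1)[of n]] partial[of n] by simp
    qed
    then have "Is \<longlonglongrightarrow> ccoef f j" by (rule tendsto_eventually)
    then show ?thesis using IJ(2,3) LIMSEQ_unique integral_unique by blast
  qed
  have "f x - S x = 0" if "x \<in> {-L..L}" for x
  proof (rule zero_if_cosine_moments_zero[OF _ _ that])
    show "continuous_on {-L..L} (\<lambda>x. f x - S x)" by (intro continuous_intros continuous_on_smooth f cS)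
    fix j
    have "(\<lambda>\<theta>. f (L * cos \<theta>) * complex_of_real (cos (real j * \<theta>))) integrable_on {0..pi}"
      "(\<lambda>\<theta>. S (L * cos \<theta>) * complex_of_real (cos (real j * \<theta>))) integrable_on {0..pi}"
      by (intro integrable_continuous_real continuous_intros continuous_on_Lcos continuous_on_smooth f cS)+
    then show "integral {0..pi} (\<lambda>\<theta>. (f (L * cos \<theta>) - S (L * cos \<theta>)) * complex_of_real (cos (real j * \<theta>))) = 0"
      by (simp only: left_diff_distrib integral_diff momS) (simp add: ccoef_def)
  qed
  then have "S x = f x" if "x \<in> {-L..L}" for x using that by simp
  then show ?thesis using unif by (subst uniform_limit_cong'[where g = "\<lambda>n x. poly (cheb_sum f n) (of_real x)" and i = S]) auto
qed

end


section \<open>The functional calculus on integer Sobolev spaces\<close>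

context sobolev_scale
begin

lemma bounded_clinear_P_nonpos: assumes "s \<ge> 0" shows "bounded_clinear (P (- s))"
proof (cases "s = 0")
  case True
  then have "P (- s) = (\<lambda>x. x)" by auto
  then show ?thesis by (simp only: bounded_clinear_id)
next
  case False
  then have "P (- s) = powR s" using assms by (intro ext P_neg) simp
  then show ?thesis using powR_bcl[of s] False assms by simp
qed

lemma P_P_nonpos: "s \<ge> 0 \<Longrightarrow> P s (P (- s) y) = y"
  by (cases "s = 0") (simp_all add: P_neg P_powR_same)

lemma norm_P_mono_step:
  assumes "x \<in> Hinf" shows "norm (P a x) \<le> specbound * norm (P (a + 1) x)"
proof -
  have "P a x = P (- 1) (P (a + 1) x)" using assms by (simp add: P_P)
  also have "\<dots> = R (P (a + 1) x)" by (simp add: P_neg powR_1)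
  finally show ?thesis using specbound(2) by simp
qed

end

locale order_zero_op = sobolev_scale \<Theta> for \<Theta> :: "'h::complex_hilbert \<rightharpoonup> 'h" +
  fixes T :: "'h \<Rightarrow> 'h"
  assumes T_selfadjoint: "bounded_selfadjoint T"
    and T_Hinf: "x \<in> Hinf \<Longrightarrow> T x \<in> Hinf"
    and commutator_bound: "\<exists>C\<ge>0. \<forall>x\<in>Hinf. norm (P s (P 1 (T x) - T (P 1 x))) \<le> C * norm (P s x)"
begin

sublocale T: selfadjoint_op T by standard (rule T_selfadjoint)

text \<open>\<open>[\<Theta>\<^bsup>n+2\<^esup>, T] = \<Theta>\<^bsup>n+1\<^esup> [\<Theta>, T] + [\<Theta>\<^bsup>n+1\<^esup>, T] \<Theta>\<close>.\<close>

lemma commutator_power_bound: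
  "\<exists>K\<ge>0. \<forall>x\<in>Hinf. norm (P (real (Suc n)) (T x) - T (P (real (Suc n)) x)) \<le> K * norm (P (real n) x)"
proof (induction n)
  case 0
  then show ?case using commutator_bound[of 0] by simp
next
  case (Suc n)
  then obtain K where K: "K \<ge> 0" "\<And>x. x \<in> Hinf \<Longrightarrow>
      norm (P (real (Suc n)) (T x) - T (P (real (Suc n)) x)) \<le> K * norm (P (real n) x)" by blast
  obtain C where C: "C \<ge> 0" "\<And>x. x \<in> Hinf \<Longrightarrow>
      norm (P (real (Suc n)) (P 1 (T x) - T (P 1 x))) \<le> C * norm (P (real (Suc n)) x)"
    using commutator_bound[of "real (Suc n)"] by blast
  have "norm (P (real (Suc (Suc n))) (T x) - T (P (real (Suc (Suc n))) x)) \<le> (C + K) * norm (P (real (Suc n)) x)"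
    if x: "x \<in> Hinf" for x
  proof -
    have s: "real (Suc (Suc n)) = real (Suc n) + 1" "real (Suc n) = real n + 1" by simp_all
    have a: "P (real (Suc (Suc n))) z = P (real (Suc n)) (P 1 z)" if "z \<in> Hinf" for z
      using that by (simp add: P_P s(1))
    have b: "P (real n) (P 1 x) = P (real (Suc n)) x" using x by (simp add: P_P add.commute)
    have "P (real (Suc (Suc n))) (T x) - T (P (real (Suc (Suc n))) x)
      = P (real (Suc n)) (P 1 (T x) - T (P 1 x))
        + (P (real (Suc n)) (T (P 1 x)) - T (P (real (Suc n)) (P 1 x)))"
      using x by (simp only: a T_Hinf P_Hinf P_linear_Hinf(2)) simp
    then have "norm (P (real (Suc (Suc n))) (T x) - T (P (real (Suc (Suc n))) x))
      \<le> norm (P (real (Suc n)) (P 1 (T x) - T (P 1 x)))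
        + norm (P (real (Suc n)) (T (P 1 x)) - T (P (real (Suc n)) (P 1 x)))"
      by (simp only: norm_triangle_ineq)
    also have "\<dots> \<le> C * norm (P (real (Suc n)) x) + K * norm (P (real n) (P 1 x))"
      using x by (intro add_mono C K P_Hinf)
    finally show ?thesis unfolding b by (simp add: distrib_right)
  qed
  then show ?case using K(1) C(1) by (intro exI[of _ "C + K"]) auto
qed

lemma poly_op_Hinf: "x \<in> Hinf \<Longrightarrow> poly_op p T x \<in> Hinf"
  by (induction p) (auto simp: poly_op_pCons[OF T.bcl] intro: Hinf_add Hinf_scale T_Hinf)

text \<open>The factor \<open>2\<close> puts the spectrum of \<open>T\<close> into the inner half of \<open>[-L, L]\<close>, where the Chebyshev
  polynomials of the second kind are bounded uniformly in the degree.\<close>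

definition L :: real where
  "L = 2 * (SOME K. K > 0 \<and> (\<forall>x. norm (T x) \<le> K * norm x))"

lemma L: "L > 0" "norm (T x) \<le> L / 2 * norm x"
  using someI_ex[OF bounded_clinear_bound[OF T.bcl]] unfolding L_def by auto

sublocale chebyshev L by standard (rule L)

lemma real_spectrum_T: "t \<in> real_spectrum T \<Longrightarrow> \<bar>t\<bar> \<le> L / 2"
  using op_spectrum_bound[OF T.bcl L(2), of "of_real t"] L(1) by (simp add: real_spectrum_def)

lemma real_spectrum_T_subset: "real_spectrum T \<subseteq> {-L..L}"
  using real_spectrum_T L(1) by fastforce

declare chebT.simps [simp del] chebU.simps [simp del]

abbreviation tT :: "nat \<Rightarrow> 'h \<Rightarrow> 'h" where "tT k \<equiv> poly_op (chebT k) T"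
abbreviation uT :: "nat \<Rightarrow> 'h \<Rightarrow> 'h" where "uT k \<equiv> poly_op (chebU k) T"

lemma norm_tT: "norm (tT k x) \<le> norm x"
proof -
  have "norm (tT k x) \<le> 1 * norm x"
    by (rule poly_op_norm_le[OF T_selfadjoint]) (simp, intro chebT_bound subsetD[OF real_spectrum_T_subset])
  then show ?thesis by simp
qed

lemma norm_uT: "norm (uT k x) \<le> 2 * norm x"
  by (rule poly_op_norm_le[OF T_selfadjoint]) (use chebU_bound real_spectrum_T in auto)

lemma poly_op_linear_factor: "poly_op ([:0, c:] * p) T x = c *\<^sub>C T (poly_op p T x)"
  by (simp only: poly_op_mult[OF T.bcl] poly_op_X[OF T.bcl]) simp

lemma tT_simps:
  "tT 0 x = x" "tT (Suc 0) x = of_real (1 / L) *\<^sub>C T x"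
  "tT (Suc (Suc k)) x = of_real (2 / L) *\<^sub>C T (tT (Suc k) x) - tT k x"
  by (simp_all only: chebT.simps poly_op_diff poly_op_linear_factor poly_op_1 poly_op_X[OF T.bcl]) simp

lemma uT_simps:
  "uT 0 x = x" "uT (Suc 0) x = of_real (2 / L) *\<^sub>C T x"
  "uT (Suc (Suc k)) x = of_real (2 / L) *\<^sub>C T (uT (Suc k) x) - uT k x"
  by (simp_all only: chebU.simps poly_op_diff poly_op_linear_factor poly_op_1 poly_op_X[OF T.bcl]) simp

text \<open>Variation of constants for the three-term recursion: the solutions with initial values
  \<open>0, 1\<close> of the homogeneous equation are the polynomials of the second kind.\<close>

lemma cheb_duhamel:
  assumes W: "W 0 = w" "W (Suc 0) = of_real (1 / L) *\<^sub>C T w + e 0"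
    "\<And>k. W (Suc (Suc k)) = of_real (2 / L) *\<^sub>C T (W (Suc k)) - W k + e (Suc k)"
  shows "W k = tT k w + (\<Sum>j<k. uT (k - 1 - j) (e j))"
proof (induction k rule: induct_nat_012)
  case 0
  then show ?case by (simp add: W tT_simps)
next
  case 1
  then show ?case by (simp add: W tT_simps uT_simps)
next
  case (ge2 k)
  let ?c = "complex_of_real (2 / L)"
  have "W (Suc (Suc k)) = ?c *\<^sub>C T (tT (Suc k) w + (\<Sum>j<Suc k. uT (Suc k - 1 - j) (e j)))
      - (tT k w + (\<Sum>j<k. uT (k - 1 - j) (e j))) + e (Suc k)"
    unfolding W(3) using ge2 by simp
  also have "\<dots> = tT (Suc (Suc k)) w + ((\<Sum>j<k. ?c *\<^sub>C T (uT (k - j) (e j)) - uT (k - 1 - j) (e j))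
      + ?c *\<^sub>C T (uT 0 (e k)) + e (Suc k))"
    by (simp only: tT_simps bounded_clinear_add[OF T.bcl] bounded_clinear_sum[OF T.bcl] scaleC_add_right
        scaleC_sum sum_subtractf) (simp add: scaleC_add_right)
  also have "(\<Sum>j<k. ?c *\<^sub>C T (uT (k - j) (e j)) - uT (k - 1 - j) (e j)) = (\<Sum>j<k. uT (Suc k - j) (e j))"
  proof (rule sum.cong)
    fix j assume "j \<in> {..<k}"
    then obtain i where "k = Suc (j + i)" by (auto dest: less_imp_Suc_add)
    then have "k - j = Suc i" "Suc k - j = Suc (Suc i)" "k - 1 - j = i" by simp_all
    then show "?c *\<^sub>C T (uT (k - j) (e j)) - uT (k - 1 - j) (e j) = uT (Suc k - j) (e j)"
      by (simp only: uT_simps)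
  qed simp
  also have "?c *\<^sub>C T (uT 0 (e k)) = uT (Suc 0) (e k)" by (simp only: uT_simps)
  finally show ?case by (simp add: uT_simps(1) Suc_diff_le)
qed

text \<open>Applying \<open>\<Theta>\<^sup>n\<close> to the recursion for the Chebyshev polynomials of \<open>T\<close> produces an
  inhomogeneity \<open>[\<Theta>\<^sup>n, T]\<close> of order \<open>n - 1\<close>; hence each Sobolev index costs one power of
  the degree.\<close>

lemma tT_growth:
  "\<exists>C\<ge>0. \<forall>k. \<forall>x\<in>Hinf. norm (P (real n) (tT k x)) \<le> C * real (k + 1) ^ n * norm (P (real n) x)"
proof (induction n)
  case 0
  then show ?case using norm_tT by (intro exI[of _ 1]) simp
next
  case (Suc n)
  then obtain C where C: "C \<ge> 0" "\<And>k x. x \<in> Hinf \<Longrightarrow>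
      norm (P (real n) (tT k x)) \<le> C * real (k + 1) ^ n * norm (P (real n) x)" by blast
  obtain K where K: "K \<ge> 0" "\<And>x. x \<in> Hinf \<Longrightarrow>
      norm (P (real (Suc n)) (T x) - T (P (real (Suc n)) x)) \<le> K * norm (P (real n) x)"
    using commutator_power_bound by blast
  define D where "D = 4 / L * K * C * specbound"
  have D: "D \<ge> 0" using L C K specbound(1) by (simp add: D_def)
  have "norm (P (real (Suc n)) (tT k x)) \<le> (1 + D) * real (k + 1) ^ Suc n * norm (P (real (Suc n)) x)"
    if x: "x \<in> Hinf" for k x
  proof -
    let ?P = "P (real (Suc n))"
    define W where "W k = ?P (tT k x)" for k
    \<comment> \<open>the recursion starts with \<open>T\<^sub>1 = x / L\<close>, half the factor of the later steps\<close>
    define e where "e k = of_real (if k = 0 then 1 / L else 2 / L) *\<^sub>C (?P (T (tT k x)) - T (?P (tT k x)))" for k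
    have tH: "tT k x \<in> Hinf" for k by (rule poly_op_Hinf[OF x])
    have scT: "c *\<^sub>C T (tT k x) \<in> Hinf" for c k by (intro Hinf_scale T_Hinf tH)
    have sc: "?P (c *\<^sub>C T (tT k x)) = c *\<^sub>C ?P (T (tT k x))" for c k
      using P_linear_Hinf(3)[OF T_Hinf[OF tH] T_Hinf[OF tH]] .
    have W: "W k = tT k (?P x) + (\<Sum>j<k. uT (k - 1 - j) (e j))"
    proof (rule cheb_duhamel)
      show "W 0 = ?P x" by (simp add: W_def tT_simps)
      have "W (Suc 0) = ?P (of_real (1 / L) *\<^sub>C T (tT 0 x))" by (simp only: W_def tT_simps)
      then show "W (Suc 0) = of_real (1 / L) *\<^sub>C T (?P x) + e 0"
        unfolding sc by (simp add: e_def tT_simps(1) scaleC_diff_right)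
      show "W (Suc (Suc k)) = of_real (2 / L) *\<^sub>C T (W (Suc k)) - W k + e (Suc k)" for k
      proof -
        have "W (Suc (Suc k)) = ?P (of_real (2 / L) *\<^sub>C T (tT (Suc k) x)) - ?P (tT k x)"
          unfolding W_def tT_simps(3) by (rule P_linear_Hinf(2)[OF scT tH])
        also have "?P (of_real (2 / L) *\<^sub>C T (tT (Suc k) x)) = of_real (2 / L) *\<^sub>C ?P (T (tT (Suc k) x))" by (rule sc)
        finally show ?thesis by (simp add: e_def W_def scaleC_diff_right)
      qed
    qed
    have e: "2 * norm (e j) \<le> D * real k ^ n * norm (?P x)" if j: "j < k" for j
    proof -
      have "norm (e j) \<le> 2 / L * norm (?P (T (tT j x)) - T (?P (tT j x)))"
        unfolding e_def norm_scaleC using L(1) by (intro mult_right_mono) (auto simp: field_simps)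
      also have "\<dots> \<le> 2 / L * (K * norm (P (real n) (tT j x)))"
        using L(1) by (intro mult_left_mono K tH) auto
      also have "\<dots> \<le> 2 / L * (K * (C * real k ^ n * (specbound * norm (?P x))))"
      proof (intro mult_left_mono)
        have "norm (P (real n) (tT j x)) \<le> C * real (j + 1) ^ n * norm (P (real n) x)" by (rule C(2)[OF x])
        also have "\<dots> \<le> C * real k ^ n * (specbound * norm (?P x))"
          using j C(1) norm_P_mono_step[OF x, of "real n"]
          by (intro mult_mono power_mono mult_nonneg_nonneg) (auto simp: add.commute)
        finally show "norm (P (real n) (tT j x)) \<le> C * real k ^ n * (specbound * norm (?P x))" .
      qed (use L(1) K(1) in auto)
      finally have "2 * norm (e j) \<le> 2 * (2 / L * (K * (C * real k ^ n * (specbound * norm (?P x)))))" by linarith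
      also have "\<dots> = D * real k ^ n * norm (?P x)" by (simp add: D_def)
      finally show ?thesis .
    qed
    have "norm (W k) \<le> norm (tT k (?P x)) + (\<Sum>j<k. norm (uT (k - 1 - j) (e j)))"
      unfolding W by (intro order_trans[OF norm_triangle_ineq] add_left_mono norm_sum)
    also have "\<dots> \<le> norm (?P x) + (\<Sum>j<k. D * real k ^ n * norm (?P x))"
      by (intro add_mono norm_tT sum_mono order_trans[OF norm_uT]) (use e in auto)
    also have "\<dots> = (1 + D * real k ^ Suc n) * norm (?P x)" by (simp add: algebra_simps)
    also have "\<dots> \<le> ((1 + D) * real (k + 1) ^ Suc n) * norm (?P x)"
    proof (intro mult_right_mono)
      have "(1::real) \<le> real (k + 1) ^ Suc n" by (rule one_le_power) simp
      moreover have "D * real k ^ Suc n \<le> D * real (k + 1) ^ Suc n"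
        using D by (intro mult_left_mono power_mono) auto
      ultimately show "1 + D * real k ^ Suc n \<le> (1 + D) * real (k + 1) ^ Suc n" by (simp only: distrib_right mult_1)
    qed auto
    finally show ?thesis by (simp only: W_def)
  qed
  then show ?case using D by (intro exI[of _ "1 + D"]) auto
qed

lemma poly_approximable_smooth: "smooth_real f \<Longrightarrow> poly_approximable (real_spectrum T) f"
  unfolding poly_approximable_def
  using uniform_limit_on_subset[OF cheb_series_converges real_spectrum_T_subset] by blast

text \<open>The series \<open>y = \<Sum>\<^sub>k c\<^sub>k \<Theta>\<^sup>n T\<^sub>k(T / L) x\<close> converges absolutely, and applying the bounded operator
  \<open>\<Theta>\<^sup>-\<^sup>n\<close> to its partial sums identifies \<open>f(T) x\<close> with \<open>\<Theta>\<^sup>-\<^sup>n y\<close>.\<close>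

lemma cfc_smooth_integer_bound:
  "\<exists>M\<ge>0. \<forall>f x. smooth_real f \<longrightarrow> x \<in> Hinf \<longrightarrow>
     cfc T f x \<in> range (P (- real n)) \<and> norm (P (real n) (cfc T f x)) \<le> M * tnorm (n + 2) f * norm (P (real n) x)"
proof -
  obtain C where C: "C \<ge> 0" "\<And>k x. x \<in> Hinf \<Longrightarrow>
      norm (P (real n) (tT k x)) \<le> C * real (k + 1) ^ n * norm (P (real n) x)" using tT_growth by blast
  obtain K where K: "K \<ge> 0" "\<And>f k. smooth_real f \<Longrightarrow>
      cmod (chebc f k) * real (k + 1) ^ n \<le> K * tnorm (n + 2) f / (real (k + 1))\<^sup>2"
    using chebc_weighted by metis
  have sm: "summable (\<lambda>k. 1 / (real (k + 1))\<^sup>2)"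
    using inverse_power_summable[of 2, where 'a = real] summable_iff_shift[of "\<lambda>n. inverse (real n ^ 2)" 1]
    by (simp add: inverse_eq_divide)
  define M where "M = C * K * (\<Sum>k. 1 / (real (k + 1))\<^sup>2)"
  have M: "M \<ge> 0" unfolding M_def using C K by (intro mult_nonneg_nonneg suminf_nonneg sm) auto
  have "cfc T f x \<in> range (P (- real n)) \<and> norm (P (real n) (cfc T f x)) \<le> M * tnorm (n + 2) f * norm (P (real n) x)"
    if f: "smooth_real f" and x: "x \<in> Hinf" for f x
  proof -
    define v where "v k = chebc f k *\<^sub>C P (real n) (tT k x)" for k
    define B where "B = C * K * tnorm (n + 2) f * norm (P (real n) x)"
    have tH: "tT k x \<in> Hinf" for k by (rule poly_op_Hinf[OF x])
    have vb: "norm (v k) \<le> B * (1 / (real (k + 1))\<^sup>2)" for k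
    proof -
      have "norm (v k) \<le> cmod (chebc f k) * (C * real (k + 1) ^ n * norm (P (real n) x))"
        unfolding v_def norm_scaleC by (intro mult_left_mono C x) auto
      also have "\<dots> = (cmod (chebc f k) * real (k + 1) ^ n) * (C * norm (P (real n) x))" by (simp only: mult_ac)
      also have "\<dots> \<le> (K * tnorm (n + 2) f / (real (k + 1))\<^sup>2) * (C * norm (P (real n) x))"
        using C(1) by (intro mult_right_mono K f) auto
      finally show ?thesis by (simp add: B_def mult_ac)
    qed
    have smB: "summable (\<lambda>k. B * (1 / (real (k + 1))\<^sup>2))" by (rule summable_mult[OF sm])
    have sn: "summable (\<lambda>k. norm (v k))"
      by (rule summable_comparison_test'[OF smB, where N = 0]) (use vb in auto)
    define y where "y = suminf v"
    have y: "(\<lambda>N. \<Sum>k<N. v k) \<longlonglongrightarrow> y" unfolding y_def by (rule summable_LIMSEQ[OF summable_norm_cancel[OF sn]])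
    have "norm y \<le> (\<Sum>k. norm (v k))" unfolding y_def by (rule summable_norm[OF sn])
    also have "\<dots> \<le> (\<Sum>k. B * (1 / (real (k + 1))\<^sup>2))" by (rule suminf_le[OF vb sn smB])
    also have "\<dots> = B * (\<Sum>k. 1 / (real (k + 1))\<^sup>2)" by (rule suminf_mult[OF sm])
    finally have yb: "norm y \<le> M * tnorm (n + 2) f * norm (P (real n) x)" by (simp add: M_def B_def mult_ac)
    have Pb: "bounded_clinear (P (- real n))" by (rule bounded_clinear_P_nonpos) simp
    have "P (- real n) (\<Sum>k<N. v k) = poly_op (cheb_sum f N) T x" for N
    proof -
      have "P (- real n) (v k) = chebc f k *\<^sub>C tT k x" for k
        unfolding v_def bounded_clinear_scaleC[OF Pb] using tH by simp
      then show ?thesis by (simp add: bounded_clinear_sum[OF Pb] cheb_sum_def poly_op_sum poly_op_smult)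
    qed
    then have "(\<lambda>N. poly_op (cheb_sum f N) T x) \<longlonglongrightarrow> P (- real n) y"
      using bounded_clinear_tendsto[OF Pb y] by simp
    moreover have "(\<lambda>N. poly_op (cheb_sum f N) T x) \<longlonglongrightarrow> cfc T f x"
      by (intro T.cfc_limit poly_approximable_smooth f uniform_limit_on_subset[OF cheb_series_converges real_spectrum_T_subset])
    ultimately have eq: "cfc T f x = P (- real n) y" using LIMSEQ_unique by blast
    then show ?thesis using yb by (simp add: P_P_nonpos)
  qed
  then show ?thesis using M by blast
qed

lemma cfc_smooth_Hinf:
  assumes "smooth_real f" "x \<in> Hinf" shows "cfc T f x \<in> Hinf"
proof (rule Hinf_of_nat)
  fix n
  have "cfc T f x \<in> range (P (- real (Suc n)))" using cfc_smooth_integer_bound[of "Suc n"] assms by blast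
  then obtain y where "cfc T f x = P (- real (Suc n)) y" by blast
  also have "\<dots> = powR (real (Suc n)) y" by (rule P_neg) simp
  finally show "cfc T f x \<in> range (powR (real (Suc n)))" by blast
qed

end


section \<open>Duality and interpolation\<close>

context sobolev_scale
begin

text \<open>Stated for smooth vectors only, where all powers of \<open>\<Theta>\<close> are defined; by density it bounds the
  extension of \<open>F\<close> to the completion.\<close>

definition sob_bd :: "('h \<Rightarrow> 'h) \<Rightarrow> real \<Rightarrow> real \<Rightarrow> bool" where
  "sob_bd F s M \<longleftrightarrow> (\<forall>x\<in>Hinf. norm (P s (F x)) \<le> M * norm (P s x))"

lemma le_if_mult_self_le: "a * a \<le> b * a \<Longrightarrow> 0 \<le> a \<Longrightarrow> 0 \<le> b \<Longrightarrow> a \<le> (b::real)"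
  by (cases "a = 0") (auto simp: mult_le_cancel_right)

lemma sob_bd_dual:
  assumes F: "\<And>x. x \<in> Hinf \<Longrightarrow> F x \<in> Hinf" and F': "\<And>x. x \<in> Hinf \<Longrightarrow> F' x \<in> Hinf"
    and adj: "\<And>x y. x \<in> Hinf \<Longrightarrow> y \<in> Hinf \<Longrightarrow> cinner (F' x) y = cinner x (F y)"
    and bd: "sob_bd F s M"
  shows "sob_bd F' (- s) M"
  unfolding sob_bd_def
proof
  fix x assume x: "x \<in> Hinf"
  define w where "w = P (- (2 * s)) (F' x)"
  have w: "w \<in> Hinf" unfolding w_def by (intro P_Hinf F' x)
  have Pw: "P s w = P (- s) (F' x)" unfolding w_def using F'[OF x] by (simp add: P_P)
  have "norm (P (- s) (F' x)) * norm (P (- s) (F' x)) = Re (cinner (P (- s) (F' x)) (P (- s) (F' x)))"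
    by (simp add: norm_sq_cinner[symmetric] power2_eq_square)
  also have "cinner (P (- s) (F' x)) (P (- s) (F' x)) = cinner (F' x) (P (- s) (P (- s) (F' x)))"
    by (rule cinner_P[symmetric]) (intro P_Hinf F' x)+
  also have "P (- s) (P (- s) (F' x)) = w" unfolding w_def using F'[OF x] by (simp add: P_P)
  also have "cinner (F' x) w = cinner x (P (- s) (P s (F w)))" using x w by (simp add: adj F)
  also have "\<dots> = cinner (P (- s) x) (P s (F w))" by (rule cinner_P) (intro P_Hinf F x w)+
  also have "Re \<dots> \<le> norm (P (- s) x) * norm (P s (F w))" by (rule Re_cinner_le)
  also have "\<dots> \<le> norm (P (- s) x) * (M * norm (P s w))"
    using bd w by (intro mult_left_mono) (auto simp: sob_bd_def)
  finally have "norm (P (- s) (F' x)) * norm (P (- s) (F' x)) \<le> (M * norm (P (- s) x)) * norm (P (- s) (F' x))"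
    unfolding Pw by (simp add: mult_ac)
  moreover have "0 \<le> M * norm (P (- s) x)"
  proof -
    have z: "P (- (2 * s)) x \<in> Hinf" by (rule P_Hinf[OF x])
    have "norm (P s (F (P (- (2 * s)) x))) \<le> M * norm (P s (P (- (2 * s)) x))" using bd z by (auto simp: sob_bd_def)
    then have "0 \<le> M * norm (P s (P (- (2 * s)) x))" by (rule order_trans[OF norm_ge_zero])
    then show ?thesis using x by (simp add: P_P)
  qed
  ultimately show "norm (P (- s) (F' x)) \<le> M * norm (P (- s) x)"
    by (intro le_if_mult_self_le[OF _ norm_ge_zero])
qed

text \<open>Log-convexity makes the ratios of consecutive terms nondecreasing, so an initial ratio above \<open>Q\<close>
  would contradict the growth \<open>O(Q\<^sup>n)\<close>. It is applied to \<open>s n = \<parallel>S\<^sup>n z\<parallel>\<close> with \<open>S\<close> symmetric.\<close>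

lemma log_convex_growth:
  fixes s :: "nat \<Rightarrow> real"
  assumes pos: "\<And>n. s n \<ge> 0" and conv: "\<And>n. (s (Suc n))\<^sup>2 \<le> s n * s (Suc (Suc n))"
    and bnd: "\<And>n. s n \<le> K * Q ^ n" and Q: "Q \<ge> 0"
  shows "s 1 \<le> Q * s 0"
proof (rule ccontr)
  assume less: "\<not> s 1 \<le> Q * s 0"
  have "s 1 > 0" using less Q pos[of 0] mult_nonneg_nonneg[OF Q pos[of 0]] by linarith
  have "s 0 > 0" using conv[of 0] pos[of 0] \<open>s 1 > 0\<close>
    by (cases "s 0 = 0") auto
  define r where "r = s 1 / s 0"
  have r: "r > Q" using less \<open>s 0 > 0\<close> by (simp add: r_def field_simps)
  have step: "s (Suc n) \<ge> r * s n \<and> s n > 0" for n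
  proof (induction n)
    case 0
    then show ?case using \<open>s 0 > 0\<close> by (simp add: r_def)
  next
    case (Suc n)
    have "r * s n > 0" using Suc r Q by (intro mult_pos_pos) auto
    then have p: "s (Suc n) > 0" using Suc by linarith
    have "s n * (r * s (Suc n)) = (r * s n) * s (Suc n)" by (simp only: mult_ac)
    also have "\<dots> \<le> s (Suc n) * s (Suc n)" using Suc p by (intro mult_right_mono) auto
    also have "\<dots> \<le> s n * s (Suc (Suc n))" using conv[of n] by (simp add: power2_eq_square)
    finally have "r * s (Suc n) \<le> s (Suc (Suc n))" using Suc mult_le_cancel_left_pos by blast
    then show ?case using p by blast
  qed
  have low: "r ^ n * s 0 \<le> s n" for n
  proof (induction n)
    case (Suc n)
    have "r * (r ^ n * s 0) \<le> r * s n" using Suc r Q by (intro mult_left_mono) auto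
    also have "\<dots> \<le> s (Suc n)" using step[of n] by blast
    finally show ?case by (simp add: mult.assoc)
  qed simp
  have "Q \<noteq> 0" using bnd[of 1] \<open>s 1 > 0\<close> by auto
  then have Qp: "Q > 0" using Q by simp
  have "(r / Q) ^ n \<le> K / s 0" for n
    using order_trans[OF low[of n] bnd[of n]] Qp \<open>s 0 > 0\<close> by (simp add: power_divide field_simps)
  moreover have "r / Q > 1" using r Qp by simp
  ultimately show False using real_arch_pow[of "r / Q" "K / s 0"] by (meson not_le)
qed

text \<open>With \<open>c\<close> the midpoint of \<open>a\<close> and \<open>b\<close>, the square of the norm of \<open>F\<close> on the space of
  index \<open>c\<close> is the norm of the positive operator \<open>S = \<Theta>\<^sup>-\<^sup>c F\<^sup>* \<Theta>\<^sup>2\<^sup>c F \<Theta>\<^sup>-\<^sup>c\<close>. Conjugation by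
  \<open>\<Theta>\<^sup>c\<^sup>-\<^sup>a\<close> turns \<open>S\<close> into the product \<open>G\<close> of the conjugates \<open>\<Theta>\<^sup>-\<^sup>a F\<^sup>* \<Theta>\<^sup>a\<close> and
  \<open>\<Theta>\<^sup>b F \<Theta>\<^sup>-\<^sup>b\<close>, each bounded by \<open>M\<close>, so that \<open>S\<^sup>N z = O(M\<^sup>2\<^sup>N)\<close> for each \<open>z\<close>, \<open>\<Theta>\<^sup>a\<^sup>-\<^sup>c\<close> being bounded; for a
  symmetric operator this forces \<open>\<parallel>S z\<parallel> \<le> M\<^sup>2 \<parallel>z\<parallel>\<close>.\<close>

lemma sob_bd_midpoint:
  assumes F: "\<And>x. x \<in> Hinf \<Longrightarrow> F x \<in> Hinf" and F': "\<And>x. x \<in> Hinf \<Longrightarrow> F' x \<in> Hinf"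
    and adj: "\<And>x y. x \<in> Hinf \<Longrightarrow> y \<in> Hinf \<Longrightarrow> cinner (F' x) y = cinner x (F y)"
    and bd: "sob_bd F a M" "sob_bd F b M" and ab: "a \<le> b" and M: "M \<ge> 0"
  shows "sob_bd F ((a + b) / 2) M"
proof -
  define c where "c = (a + b) / 2"
  have c: "c + c = a + b" "c - a \<ge> 0" using ab by (auto simp: c_def)
  have bd': "sob_bd F' (- a) M" by (rule sob_bd_dual[OF F F' adj bd(1)])
  define S where "S z = P (- c) (F' (P (c + c) (F (P (- c) z))))" for z
  define G where "G z = P (- a) (F' (P a (P b (F (P (- b) z)))))" for z
  have SH: "S z \<in> Hinf" if "z \<in> Hinf" for z unfolding S_def by (intro P_Hinf F F' that)
  have GH: "G z \<in> Hinf" if "z \<in> Hinf" for z unfolding G_def by (intro P_Hinf F F' that)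
  have adj2: "cinner (F x) y = cinner x (F' y)" if "x \<in> Hinf" "y \<in> Hinf" for x y
    using adj[OF that(2,1)] by (metis cinner_commute)
  have Ssym: "cinner (S x) y = cinner x (S y)" if x: "x \<in> Hinf" and y: "y \<in> Hinf" for x y
  proof -
    have i: "P (- c) x \<in> Hinf" "P (- c) y \<in> Hinf" by (intro P_Hinf x y)+
    have "cinner (S x) y = cinner (P (c + c) (F (P (- c) x))) (F (P (- c) y))"
      unfolding S_def using i x y by (simp add: cinner_P[symmetric] adj P_Hinf F F')
    also have "\<dots> = cinner x (S y)"
      unfolding S_def using i x y by (simp add: cinner_P[symmetric] adj2 P_Hinf F F')
    finally show ?thesis .
  qed
  have Gbd: "norm (G z) \<le> M\<^sup>2 * norm z" if z: "z \<in> Hinf" for z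
  proof -
    define w where "w = P b (F (P (- b) z))"
    have w: "w \<in> Hinf" unfolding w_def by (intro P_Hinf F z)
    have "norm (G z) \<le> M * norm (P (- a) (P a w))"
      unfolding G_def w_def[symmetric] using bd' P_Hinf[OF w] by (auto simp: sob_bd_def)
    also have "\<dots> = M * norm w" using w by simp
    also have "norm w \<le> M * norm (P b (P (- b) z))"
      unfolding w_def using bd(2) P_Hinf[OF z] by (auto simp: sob_bd_def)
    finally show ?thesis using M z by (simp add: power2_eq_square mult_left_mono)
  qed
  have conj: "S z = P (a - c) (G (P (c - a) z))" if z: "z \<in> Hinf" for z
  proof -
    have "- b + (c - a) = - c" using c(1) by linarith
    then have e: "P (- b) (P (c - a) z) = P (- c) z" using z by (simp only: P_P)
    have u: "F (P (- c) z) \<in> Hinf" by (intro F P_Hinf z)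
    have "P a (P b (F (P (- c) z))) = P (c + c) (F (P (- c) z))" using u c by (simp add: P_P)
    then have "G (P (c - a) z) = P (- a) (F' (P (c + c) (F (P (- c) z))))" unfolding G_def e by simp
    then show ?thesis unfolding S_def using u by (simp add: P_P P_Hinf F')
  qed
  have Spow: "(S ^^ N) z \<in> Hinf" "(S ^^ N) z = P (a - c) ((G ^^ N) (P (c - a) z))"
    "(G ^^ N) (P (c - a) z) \<in> Hinf" "norm ((G ^^ N) (P (c - a) z)) \<le> (M\<^sup>2) ^ N * norm (P (c - a) z)"
    if z: "z \<in> Hinf" for z N
  proof (induction N)
    case 0
    { case 1 show ?case using z by simp }
    { case 2 show ?case using z by (simp add: P_P) }
    { case 3 show ?case using z by (simp add: P_Hinf) }
    { case 4 show ?case by simp }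
  next
    case (Suc N)
    { case 1 show ?case using Suc(1) by (simp add: SH) }
    { case 2
      have "S ((S ^^ N) z) = P (a - c) (G (P (c - a) (P (a - c) ((G ^^ N) (P (c - a) z)))))"
        using conj[OF Suc(1)] Suc(2) by simp
      then show ?case using Suc(3) by (simp add: P_P) }
    { case 3 show ?case using Suc(3) by (simp add: GH) }
    { case 4
      have "norm (G ((G ^^ N) (P (c - a) z))) \<le> M\<^sup>2 * norm ((G ^^ N) (P (c - a) z))" by (rule Gbd[OF Suc(3)])
      also have "\<dots> \<le> M\<^sup>2 * ((M\<^sup>2) ^ N * norm (P (c - a) z))" by (intro mult_left_mono Suc(4)) auto
      finally show ?case by (simp add: mult.assoc) }
  qed
  obtain \<kappa> where \<kappa>: "\<kappa> > 0" "\<And>x. norm (P (a - c) x) \<le> \<kappa> * norm x"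
    using bounded_clinear_bound[OF bounded_clinear_P_nonpos[OF c(2)]] by auto
  have Sbd: "norm (S z) \<le> M\<^sup>2 * norm z" if z: "z \<in> Hinf" for z
  proof -
    have "norm ((S ^^ 1) z) \<le> M\<^sup>2 * norm ((S ^^ 0) z)"
    proof (rule log_convex_growth[where K = "\<kappa> * norm (P (c - a) z)"])
      show "(norm ((S ^^ Suc n) z))\<^sup>2 \<le> norm ((S ^^ n) z) * norm ((S ^^ Suc (Suc n)) z)" for n
      proof -
        let ?u = "(S ^^ n) z"
        have u: "?u \<in> Hinf" "S ?u \<in> Hinf" using Spow(1)[OF z] SH by auto
        have "(norm (S ?u))\<^sup>2 = Re (cinner ?u (S (S ?u)))"
          by (simp add: norm_sq_cinner Ssym[OF u])
        also have "\<dots> \<le> norm ?u * norm (S (S ?u))" by (rule Re_cinner_le)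
        finally show ?thesis by simp
      qed
      show "norm ((S ^^ n) z) \<le> \<kappa> * norm (P (c - a) z) * (M\<^sup>2) ^ n" for n
      proof -
        have "norm ((S ^^ n) z) \<le> \<kappa> * norm ((G ^^ n) (P (c - a) z))" unfolding Spow(2)[OF z] by (rule \<kappa>)
        also have "\<dots> \<le> \<kappa> * ((M\<^sup>2) ^ n * norm (P (c - a) z))" using \<kappa>(1) by (intro mult_left_mono Spow(4) z) auto
        finally show ?thesis by (simp add: mult_ac)
      qed
    qed auto
    then show ?thesis by simp
  qed
  show ?thesis unfolding c_def[symmetric] sob_bd_def
  proof
    fix x assume x: "x \<in> Hinf"
    define z where "z = P c x"
    have z: "z \<in> Hinf" and xz: "x = P (- c) z" unfolding z_def using x by (simp_all add: P_Hinf)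
    have i: "F x \<in> Hinf" by (rule F[OF x])
    have "(norm (P c (F x)))\<^sup>2 = Re (cinner (F x) (P (c + c) (F x)))"
      by (simp only: norm_sq_cinner P_P[OF i, symmetric] cinner_P[OF i P_Hinf[OF i]])
    also have "cinner (F x) (P (c + c) (F x)) = cinner x (F' (P (c + c) (F x)))"
      by (rule adj2[OF x P_Hinf[OF i]])
    also have "\<dots> = cinner z (S z)"
      by (simp only: S_def xz[symmetric] cinner_P[OF z F'[OF P_Hinf[OF i]]])
    also have "Re \<dots> \<le> norm z * norm (S z)" by (rule Re_cinner_le)
    also have "\<dots> \<le> norm z * (M\<^sup>2 * norm z)" by (intro mult_left_mono Sbd z) auto
    also have "\<dots> = (M * norm z)\<^sup>2" by (simp add: power2_eq_square)
    finally have "norm (P c (F x)) \<le> M * norm z" by (rule power2_le_imp_le) (simp add: M)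
    then show "norm (P c (F x)) \<le> M * norm (P c x)" by (simp only: z_def)
  qed
qed

text \<open>The derivative \<open>t\<^sup>a ln t\<close> of \<open>a \<mapsto> t\<^sup>a\<close> is bounded for \<open>1 \<le> a \<le> m\<close> and \<open>t > 0\<close> in a bounded set.\<close>

lemma powR_lipschitz:
  "\<exists>C. \<forall>a\<in>{1..m}. \<forall>b\<in>{1..m}. \<forall>y. norm (powR a y - powR b y) \<le> C * \<bar>a - b\<bar> * norm y"
proof -
  define K where "K = max 1 specbound"
  define C where "C = K powr (m + 1)"
  have K: "K \<ge> 1" "specbound \<le> K" by (auto simp: K_def)
  have C0: "C \<ge> 0" by (simp add: C_def)
  have scalar: "\<bar>t powr a - t powr b\<bar> \<le> C * \<bar>a - b\<bar>"
    if t: "t \<in> {0..specbound}" and ab: "a \<in> {1..m}" "b \<in> {1..m}" for t a b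
  proof (cases "t = 0")
    case True
    then show ?thesis using C0 by simp
  next
    case False
    then have t0: "t > 0" using t by simp
    have "norm (t powr a - t powr b) \<le> C * norm (a - b)"
    proof (rule field_differentiable_bound[of "{1..m}"])
      show "((\<lambda>a. t powr a) has_field_derivative t powr a * ln t) (at a within {1..m})" for a
        using t0 by (auto intro!: derivative_eq_intros simp: powr_def)
      fix a assume a: "a \<in> {1..m}"
      have "\<bar>t powr a * ln t\<bar> \<le> C"
      proof (cases "t \<le> 1")
        case True
        have "t powr a \<le> t powr 1" using a t0 True by (intro powr_mono') auto
        moreover have "\<bar>ln t\<bar> \<le> 1 / t"
          using t0 True ln_le_minus_one[of "1 / t"] by (simp add: ln_div)
        ultimately have "t powr a * \<bar>ln t\<bar> \<le> t * (1 / t)" using t0 by (intro mult_mono) auto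
        also have "\<dots> \<le> C" using t0 K(1) a by (simp add: C_def ge_one_powr_ge_zero)
        finally show ?thesis by (simp add: abs_mult)
      next
        case False
        have tK: "t \<le> K" using t K(2) by auto
        have "\<bar>ln t\<bar> \<le> K" using False ln_le_minus_one[OF t0] tK by simp
        moreover have "t powr a \<le> K powr m"
          using a False tK t0 K(1) by (intro order_trans[OF powr_mono[of a m t] powr_mono2]) auto
        ultimately have "t powr a * \<bar>ln t\<bar> \<le> K powr m * K" using K(1) by (intro mult_mono) auto
        also have "\<dots> = C" using K(1) by (simp add: C_def powr_add)
        finally show ?thesis by (simp add: abs_mult)
      qed
      then show "norm (t powr a * ln t) \<le> C" by simp
    qed (use ab in auto)
    then show ?thesis by simp
  qed
  have "norm (powR a y - powR b y) \<le> C * \<bar>a - b\<bar> * norm y" if ab: "a \<in> {1..m}" "b \<in> {1..m}" for a b y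
  proof -
    have ap: "poly_approximable (real_spectrum R) (\<lambda>t. complex_of_real (t powr a))"
      "poly_approximable (real_spectrum R) (\<lambda>t. complex_of_real (t powr b))"
      using ab by (auto intro: approximable_powr)
    have "powR a y - powR b y = cfc R (\<lambda>t. complex_of_real (t powr a) - complex_of_real (t powr b)) y"
      unfolding powR_def by (rule cfc_diff[OF ap, symmetric])
    also have "norm \<dots> \<le> (C * \<bar>a - b\<bar>) * norm y"
    proof (rule cfc_norm_le[OF poly_approximable_diff(1)[OF ap]])
      fix t assume "t \<in> real_spectrum R"
      then have "t \<in> {0..specbound}" using real_spectrum_R by blast
      from scalar[OF this ab]
      show "cmod (complex_of_real (t powr a) - complex_of_real (t powr b)) \<le> C * \<bar>a - b\<bar>"
        by (metis norm_of_real of_real_diff)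
    qed (use C0 in simp)
    finally show ?thesis .
  qed
  then show ?thesis by blast
qed

lemma P_tendsto:
  assumes x: "x \<in> Hinf" and s: "\<And>k. s k \<in> {0..m}" "s \<longlonglongrightarrow> l" "l \<in> {0..m}"
  shows "(\<lambda>k. P (s k) x) \<longlonglongrightarrow> P l x"
proof -
  have m: "m \<ge> 0" "m + 1 > 0" using s(3) by auto
  obtain y where y: "x = powR (m + 1) y" by (rule Hinf_powRE[OF x m(2)])
  have P: "P r x = powR (m + 1 - r) y" if "r \<in> {0..m}" for r
    unfolding y by (rule P_powR) (use that m in auto)
  obtain C where C: "\<And>a b y. a \<in> {1..m+1} \<Longrightarrow> b \<in> {1..m+1} \<Longrightarrow> norm (powR a y - powR b y) \<le> C * \<bar>a - b\<bar> * norm y"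
    using powR_lipschitz[of "m + 1"] by blast
  have "norm (P (s k) x - P l x) \<le> C * \<bar>(m + 1 - s k) - (m + 1 - l)\<bar> * norm y" for k
    unfolding P[OF s(1)] P[OF s(3)] using s(1)[of k] s(3) by (intro C) auto
  then have "\<forall>\<^sub>F k in sequentially. norm (P (s k) x - P l x) \<le> C * \<bar>(m + 1 - s k) - (m + 1 - l)\<bar> * norm y"
    by (intro always_eventually allI)
  moreover have "(\<lambda>k. C * \<bar>(m + 1 - s k) - (m + 1 - l)\<bar> * norm y) \<longlonglongrightarrow> C * \<bar>(m + 1 - l) - (m + 1 - l)\<bar> * norm y"
    by (intro tendsto_intros s)
  then have "(\<lambda>k. C * \<bar>(m + 1 - s k) - (m + 1 - l)\<bar> * norm y) \<longlonglongrightarrow> 0" by simp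
  ultimately have "(\<lambda>k. P (s k) x - P l x) \<longlonglongrightarrow> 0" by (rule Lim_null_comparison)
  then show ?thesis by (rule LIM_zero_cancel)
qed

text \<open>The set of indices with the bound is closed and closed under midpoints.\<close>

lemma sob_bd_interpolate:
  assumes F: "\<And>x. x \<in> Hinf \<Longrightarrow> F x \<in> Hinf" and F': "\<And>x. x \<in> Hinf \<Longrightarrow> F' x \<in> Hinf"
    and adj: "\<And>x y. x \<in> Hinf \<Longrightarrow> y \<in> Hinf \<Longrightarrow> cinner (F' x) y = cinner x (F y)"
    and bd: "sob_bd F 0 M" "sob_bd F m M" and M: "M \<ge> 0" and s: "s \<in> {0..m}"
  shows "sob_bd F s M"
proof (rule ccontr)
  assume ns: "\<not> sob_bd F s M"
  define Z where "Z = {r\<in>{0..m}. sob_bd F r M}"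
  have cl: "closed Z" unfolding closed_sequential_limits
  proof (intro allI impI, elim conjE)
    fix r l assume r: "\<forall>n. r n \<in> Z" "r \<longlonglongrightarrow> l"
    then have r': "r n \<in> {0..m}" for n by (auto simp: Z_def)
    have l: "l \<in> {0..m}" using closed_sequentially[OF closed_atLeastAtMost r' r(2)] .
    have "norm (P l (F x)) \<le> M * norm (P l x)" if x: "x \<in> Hinf" for x
    proof (rule LIMSEQ_le)
      show "(\<lambda>n. norm (P (r n) (F x))) \<longlonglongrightarrow> norm (P l (F x))"
        by (intro tendsto_norm P_tendsto[OF F[OF x] r' r(2) l])
      show "(\<lambda>n. M * norm (P (r n) x)) \<longlonglongrightarrow> M * norm (P l x)"
        by (intro tendsto_mult_left tendsto_norm P_tendsto[OF x r' r(2) l])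
      show "\<exists>N. \<forall>n\<ge>N. norm (P (r n) (F x)) \<le> M * norm (P (r n) x)"
        using r(1) x by (auto simp: Z_def sob_bd_def)
    qed
    then show "l \<in> Z" using l by (auto simp: Z_def sob_bd_def)
  qed
  define a b where "a = Sup (Z \<inter> {0..s})" and "b = Inf (Z \<inter> {s..m})"
  have bdd: "bdd_above (Z \<inter> {0..s})" "bdd_below (Z \<inter> {s..m})"
    by (auto intro: bdd_aboveI[of _ s] bdd_belowI[of _ s])
  have "0 \<in> Z \<inter> {0..s}" "m \<in> Z \<inter> {s..m}" using bd s by (auto simp: Z_def)
  then have ne: "Z \<inter> {0..s} \<noteq> {}" "Z \<inter> {s..m} \<noteq> {}" by blast+
  have a: "a \<in> Z \<inter> {0..s}" unfolding a_def
    by (intro closed_contains_Sup closed_Int cl ne bdd closed_atLeastAtMost)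
  have b: "b \<in> Z \<inter> {s..m}" unfolding b_def
    by (intro closed_contains_Inf closed_Int cl ne bdd closed_atLeastAtMost)
  have sZ: "s \<notin> Z" using ns by (simp add: Z_def)
  have ab: "a < s" "s < b" using a b sZ by (auto simp: less_le)
  have "sob_bd F ((a + b) / 2) M"
    using a b ab by (intro sob_bd_midpoint[OF F F' adj] M) (auto simp: Z_def)
  then have c: "(a + b) / 2 \<in> Z" using a b by (auto simp: Z_def)
  then have c0: "0 \<le> (a + b) / 2" "(a + b) / 2 \<le> m" by (auto simp: Z_def)
  show False
  proof (cases "(a + b) / 2 \<le> s")
    case True
    then have "(a + b) / 2 \<in> Z \<inter> {0..s}" using c c0 by simp
    then have "(a + b) / 2 \<le> a" unfolding a_def by (rule cSup_upper[OF _ bdd(1)])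
    then show False using ab by simp
  next
    case False
    then have "(a + b) / 2 \<in> Z \<inter> {s..m}" using c c0 by simp
    then have "b \<le> (a + b) / 2" unfolding b_def by (rule cInf_lower[OF _ bdd(2)])
    then show False using ab by simp
  qed
qed

end


section \<open>The functional calculus on all Sobolev spaces\<close>

context chebyshev
begin

lemma tnorm_cnj: "smooth_real f \<Longrightarrow> tnorm N (\<lambda>x. cnj (f x)) = tnorm N f"
  by (simp add: tnorm_def I_def nth_deriv_cnj)

lemma tnorm_mono: "N \<le> N' \<Longrightarrow> tnorm N f \<le> tnorm N' f"
  unfolding tnorm_def by (rule sum_mono2) (auto simp: I_nonneg)

text \<open>On the compact interval \<open>{-L..L}\<close> all weights are bounded below by \<open>\<langle>L\<rangle>\<^sup>-\<^sup>1\<close>.\<close>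

lemma I_le_T_norm:
  assumes f: "smooth_real f"
  shows "ennreal (I k f) \<le> ennreal (sqrt (1 + L\<^sup>2)) * T_norm 0 k f"
proof -
  let ?g = "\<lambda>x. cmod (nth_deriv k f x)" and ?W = "sqrt (1 + L\<^sup>2)"
  let ?w = "\<lambda>x. sqrt (1 + \<bar>x\<bar>\<^sup>2) powr (real k - 0 - 1)"
  have W: "?W \<ge> 1" by simp
  have w: "1 \<le> ?W * ?w x" if x: "x \<in> {-L..L}" for x
  proof -
    have s: "1 \<le> sqrt (1 + \<bar>x\<bar>\<^sup>2)" by simp
    have "\<bar>x\<bar> \<le> \<bar>L\<bar>" using x by auto
    then have sL: "sqrt (1 + \<bar>x\<bar>\<^sup>2) \<le> ?W" by (simp add: abs_le_square_iff)
    show ?thesis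
    proof (cases "k = 0")
      case True
      then have e: "?w x = 1 / sqrt (1 + \<bar>x\<bar>\<^sup>2)" using s by (simp add: powr_minus_divide)
      have "1 \<le> ?W / sqrt (1 + \<bar>x\<bar>\<^sup>2)"
        using sL less_le_trans[OF zero_less_one s] by (simp only: le_divide_eq_1_pos)
      then show ?thesis unfolding e by simp
    next
      case False
      then have "1 \<le> ?w x" using s by (intro ge_one_powr_ge_zero) auto
      then have "1 * 1 \<le> ?W * ?w x" using W by (intro mult_mono) auto
      then show ?thesis by simp
    qed
  qed
  have cg: "continuous_on UNIV ?g" by (intro continuous_intros continuous_on_nth_deriv f)
  have "(?g has_integral I k f) {-L..L}"
    unfolding I_def by (intro integrable_integral integrable_nth_deriv f)
  then have "ennreal (I k f) = (\<integral>\<^sup>+x. ennreal (?g x) * indicator {-L..L} x \<partial>lborel)"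
    by (intro nn_integral_has_integral_lebesgue'[symmetric]) auto
  also have "\<dots> \<le> (\<integral>\<^sup>+x. ennreal ?W * ennreal (?g x * ?w x) \<partial>lborel)"
  proof (rule nn_integral_mono)
    fix x
    show "ennreal (?g x) * indicator {-L..L} x \<le> ennreal ?W * ennreal (?g x * ?w x)"
    proof (cases "x \<in> {-L..L}")
      case True
      have "?g x * 1 \<le> ?g x * (?W * ?w x)" using w[OF True] by (intro mult_left_mono) auto
      then have "ennreal (?g x) \<le> ennreal (?W * (?g x * ?w x))" by (intro ennreal_leI) (simp only: mult_ac mult_1)
      also have "\<dots> = ennreal ?W * ennreal (?g x * ?w x)" using W by (intro ennreal_mult) auto
      finally show ?thesis using True by simp
    qed simp
  qed
  also have "\<dots> = ennreal ?W * T_norm 0 k f"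
    unfolding T_norm_def
  proof (rule nn_integral_cmult)
    have "?g \<in> borel_measurable borel" using cg by (rule borel_measurable_continuous_onI)
    then show "(\<lambda>x. ennreal (?g x * ?w x)) \<in> borel_measurable lborel" by measurable
  qed
  finally show ?thesis .
qed

lemma tnorm_le_T_norm:
  assumes "smooth_real f"
  shows "ennreal (tnorm N f) \<le> ennreal (sqrt (1 + L\<^sup>2)) * (\<Sum>k\<in>{0..N}. T_norm 0 k f)"
proof -
  have "ennreal (tnorm N f) = (\<Sum>k\<in>{0..N}. ennreal (I k f))"
    unfolding tnorm_def by (simp add: I_nonneg atMost_atLeast0)
  also have "\<dots> \<le> (\<Sum>k\<in>{0..N}. ennreal (sqrt (1 + L\<^sup>2)) * T_norm 0 k f)"
    by (intro sum_mono I_le_T_norm assms)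
  finally show ?thesis by (simp add: sum_distrib_left)
qed

end

lemma (in sobolev_scale) sob_bd_mono: "sob_bd F s M \<Longrightarrow> M \<le> M' \<Longrightarrow> sob_bd F s M'"
  unfolding sob_bd_def by (meson mult_right_mono norm_ge_zero order_trans)

context order_zero_op
begin

text \<open>Interpolation between the indices \<open>0\<close> and \<open>\<lceil>|s|\<rceil>\<close>; for negative \<open>s\<close>, duality with the operator
  belonging to the complex conjugate of \<open>f\<close>, whose norms are the same.\<close>

lemma cfc_smooth_sobolev_bound:
  "\<exists>M\<ge>0. \<forall>f. smooth_real f \<longrightarrow> sob_bd (cfc T f) s (M * tnorm (nat \<lceil>\<bar>s\<bar>\<rceil> + 2) f)"
proof -
  define n where "n = nat \<lceil>\<bar>s\<bar>\<rceil>"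
  have n: "\<bar>s\<bar> \<in> {0..real n}" by (simp add: n_def)
  obtain M0 where M0: "M0 \<ge> 0" "\<And>f x. smooth_real f \<Longrightarrow> x \<in> Hinf \<Longrightarrow>
      norm (P (real 0) (cfc T f x)) \<le> M0 * tnorm (0 + 2) f * norm (P (real 0) x)"
    using cfc_smooth_integer_bound[of 0] by blast
  obtain Mn where Mn: "Mn \<ge> 0" "\<And>f x. smooth_real f \<Longrightarrow> x \<in> Hinf \<Longrightarrow>
      norm (P (real n) (cfc T f x)) \<le> Mn * tnorm (n + 2) f * norm (P (real n) x)"
    using cfc_smooth_integer_bound[of n] by blast
  define M where "M = max M0 Mn"
  have M: "M \<ge> 0" using M0 by (simp add: M_def)
  have adj: "cinner (cfc T (\<lambda>x. cnj (f x)) x) y = cinner x (cfc T f y)" if "smooth_real f" for f x y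
    by (rule T.cinner_cfc[symmetric]) (rule poly_approximable_smooth[OF that])
  have pos: "sob_bd (cfc T f) \<bar>s\<bar> (M * tnorm (n + 2) f)" if f: "smooth_real f" for f
  proof (rule sob_bd_interpolate[OF cfc_smooth_Hinf[OF f] cfc_smooth_Hinf[OF smooth_real_cnj[OF f]] adj[OF f] _ _ _ n])
    have "M0 * tnorm (0 + 2) f \<le> M * tnorm (n + 2) f"
      using M M0 by (intro mult_mono tnorm_mono tnorm_nonneg) (auto simp: M_def)
    then show "sob_bd (cfc T f) 0 (M * tnorm (n + 2) f)"
      by (rule sob_bd_mono[rotated]) (use M0(2)[OF f] in \<open>simp add: sob_bd_def\<close>)
    have "Mn * tnorm (n + 2) f \<le> M * tnorm (n + 2) f"
      by (intro mult_right_mono tnorm_nonneg) (simp add: M_def)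
    then show "sob_bd (cfc T f) (real n) (M * tnorm (n + 2) f)"
      by (rule sob_bd_mono[rotated]) (use Mn(2)[OF f] in \<open>simp add: sob_bd_def\<close>)
    show "0 \<le> M * tnorm (n + 2) f" using M tnorm_nonneg by simp
  qed
  have "sob_bd (cfc T f) s (M * tnorm (n + 2) f)" if f: "smooth_real f" for f
  proof (cases "s \<ge> 0")
    case True
    then show ?thesis using pos[OF f] by simp
  next
    case False
    have "sob_bd (cfc T f) (- \<bar>s\<bar>) (M * tnorm (n + 2) (\<lambda>x. cnj (f x)))"
    proof (rule sob_bd_dual)
      show "sob_bd (cfc T (\<lambda>x. cnj (f x))) \<bar>s\<bar> (M * tnorm (n + 2) (\<lambda>x. cnj (f x)))"
        by (rule pos[OF smooth_real_cnj[OF f]])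
      show "cinner (cfc T f x) y = cinner x (cfc T (\<lambda>x. cnj (f x)) y)" for x y
        using adj[OF smooth_real_cnj[OF f], of x y] by simp
    qed (use cfc_smooth_Hinf[OF f] cfc_smooth_Hinf[OF smooth_real_cnj[OF f]] in auto)
    then show ?thesis using False by (simp add: tnorm_cnj[OF f])
  qed
  then show ?thesis using M unfolding n_def by blast
qed

lemma bounded_clinear_cfc_smooth: "smooth_real f \<Longrightarrow> bounded_clinear (cfc T f)"
  by (rule T.bounded_clinear_cfc[OF poly_approximable_smooth])

lemma cfc_sob_ext:
  assumes f: "smooth_real f" and M: "M \<ge> 0" "sob_bd (cfc T f) s M"
  shows "sob_onorm \<Theta> s s (sob_ext \<Theta> s s (Some \<circ> cfc T f)) \<le> M"
  by (rule sob_ext_exists(2))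
    (use M cfc_smooth_Hinf[OF f] bounded_clinear_add[OF bounded_clinear_cfc_smooth[OF f]]
      bounded_clinear_scaleC[OF bounded_clinear_cfc_smooth[OF f]] in \<open>auto simp: sob_bd_def\<close>)

lemma cfc_in_op:
  assumes f: "smooth_real f" shows "in_op \<Theta> 0 (Some \<circ> cfc T f)"
proof -
  let ?A = "(Some \<circ> cfc T f) |` Hinf"
  have A: "?A x = Some (cfc T f x)" if "x \<in> Hinf" for x using that by simp
  note H = cfc_smooth_Hinf[OF f]
  note lin = bounded_clinear_add[OF bounded_clinear_cfc_smooth[OF f]]
    bounded_clinear_scaleC[OF bounded_clinear_cfc_smooth[OF f]] bounded_clinear_zero[OF bounded_clinear_cfc_smooth[OF f]]
  have "dom ?A = Hinf" by (auto simp: restrict_map_def dom_def)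
  moreover have "ran ?A \<subseteq> Hinf" using H by (auto simp: restrict_map_def ran_def split: if_splits)
  moreover have "linear_pop ?A" unfolding linear_pop_def
    using lin by (auto simp: restrict_map_def intro: Hinf_add Hinf_scale split: if_splits)
  moreover have "\<exists>B. is_sob_ext \<Theta> (s + 0) s ?A B" for s
  proof -
    obtain M where M: "M \<ge> 0" "sob_bd (cfc T f) s (M * tnorm (nat \<lceil>\<bar>s\<bar>\<rceil> + 2) f)"
      using cfc_smooth_sobolev_bound f by blast
    have "is_sob_ext \<Theta> s s ?A (sob_ext \<Theta> s s ?A)"
    proof (rule sob_ext_exists(1))
      show "0 \<le> M * tnorm (nat \<lceil>\<bar>s\<bar>\<rceil> + 2) f" using M(1) tnorm_nonneg by simp
      show "norm (P s (the (?A x))) \<le> M * tnorm (nat \<lceil>\<bar>s\<bar>\<rceil> + 2) f * norm (P s x)" if "x \<in> Hinf" for x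
        using M(2) that by (simp add: sob_bd_def A)
    qed (use H lin in \<open>auto simp: Hinf_add Hinf_scale\<close>)
    then show ?thesis by auto
  qed
  ultimately show ?thesis using H by (auto simp: in_op_def op_class_def)
qed

text \<open>Since \<open>2\<^bsup>n-1\<^esup> \<ge> n\<close> for \<open>n = \<lceil>|s|\<rceil> \<ge> 1\<close>, the exponent \<open>\<lceil>2\<^bsup>|s|\<^esup>\<rceil> + 1\<close> leaves room for \<open>\<lceil>|s|\<rceil> + 2\<close> derivatives.\<close>

lemma ceiling_le_two_powr: "nat \<lceil>\<bar>s\<bar>\<rceil> + 2 \<le> nat \<lceil>2 powr \<bar>s::real\<bar>\<rceil> + 1"
proof (cases "s = 0")
  case False
  define n where "n = nat \<lceil>\<bar>s\<bar>\<rceil>"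
  have "\<lceil>\<bar>s\<bar>\<rceil> \<ge> 1" using False by (simp add: one_le_ceiling)
  then have n: "n \<ge> 1" "real n - 1 < \<bar>s\<bar>" unfolding n_def by linarith+
  obtain m where m: "n = Suc m" using n(1) by (cases n) auto
  have "n \<le> 2 ^ (n - 1)" using less_exp[of m] by (simp add: m Suc_le_eq)
  then have "real n \<le> real (2 ^ (n - 1))" by (simp only: of_nat_le_iff)
  also have "\<dots> = 2 powr (real n - 1)" using n(1) by (simp add: powr_realpow[symmetric] of_nat_diff)
  also have "\<dots> < 2 powr \<bar>s\<bar>" using n(2) by (intro powr_less_mono) auto
  finally have "int n < \<lceil>2 powr \<bar>s\<bar>\<rceil>" by (simp add: less_ceiling_iff)
  then show ?thesis unfolding n_def[symmetric] by linarith
qed simp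

lemma cfc_sob_onorm_bound:
  "\<exists>C>0. \<forall>f. smooth_real f \<longrightarrow>
     ennreal (sob_onorm \<Theta> s s (sob_ext \<Theta> s s (Some \<circ> cfc T f)))
       \<le> ennreal C * (\<Sum>k\<in>{0..nat \<lceil>2 powr \<bar>s\<bar>\<rceil> + 1}. T_norm 0 k f)"
proof -
  obtain M where M: "M \<ge> 0" "\<And>f. smooth_real f \<Longrightarrow> sob_bd (cfc T f) s (M * tnorm (nat \<lceil>\<bar>s\<bar>\<rceil> + 2) f)"
    using cfc_smooth_sobolev_bound by blast
  \<comment> \<open>\<open>M + 1\<close> instead of \<open>M\<close> only to have a positive constant\<close>
  define C where "C = (M + 1) * sqrt (1 + L\<^sup>2)"
  let ?N = "nat \<lceil>2 powr \<bar>s\<bar>\<rceil> + 1"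
  have "ennreal (sob_onorm \<Theta> s s (sob_ext \<Theta> s s (Some \<circ> cfc T f)))
      \<le> ennreal C * (\<Sum>k\<in>{0..?N}. T_norm 0 k f)" if f: "smooth_real f" for f
  proof -
    have "sob_onorm \<Theta> s s (sob_ext \<Theta> s s (Some \<circ> cfc T f)) \<le> M * tnorm (nat \<lceil>\<bar>s\<bar>\<rceil> + 2) f"
      using M(1) tnorm_nonneg by (intro cfc_sob_ext[OF f _ M(2)[OF f]] mult_nonneg_nonneg)
    also have "\<dots> \<le> (M + 1) * tnorm ?N f"
      using M(1) ceiling_le_two_powr by (intro mult_mono tnorm_mono tnorm_nonneg) auto
    finally have "ennreal (sob_onorm \<Theta> s s (sob_ext \<Theta> s s (Some \<circ> cfc T f))) \<le> ennreal ((M + 1) * tnorm ?N f)"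
      by (rule ennreal_leI)
    also have "\<dots> = ennreal (M + 1) * ennreal (tnorm ?N f)"
      using M(1) tnorm_nonneg by (intro ennreal_mult) auto
    also have "\<dots> \<le> ennreal (M + 1) * (ennreal (sqrt (1 + L\<^sup>2)) * (\<Sum>k\<in>{0..?N}. T_norm 0 k f))"
      by (intro mult_left_mono tnorm_le_T_norm f) auto
    also have "\<dots> = ennreal C * (\<Sum>k\<in>{0..?N}. T_norm 0 k f)"
      unfolding C_def using M(1) by (subst ennreal_mult) (auto simp: mult.assoc)
    finally show ?thesis .
  qed
  moreover have "C > 0" unfolding C_def using M(1) by (intro mult_pos_pos) (auto intro: add_pos_nonneg)
  ultimately show ?thesis by blast
qed

end

theorem theorem2p3p7:
  fixes \<Theta> A :: "'h::complex_hilbert \<rightharpoonup> 'h"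
  assumes separable: "\<exists>S :: 'h set. countable S \<and> closure S = UNIV"
    and "self_adjoint_pop \<Theta>" and "positive_pop \<Theta>" and "has_bounded_inverse \<Theta>"
    and "A \<in> op_class \<Theta> 0"
    and "in_op \<Theta> 0 (commutator_pop \<Theta> A)"
    and "self_adjoint_pop (Some \<circ> hilbert_ext \<Theta> A)"
  shows "(\<forall>f. smooth_real f \<longrightarrow> in_op \<Theta> 0 (Some \<circ> cfc (hilbert_ext \<Theta> A) f))
    \<and> (\<forall>s::real. \<exists>C>0. \<forall>f. smooth_real f \<longrightarrow>
         ennreal (sob_onorm \<Theta> s s (sob_ext \<Theta> s s (Some \<circ> cfc (hilbert_ext \<Theta> A) f)))
           \<le> ennreal C * (\<Sum>k\<in>{0..nat \<lceil>2 powr \<bar>s\<bar>\<rceil> + 1}. T_norm 0 k f))"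
proof -
  interpret sobolev_scale \<Theta> by standard (fact assms)+
  define T where "T = hilbert_ext \<Theta> A"
  note ext = hilbert_ext_extends[OF assms(5), folded T_def]
  interpret order_zero_op \<Theta> T
  proof
    show "bounded_selfadjoint T"
      unfolding bounded_selfadjoint_def
    proof (intro conjI allI ext(1))
      fix x y
      have "\<forall>y z. (Some \<circ> T) y = Some z \<longleftrightarrow> (\<forall>x\<in>dom (Some \<circ> T). cinner y (the ((Some \<circ> T) x)) = cinner z x)"
        using assms(7) unfolding self_adjoint_pop_def T_def by blast
      from spec[OF spec[OF this, of x], of "T x"]
      have "\<forall>y\<in>dom (Some \<circ> T). cinner x (the ((Some \<circ> T) y)) = cinner (T x) y"
        by (simp only: comp_apply simp_thms)
      then show "cinner x (T y) = cinner (T x) y" by (simp add: dom_def)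
    qed
    show "T x \<in> Hinf" if "x \<in> Hinf" for x using that by (rule ext(3))
    fix s
    let ?D = "commutator_pop \<Theta> A |` Hinf"
    have "?D \<in> op_class \<Theta> 0" using assms(6) by (simp add: in_op_def)
    then obtain C where C: "C > 0" "\<And>x. x \<in> Hinf \<Longrightarrow> norm (P s (the (?D x))) \<le> C * norm (P s x)"
      using op_class_bound by blast
    have "the (?D x) = P 1 (T x) - T (P 1 x)" if x: "x \<in> Hinf" for x
      using x ext(2)[OF x] ext(2)[OF P_Hinf[OF x]] Theta_P[OF x] Theta_P[OF ext(3)[OF x]]
      by (simp add: commutator_pop_def map_comp_def dom_def)
    then show "\<exists>C\<ge>0. \<forall>x\<in>Hinf. norm (P s (P 1 (T x) - T (P 1 x))) \<le> C * norm (P s x)"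
      using C by (intro exI[of _ C]) force
  qed
  show ?thesis using cfc_in_op cfc_sob_onorm_bound unfolding T_def by blast
qed

end
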